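(* Let $\tau,r\ge 0$ be constants, let $A\in\mathbb{R}^{n\times n}$, $B\in\mathbb{R}^{n\times m}$, $k\in\mathbb{R}^{m\times n}$, and suppose that $A+Bk$ is Hurwitz. Consider the closed-loop system $$\dot x(t)=Ax(t)+Bu(t-\tau),\qquad x(t)\in\mathbb{R}^n,\ u(t)\in\mathbb{R}^m,$$ $$u(t)=k\exp(Ar)x(t)+k\int_t^{t+r}\exp(A(t+r-s))\,B\,u(s-r)\,ds,\quad t\ge 0 .$$ The zero solution of the closed-loop system is globally exponentially stable provided that at least one of the following two conditions holds: (i) all roots $s\in\mathbb{C}$ of the equation $$\det\left(sI-(A+Bk)+Bk\exp(Ar)\left(e^{-rs}-e^{-\tau s}\right)\right)=0$$ have negative real parts; (ii) all roots $s\in\mathbb{C}$ of the equation $$\det\left(sI-(A+Bk)+\exp(Ar)Bk\left(e^{-rs}-e^{-\tau s}\right)\right)=0$$ have negative real parts.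
   Context: $I\in\mathbb{R}^{n\times n}$ is the identity matrix and $|\cdot|$ the Euclidean norm. A square matrix is Hurwitz if all its eigenvalues have negative real parts. Write $h=\max(r,\tau)$. Initial conditions are $x(0)=x_0\in\mathbb{R}^n$ and $u(t)=u_0(t)$ for $t\in[-h,0]$, with $u_0:[-h,0]\to\mathbb{R}^m$ continuous and satisfying the compatibility condition $u_0(0)=k\exp(Ar)x_0+k\int_{-r}^0\exp(-As)Bu_0(s)\,ds$; the solution then has $u$ continuous on $[-h,\infty)$. Global exponential stability of the zero solution means: there exist constants $Q,\sigma>0$ such that for all such $(x_0,u_0)$ the corresponding solution satisfies $|x(t)|+\max_{t-h\le s\le t}|u(s)|\le Q\exp(-\sigma t)\left(|x_0|+\max_{-h\le s\le 0}|u_0(s)|\right)$ for all $t\ge 0$. *)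

theory Defs
  imports "HOL-Analysis.Analysis"
begin

(* The product (times) of the type real ^ 'n ^ 'n is componentwise, so neither (^) nor exp
   gives the matrix notions; the series below converges in the normed space of matrices. *)
primrec mat_power :: "'a::semiring_1 ^ 'n ^ 'n \<Rightarrow> nat \<Rightarrow> 'a ^ 'n ^ 'n" where
  "mat_power A 0 = mat 1"
| "mat_power A (Suc j) = A ** mat_power A j"

definition mat_exp :: "real ^ 'n ^ 'n \<Rightarrow> real ^ 'n ^ 'n" where
  "mat_exp A = (\<Sum>j. mat_power A j /\<^sub>R fact j)"

abbreviation cmat :: "real ^ 'n ^ 'm \<Rightarrow> complex ^ 'n ^ 'm" where
  "cmat \<equiv> map_matrix complex_of_real"

definition eigenvalue :: "complex ^ 'n ^ 'n \<Rightarrow> complex \<Rightarrow> bool" where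
  "eigenvalue M s \<longleftrightarrow> (\<exists>v. v \<noteq> 0 \<and> M *v v = s *s v)"

definition Hurwitz :: "real ^ 'n ^ 'n \<Rightarrow> bool" where
  "Hurwitz A \<longleftrightarrow> (\<forall>s. eigenvalue (cmat A) s \<longrightarrow> Re s < 0)"

definition admissible_initial_data ::
  "real ^ 'n ^ 'n \<Rightarrow> real ^ 'm ^ 'n \<Rightarrow> real ^ 'n ^ 'm \<Rightarrow> real \<Rightarrow> real \<Rightarrow>
   real ^ 'n \<Rightarrow> (real \<Rightarrow> real ^ 'm) \<Rightarrow> bool" where
  "admissible_initial_data A B k r \<tau> x0 u0 \<longleftrightarrow>
     continuous_on {- max r \<tau>..0} u0 \<and>
     u0 0 = k *v (mat_exp (r *\<^sub>R A) *v x0)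
          + k *v integral {- r..0} (\<lambda>s. mat_exp ((- s) *\<^sub>R A) *v (B *v u0 s))"

(* Only the values of x on [0,\<infinity>) and of u on [-h,\<infinity>), h = max r \<tau>, are constrained.
   At t = 0 the derivative of x is one-sided. *)
definition closed_loop_solution ::
  "real ^ 'n ^ 'n \<Rightarrow> real ^ 'm ^ 'n \<Rightarrow> real ^ 'n ^ 'm \<Rightarrow> real \<Rightarrow> real \<Rightarrow>
   real ^ 'n \<Rightarrow> (real \<Rightarrow> real ^ 'm) \<Rightarrow>
   (real \<Rightarrow> real ^ 'n) \<Rightarrow> (real \<Rightarrow> real ^ 'm) \<Rightarrow> bool" where
  "closed_loop_solution A B k r \<tau> x0 u0 x u \<longleftrightarrow>
     x 0 = x0 \<and>
     (\<forall>t\<in>{- max r \<tau>..0}. u t = u0 t) \<and>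
     continuous_on {- max r \<tau>..} u \<and>
     (\<forall>t\<ge>0. (x has_vector_derivative (A *v x t + B *v u (t - \<tau>))) (at t within {0..})) \<and>
     (\<forall>t\<ge>0. u t = k *v (mat_exp (r *\<^sub>R A) *v x t)
        + k *v integral {t..t + r}
            (\<lambda>s. mat_exp ((t + r - s) *\<^sub>R A) *v (B *v u (s - r))))"

(* The universally quantified bound already forces uniqueness: by linearity it applies to the
   difference of two solutions with the same data, whose own initial data are zero. Together
   with the existence clause it therefore speaks about "the" solution. *)
definition globally_exponentially_stable ::
  "real ^ 'n ^ 'n \<Rightarrow> real ^ 'm ^ 'n \<Rightarrow> real ^ 'n ^ 'm \<Rightarrow> real \<Rightarrow> real \<Rightarrow> bool" where
  "globally_exponentially_stable A B k r \<tau> \<longleftrightarrow>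
     (let h = max r \<tau> in
      \<exists>Q \<sigma>. Q > 0 \<and> \<sigma> > 0 \<and>
        (\<forall>x0 u0. admissible_initial_data A B k r \<tau> x0 u0 \<longrightarrow>
           (\<exists>x u. closed_loop_solution A B k r \<tau> x0 u0 x u) \<and>
           (\<forall>x u. closed_loop_solution A B k r \<tau> x0 u0 x u \<longrightarrow>
              (\<forall>t\<ge>0. norm (x t) + (SUP s\<in>{t - h..t}. norm (u s))
                 \<le> Q * exp (- \<sigma> * t) * (norm x0 + (SUP s\<in>{- h..0}. norm (u0 s)))))))"

end

theory Submission
  imports Defs "HOL-Complex_Analysis.Conformal_Mappings" "HOL-Probability.Probability"
begin

text \<open>
  The predictor \<open>z(t) = e\<^sup>A\<^sup>r x(t) + \<integral> e\<^sup>A\<^sup>(\<^sup>t\<^sup>-\<^sup>w\<^sup>) B u(w) dw\<close>, integrated over \<open>[t - r, t]\<close>, turns the closed loop into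
  \<open>u = k z\<close> and the delay equation
  \<open>z'(t) = (A + B k) z(t) + e\<^sup>A\<^sup>r B k (z(t - \<tau>) - z(t - r))\<close> for \<open>t \<ge> max r \<tau>\<close>, whose characteristic
  equation is the one in (ii). The determinants in (i) and (ii) coincide, because
  \<open>det (X - K P) = det (X - P K)\<close> whenever \<open>X\<close> and \<open>P\<close> commute; take \<open>X = s I - A\<close>, \<open>K = B k\<close> and
  \<open>P = I - e\<^sup>A\<^sup>r (e\<^sup>-\<^sup>r\<^sup>s - e\<^sup>-\<^sup>\<tau>\<^sup>s)\<close>.

  Compactness and the growth of \<open>s I\<close> give a strip \<open>Re s \<ge> -\<epsilon>\<close> on which the characteristic matrix is
  invertible with inverse \<open>O(1 / (1 + |s|))\<close>. Hence the Laplace transform of \<open>z\<close>, up to an explicit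
  decaying term, continues to this strip as an \<open>O(|s|\<^sup>-\<^sup>2)\<close> function bounded by the initial data.
  Fourier inversion on a line far to the right, followed by shifting that line to \<open>Re s = -\<epsilon>/2\<close>,
  yields exponential decay of \<open>z\<close>, and then of \<open>u\<close> and \<open>x\<close>.
\<close>

section \<open>Matrices and the matrix exponential\<close>

text \<open>The obstacle is the initial input, which is only continuous. Up to time
  \<open>h = max r \<tau>\<close> it acts on the predictor as a forcing term, and continuity alone
  gives no decay like 1/|s| for the transform of such a term. The delay equation is therefore first
  followed up to time \<open>h\<close> with a crude exponential growth bound. On [0, h] the
  predictor is continuously differentiable, with derivative bounded through the equation, and from
  time \<open>h\<close> on the equation is homogeneous; the transform argument is applied to the
  solution restarted there, whose history is now C^1. Inside that argument the growth rate only
  secures the existence of the transform far to the right; the decay constant depends on the bound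
  for the history, not on the growth. The stability notion also asks for existence of solutions. For
  this the change of variables is read backwards: the delay equation is solved by a contraction in a
  weighted supremum norm, and then \<open>u\<close> and \<open>x\<close> are computed explicitly
  from the predictor.\<close>

lemma bounded_bilinear_matrix_vector_mult:
  "bounded_bilinear ((*v) :: 'a::{euclidean_space,real_algebra_1} ^ 'n ^ 'm \<Rightarrow> 'a ^ 'n \<Rightarrow> 'a ^ 'm)"
  unfolding bilinear_conv_bounded_bilinear[symmetric] bilinear_def
  by (intro conjI allI linearI)
    (simp_all add: vec_eq_iff matrix_vector_mult_def scaleR_sum_right sum.distrib algebra_simps)

lemma matrix_mult_scaleR_left: "(c *\<^sub>R X) ** Y = c *\<^sub>R (X ** Y)"
  and matrix_mult_scaleR_right: "X ** (c *\<^sub>R Y) = c *\<^sub>R (X ** Y)"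
  for X :: "real ^ 'n ^ 'm" and Y :: "real ^ 'p ^ 'n"
  by (simp_all add: vec_eq_iff matrix_matrix_mult_def sum_distrib_left mult_ac)

lemma bounded_bilinear_matrix_matrix_mult:
  "bounded_bilinear ((**) :: real ^ 'n ^ 'm \<Rightarrow> real ^ 'p ^ 'n \<Rightarrow> real ^ 'p ^ 'm)"
  unfolding bilinear_conv_bounded_bilinear[symmetric] bilinear_def
  by (intro conjI allI linearI)
    (simp_all add: vec_eq_iff matrix_matrix_mult_def sum_distrib_left sum.distrib algebra_simps)

lemma bounded_bilinear_vector_scalar_mult:
  "bounded_bilinear ((*s) :: complex \<Rightarrow> complex ^ 'n \<Rightarrow> complex ^ 'n)"
  unfolding bilinear_conv_bounded_bilinear[symmetric] bilinear_def
  by (intro conjI allI linearI) (simp_all add: vec_eq_iff algebra_simps)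

definition cvec :: "real ^ 'n \<Rightarrow> complex ^ 'n" where
  "cvec v = (\<chi> i. complex_of_real (v $ i))"

lemma cvec_component [simp]: "cvec v $ i = complex_of_real (v $ i)"
  by (simp add: cvec_def)

lemma bounded_linear_cvec: "bounded_linear cvec"
  unfolding linear_conv_bounded_linear[symmetric]
  by (intro linearI) (simp_all add: vec_eq_iff scaleR_conv_of_real[where 'a=complex])

lemma norm_cvec [simp]: "norm (cvec v) = norm v"
  by (simp add: norm_vec_def)

lemma cmat_mult_cvec: "cmat M *v cvec v = cvec (M *v v)"
  by (simp add: vec_eq_iff matrix_vector_mult_def)

lemma norm_vector_scalar_mult [simp]: "norm (c *s (v :: complex ^ 'n)) = norm c * norm v"
  by (simp add: norm_vec_def norm_mult L2_set_right_distrib)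

text \<open>The vector is reassembled from its components as a finite sum of \<open>axis\<close>
  vectors. Entries in an arbitrary Euclidean space allow two successive uses on a matrix, first for
  the rows and then for the scalars in them.\<close>

lemma has_vector_derivative_vec_component:
  fixes f :: "real \<Rightarrow> 'a::euclidean_space ^ 'n"
  assumes "\<And>i. ((\<lambda>t. f t $ i) has_vector_derivative f' $ i) F"
  shows "(f has_vector_derivative f') F"
proof -
  have ax: "bounded_linear (axis i :: 'a \<Rightarrow> 'a ^ 'n)" for i :: 'n
    unfolding linear_conv_bounded_linear[symmetric]
    by (intro linearI) (simp_all add: axis_def vec_eq_iff)
  have eq: "(\<Sum>i\<in>UNIV. axis i (v $ i)) = v" for v :: "'a ^ 'n"
    by (simp add: vec_eq_iff axis_def if_distrib cong: if_cong)
  have "((\<lambda>t. \<Sum>i\<in>UNIV. axis i (f t $ i)) has_vector_derivative (\<Sum>i\<in>UNIV. axis i (f' $ i))) F"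
    by (intro has_vector_derivative_sum bounded_linear.has_vector_derivative[OF ax] assms)
  then show ?thesis by (simp only: eq)
qed

section \<open>The matrix exponential: convergence, derivative, group law\<close>

lemma mat_power_scaleR: "mat_power (t *\<^sub>R A) j = t ^ j *\<^sub>R mat_power A j"
  for A :: "real ^ 'n ^ 'n"
  by (induction j) (simp_all add: matrix_mult_scaleR_left matrix_mult_scaleR_right mult.commute)

lemma mat_power_commute: "mat_power A j ** A = A ** mat_power A j"
  for A :: "real ^ 'n ^ 'n"
  by (induction j) (simp_all add: matrix_mul_assoc[symmetric])

lemma summable_mat_exp: "summable (\<lambda>j. mat_power A j /\<^sub>R fact j)"
  for A :: "real ^ 'n ^ 'n"
proof -
  \<comment> \<open>The bilinear bound supplies some factor \<open>K\<close> for products of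
    matrices; it is absorbed by comparing with the scalar exponential series at
    \<open>norm A * K\<close>.\<close>
  obtain K where K: "K > 0" "\<And>(X :: real ^ 'n ^ 'n) (Y :: real ^ 'n ^ 'n). norm (X ** Y) \<le> norm X * norm Y * K"
    using bounded_bilinear.pos_bounded[OF bounded_bilinear_matrix_matrix_mult] by metis
  have pw: "norm (mat_power A j) \<le> norm (mat 1 :: real ^ 'n ^ 'n) * (norm A * K) ^ j" for j
  proof (induction j)
    case (Suc j)
    have "norm (mat_power A (Suc j)) \<le> (norm A * K) * norm (mat_power A j)"
      using K(2)[of A "mat_power A j"] by (simp add: mult.commute mult.left_commute)
    also have "\<dots> \<le> (norm A * K) * (norm (mat 1 :: real ^ 'n ^ 'n) * (norm A * K) ^ j)"
      using K(1) by (intro mult_left_mono Suc.IH) auto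
    finally show ?case by (simp add: mult.left_commute)
  qed simp
  show ?thesis
  proof (rule summable_comparison_test'[where N=0])
    show "summable (\<lambda>j. norm (mat 1 :: real ^ 'n ^ 'n) * ((norm A * K) ^ j /\<^sub>R fact j))"
      by (intro summable_mult summable_exp_generic)
    show "norm (mat_power A j /\<^sub>R fact j) \<le> norm (mat 1 :: real ^ 'n ^ 'n) * ((norm A * K) ^ j /\<^sub>R fact j)"
      for j using pw[of j] by (simp add: field_simps)
  qed
qed

lemma mat_exp_component:
  fixes A :: "real ^ 'n ^ 'n"
  shows "(\<lambda>n. (mat_power A n $ i $ j / fact n) * t ^ n) sums (mat_exp (t *\<^sub>R A) $ i $ j)"
proof -
  have "bounded_linear (\<lambda>X :: real ^ 'n ^ 'n. X $ i $ j)"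
    using bounded_linear_compose[OF bounded_linear_vec_nth bounded_linear_vec_nth] .
  from bounded_linear.sums[OF this summable_sums[OF summable_mat_exp[of "t *\<^sub>R A"]]]
  show ?thesis by (simp add: mat_exp_def mat_power_scaleR field_simps)
qed

lemma mat_exp_mult_sums:
  fixes A :: "real ^ 'n ^ 'n"
  shows "(\<lambda>n. A ** (mat_power A n /\<^sub>R fact n)) sums (A ** mat_exp A)"
    and "(\<lambda>n. (mat_power A n /\<^sub>R fact n) ** A) sums (mat_exp A ** A)"
  unfolding mat_exp_def
  by (intro bounded_linear.sums[OF bounded_bilinear.bounded_linear_right[OF bounded_bilinear_matrix_matrix_mult]]
      bounded_linear.sums[OF bounded_bilinear.bounded_linear_left[OF bounded_bilinear_matrix_matrix_mult]]
      summable_sums summable_mat_exp)+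

lemma mat_exp_commute_self: "mat_exp A ** A = A ** mat_exp A" for A :: "real ^ 'n ^ 'n"
proof (rule sums_unique2[OF mat_exp_mult_sums(2)])
  show "(\<lambda>n. (mat_power A n /\<^sub>R fact n) ** A) sums (A ** mat_exp A)"
    using mat_exp_mult_sums(1)[of A]
    by (simp add: mat_power_commute matrix_mult_scaleR_left matrix_mult_scaleR_right)
qed

lemma mat_exp_0 [simp]: "mat_exp (0 :: real ^ 'n ^ 'n) = mat 1"
proof -
  have "mat_exp (0 :: real ^ 'n ^ 'n) = (\<Sum>j\<in>{0}. mat_power 0 j /\<^sub>R fact j)"
    unfolding mat_exp_def
  proof (rule suminf_finite)
    show "mat_power 0 j /\<^sub>R fact j = (0 :: real ^ 'n ^ 'n)" if "j \<notin> {0}" for j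
      using that by (cases j) auto
  qed simp
  then show ?thesis by simp
qed

lemma mat_exp_commute: "mat_exp (t *\<^sub>R A) ** A = A ** mat_exp (t *\<^sub>R A)" for A :: "real ^ 'n ^ 'n"
proof (cases "t = 0")
  case False
  have "t *\<^sub>R (mat_exp (t *\<^sub>R A) ** A) = t *\<^sub>R (A ** mat_exp (t *\<^sub>R A))"
    using mat_exp_commute_self[of "t *\<^sub>R A"]
    by (simp add: matrix_mult_scaleR_left matrix_mult_scaleR_right)
  with False show ?thesis by simp
qed simp

text \<open>Every entry is a scalar power series in \<open>t\<close> that converges everywhere, so
  it may be differentiated term by term. The index shift in \<open>diffs\<close> turns the
  coefficient of A^n into that of A^(n+1) = A A^n, which is where the left factor \<open>A\<close>
  comes from.\<close>

lemma mat_exp_has_vector_derivative: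
  fixes A :: "real ^ 'n ^ 'n"
  shows "((\<lambda>t. mat_exp (t *\<^sub>R A)) has_vector_derivative (A ** mat_exp (t *\<^sub>R A))) (at t within S)"
proof (intro has_vector_derivative_vec_component)
  fix i j
  define c where "c n = mat_power A n $ i $ j / fact n" for n
  have c: "(\<lambda>n. c n * y ^ n) sums (mat_exp (y *\<^sub>R A) $ i $ j)" for y
    unfolding c_def by (rule mat_exp_component)
  have "((\<lambda>y. \<Sum>n. c n * y ^ n) has_field_derivative (\<Sum>n. diffs c n * t ^ n)) (at t)"
    by (rule termdiffs_strong_converges_everywhere) (use c in \<open>auto simp: sums_iff\<close>)
  moreover have "(\<lambda>y. \<Sum>n. c n * y ^ n) = (\<lambda>y. mat_exp (y *\<^sub>R A) $ i $ j)"
    using c by (auto simp: sums_iff)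
  moreover have "(\<lambda>n. diffs c n * t ^ n) sums ((A ** mat_exp (t *\<^sub>R A)) $ i $ j)"
  proof -
    have "(\<lambda>n. \<Sum>l\<in>UNIV. A $ i $ l * ((mat_power A n $ l $ j / fact n) * t ^ n))
        sums (\<Sum>l\<in>UNIV. A $ i $ l * mat_exp (t *\<^sub>R A) $ l $ j)"
      by (intro sums_sum sums_mult mat_exp_component)
    moreover have "diffs c n * t ^ n = (\<Sum>l\<in>UNIV. A $ i $ l * ((mat_power A n $ l $ j / fact n) * t ^ n))" for n
    proof -
      have "diffs c n = (A ** mat_power A n) $ i $ j / fact n"
        by (simp add: diffs_def c_def field_simps del: of_nat_Suc)
      then show ?thesis by (simp add: matrix_matrix_mult_def sum_distrib_left sum_divide_distrib field_simps)
    qed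
    ultimately show ?thesis by (simp add: matrix_matrix_mult_def)
  qed
  ultimately show "((\<lambda>t. mat_exp (t *\<^sub>R A) $ i $ j) has_vector_derivative (A ** mat_exp (t *\<^sub>R A)) $ i $ j) (at t within S)"
    by (auto simp: sums_iff has_real_derivative_iff_has_vector_derivative[symmetric]
        intro: has_field_derivative_at_within)
qed

lemma mat_exp_has_vector_derivative_compose:
  fixes A :: "real ^ 'n ^ 'n"
  assumes "(f has_real_derivative f') (at t within S)"
  shows "((\<lambda>t. mat_exp (f t *\<^sub>R A)) has_vector_derivative f' *\<^sub>R (A ** mat_exp (f t *\<^sub>R A))) (at t within S)"
  using vector_diff_chain_within[OF assms[unfolded has_real_derivative_iff_has_vector_derivative]
      mat_exp_has_vector_derivative[of A "f t" "f ` S"]]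
  by (simp add: o_def)

text \<open>The product of exp(-xA) and exp((x+b)A) has derivative zero in x, because
  \<open>A\<close> commutes with its exponentials, so it keeps its value at x = 0. The case b = 0
  shows that exp(-xA) is an inverse, which then moves to the other side.\<close>

lemma mat_exp_add: "mat_exp ((s + t) *\<^sub>R A) = mat_exp (s *\<^sub>R A) ** mat_exp (t *\<^sub>R A)"
  for A :: "real ^ 'n ^ 'n"
proof -
  have *: "mat_exp ((- a) *\<^sub>R A) ** mat_exp ((a + b) *\<^sub>R A) = mat_exp (b *\<^sub>R A)" for a b
  proof -
    let ?f = "\<lambda>x. mat_exp ((- x) *\<^sub>R A) ** mat_exp ((x + b) *\<^sub>R A)"
    have "(?f has_vector_derivative 0) (at x within UNIV)" for x
    proof -
      have d1: "((\<lambda>x. mat_exp ((- x) *\<^sub>R A)) has_vector_derivative ((-1) *\<^sub>R (A ** mat_exp ((- x) *\<^sub>R A)))) (at x)"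
        by (rule mat_exp_has_vector_derivative_compose) (auto intro!: derivative_eq_intros)
      have d2: "((\<lambda>x. mat_exp ((x + b) *\<^sub>R A)) has_vector_derivative (1 *\<^sub>R (A ** mat_exp ((x + b) *\<^sub>R A)))) (at x)"
        by (rule mat_exp_has_vector_derivative_compose) (auto intro!: derivative_eq_intros)
      have "(?f has_vector_derivative (mat_exp ((- x) *\<^sub>R A) ** (1 *\<^sub>R (A ** mat_exp ((x + b) *\<^sub>R A)))
         + ((-1) *\<^sub>R (A ** mat_exp ((- x) *\<^sub>R A))) ** mat_exp ((x + b) *\<^sub>R A))) (at x)"
        by (rule bounded_bilinear.has_vector_derivative[OF bounded_bilinear_matrix_matrix_mult d1 d2])
      moreover have "mat_exp ((- x) *\<^sub>R A) ** (1 *\<^sub>R (A ** mat_exp ((x + b) *\<^sub>R A)))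
         + ((-1) *\<^sub>R (A ** mat_exp ((- x) *\<^sub>R A))) ** mat_exp ((x + b) *\<^sub>R A) = 0"
        using mat_exp_commute[of "- x" A]
        by (simp add: matrix_mul_assoc bounded_bilinear.minus_left[OF bounded_bilinear_matrix_matrix_mult])
      ultimately show ?thesis by simp
    qed
    then obtain c where c: "\<And>x. ?f x = c"
      using has_vector_derivative_zero_constant[of UNIV ?f] by auto
    have "?f 0 = mat_exp (b *\<^sub>R A)" by simp
    with c[of 0] c[of a] show ?thesis by simp
  qed
  have "mat_exp (s *\<^sub>R A) ** mat_exp (t *\<^sub>R A)
      = mat_exp (s *\<^sub>R A) ** (mat_exp ((- s) *\<^sub>R A) ** mat_exp ((s + t) *\<^sub>R A))"
    by (simp only: *)
  also have "\<dots> = (mat_exp ((- (- s)) *\<^sub>R A) ** mat_exp ((- s + 0) *\<^sub>R A)) ** mat_exp ((s + t) *\<^sub>R A)"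
    by (simp add: matrix_mul_assoc)
  also have "\<dots> = mat_exp ((s + t) *\<^sub>R A)" by (subst *) simp
  finally show ?thesis ..
qed

lemma mat_exp_minus_mult [simp]: "mat_exp (- (t *\<^sub>R A)) ** mat_exp (t *\<^sub>R A) = mat 1"
  and mat_exp_mult_minus [simp]: "mat_exp (t *\<^sub>R A) ** mat_exp (- (t *\<^sub>R A)) = mat 1"
  for A :: "real ^ 'n ^ 'n"
  using mat_exp_add[of "- t" t A] mat_exp_add[of t "- t" A] by simp_all

lemma continuous_mat_exp [continuous_intros]:
  fixes A :: "real ^ 'n ^ 'n"
  assumes "continuous_on S f"
  shows "continuous_on S (\<lambda>t. mat_exp (f t *\<^sub>R A))"
proof -
  have "continuous_on UNIV (\<lambda>t. mat_exp (t *\<^sub>R A))"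
    using mat_exp_has_vector_derivative by (intro continuous_on_vector_derivative) blast
  from continuous_on_compose2[OF this assms] show ?thesis by simp
qed

section \<open>The characteristic matrix\<close>

lemma det_eq_0_ker: "det A = 0 \<longleftrightarrow> (\<exists>v. v \<noteq> 0 \<and> A *v v = 0)"
  for A :: "'a::field ^ 'n ^ 'n"
  using invertible_det_nz[of A] matrix_left_invertible_ker[of A] invertible_left_inverse[of A] by blast

lemma holomorphic_on_det:
  fixes A :: "complex \<Rightarrow> complex ^ 'n ^ 'n"
  assumes "\<And>i j. (\<lambda>s. A s $ i $ j) holomorphic_on S"
  shows "(\<lambda>s. det (A s)) holomorphic_on S"
  unfolding det_def by (intro holomorphic_intros assms)

lemma matrix_mult_diff_left: "(X - Y) ** Z = X ** Z - Y ** Z"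
  and matrix_mult_diff_right: "W ** (X - Y) = W ** X - W ** Y"
  for X Y :: "'a::ring_1 ^ 'n ^ 'm" and Z :: "'a ^ 'p ^ 'n" and W :: "'a ^ 'm ^ 'p"
  by (simp_all add: vec_eq_iff matrix_matrix_mult_def sum_subtractf algebra_simps)

lemma matrix_mult_add_left: "(X + Y) ** Z = X ** Z + Y ** Z"
  for X Y :: "'a::semiring_1 ^ 'n ^ 'm" and Z :: "'a ^ 'p ^ 'n"
  by (simp add: vec_eq_iff matrix_matrix_mult_def sum.distrib distrib_right)

lemma mat_matrix_mult_commute: "mat c ** X = X ** mat c" for X :: "'a::comm_ring_1 ^ 'n ^ 'n"
  by (simp add: vec_eq_iff matrix_matrix_mult_def mat_def if_distrib if_distribR mult.commute cong: if_cong)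

lemma cmat_mult: "cmat (X ** Y) = cmat X ** cmat Y"
  by (simp add: vec_eq_iff matrix_matrix_mult_def)

lemma cmat_add: "cmat (X + Y) = cmat X + cmat Y"
  by (simp add: vec_eq_iff)

lemma mat_vector_mult: "mat c *v v = c *s v" for v :: "'a::comm_ring_1 ^ 'n"
  by (simp add: vec_eq_iff matrix_vector_mult_def mat_def if_distrib if_distribR cong: if_cong)

text \<open>If \<open>P\<close> is invertible this is \<open>P (X - K P) = (X - P K) P\<close>; the general case perturbs \<open>P\<close> by a scalar.\<close>

lemma det_diff_commute:
  fixes X P K :: "complex ^ 'n ^ 'n"
  assumes comm: "X ** P = P ** X"
  shows "det (X - K ** P) = det (X - P ** K)"
proof (rule ccontr)
  assume ne: "det (X - K ** P) \<noteq> det (X - P ** K)"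
  define P' where "P' \<eta> = P + mat \<eta>" for \<eta>
  define D where "D \<eta> = det (X - K ** P' \<eta>) - det (X - P' \<eta> ** K)" for \<eta>
  have entry: "(\<lambda>\<eta>. P' \<eta> $ i $ j) holomorphic_on UNIV" for i j
    unfolding P'_def by (cases "i = j") (auto simp: mat_def intro!: holomorphic_intros)
  have holf: "(\<lambda>\<eta>. det (P' \<eta>)) holomorphic_on UNIV"
    by (intro holomorphic_on_det entry)
  have holD: "D holomorphic_on UNIV"
    unfolding D_def by (intro holomorphic_intros holomorphic_on_det)
      (auto simp: matrix_matrix_mult_def intro!: holomorphic_intros entry)
  have zero: "det (P' \<eta>) * D \<eta> = 0" for \<eta>
  proof -
    have "P' \<eta> ** X = X ** P' \<eta>"
      unfolding P'_def matrix_mult_add_left matrix_add_ldistrib comm mat_matrix_mult_commute[of \<eta> X] ..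
    then have "P' \<eta> ** (X - K ** P' \<eta>) = (X - P' \<eta> ** K) ** P' \<eta>"
      by (simp only: matrix_mult_diff_left matrix_mult_diff_right matrix_mul_assoc)
    from arg_cong[OF this, of det] show ?thesis
      by (simp add: det_mul D_def algebra_simps)
  qed
  \<comment> \<open>A nonzero value at 0 persists on an open set, where \<open>zero\<close> forces
    the determinant of \<open>P'\<close> to vanish. By the identity theorem that determinant then
    vanishes on the whole plane.\<close>
  have "D 0 \<noteq> 0" using ne by (simp add: D_def P'_def)
  then have "0 \<in> D -` (- {0})" by simp
  moreover have op: "open (D -` (- {0}))"
    using holD by (intro open_vimage holomorphic_on_imp_continuous_on) auto
  ultimately have "det (P' \<eta>) = 0" for \<eta>
    using analytic_continuation_open[of "D -` (- {0})" UNIV "\<lambda>\<eta>. det (P' \<eta>)" "\<lambda>_. 0" \<eta>] zero holf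
    by auto
  moreover obtain \<kappa> where \<kappa>: "\<And>v. norm (P *v v) \<le> norm v * \<kappa>"
    using bounded_linear.bounded[OF matrix_vector_mul_bounded_linear[of P]] by blast
  \<comment> \<open>The contradiction comes from a scalar beyond the operator bound of
    \<open>P\<close>: a kernel vector of \<open>P'\<close> would satisfy |P v| = (|\<kappa>| + 1)
    |v|, more than \<kappa> |v|.\<close>
  ultimately obtain v where v: "v \<noteq> 0" "P' (complex_of_real (\<bar>\<kappa>\<bar> + 1)) *v v = 0"
    using det_eq_0_ker by metis
  define c where "c = complex_of_real (\<bar>\<kappa>\<bar> + 1)"
  have "P' c *v v = 0" using v(2) by (simp only: c_def)
  then have "P *v v = - (c *s v)"
    by (simp add: P'_def matrix_vector_mult_add_rdistrib mat_vector_mult eq_neg_iff_add_eq_0)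
  then have "norm (P *v v) = norm c * norm v" by simp
  also have "norm c = \<bar>\<kappa>\<bar> + 1" unfolding c_def by (subst norm_of_real) simp
  finally have "(\<bar>\<kappa>\<bar> + 1) * norm v \<le> norm v * \<kappa>" using \<kappa>[of v] by simp
  moreover have "norm v * \<kappa> < (\<bar>\<kappa>\<bar> + 1) * norm v" using v(1) by (subst mult.commute) (intro mult_strict_right_mono, auto)
  ultimately show False by simp
qed

text \<open>\<open>N\<close> is left free so that both characteristic equations are instances: with
  \<open>E = mat_exp (r *\<^sub>R A)\<close> it is \<open>B ** k ** E\<close> in (i) and
  \<open>E ** B ** k\<close> in (ii).\<close>

definition char_mat :: "real ^ 'n ^ 'n \<Rightarrow> real ^ 'n ^ 'n \<Rightarrow> real \<Rightarrow> real \<Rightarrow> complex \<Rightarrow> complex ^ 'n ^ 'n" where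
  "char_mat M N r \<tau> s = mat s - cmat M + cmat N ** mat (exp (- of_real r * s) - exp (- of_real \<tau> * s))"

lemma char_mat_mult:
  "char_mat M N r \<tau> s *v v = s *s v - cmat M *v v + (exp (- of_real r * s) - exp (- of_real \<tau> * s)) *s (cmat N *v v)"
  by (simp add: char_mat_def matrix_vector_mult_add_rdistrib matrix_vector_mult_diff_rdistrib
      mat_vector_mult matrix_vector_mul_assoc[symmetric] vector_scalar_commute matrix_vector_mult_diff_distrib)

lemma det_char_mat_commute:
  fixes A E K :: "real ^ 'n ^ 'n"
  assumes "E ** A = A ** E"
  shows "det (char_mat (A + K) (K ** E) r \<tau> s) = det (char_mat (A + K) (E ** K) r \<tau> s)"
proof -
  define \<phi> where "\<phi> = exp (- of_real r * s) - exp (- of_real \<tau> * s)"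
  define X where "X = mat s - cmat A"
  define P where "P = mat 1 - cmat E ** mat \<phi>"
  have E: "cmat E ** cmat A = cmat A ** cmat E" by (simp flip: cmat_mult add: assms)
  have A: "cmat A ** (cmat E ** mat \<phi>) = (cmat E ** mat \<phi>) ** cmat A"
    by (metis E mat_matrix_mult_commute matrix_mul_assoc)
  have K: "(cmat E ** mat \<phi>) ** cmat K = (cmat E ** cmat K) ** mat \<phi>"
    by (metis mat_matrix_mult_commute matrix_mul_assoc)
  have "X ** P = P ** X"
    unfolding X_def P_def matrix_mult_diff_left matrix_mult_diff_right
      A mat_matrix_mult_commute[of s "cmat E ** mat \<phi>"] matrix_mul_lid matrix_mul_rid by simp
  note det_diff_commute[OF this, of "cmat K"]
  moreover have "X - cmat K ** P = char_mat (A + K) (K ** E) r \<tau> s"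
    unfolding char_mat_def X_def P_def \<phi>_def matrix_mult_diff_right cmat_mult cmat_add matrix_mul_assoc
    by simp
  moreover have "X - P ** cmat K = char_mat (A + K) (E ** K) r \<tau> s"
    unfolding char_mat_def X_def P_def matrix_mult_diff_left K cmat_mult cmat_add
    by (simp add: \<phi>_def)
  ultimately show ?thesis by simp
qed

section \<open>A uniform lower bound for the characteristic matrix on a strip\<close>

lemma norm_exp_delay_le:
  assumes "Re s \<ge> -1" "r \<ge> 0"
  shows "norm (exp (- of_real r * s)) \<le> exp r"
proof -
  have "- (r * Re s) \<le> r" using mult_left_mono[OF assms] by simp
  then show ?thesis by (simp add: norm_exp_eq_Re)
qed

lemma continuous_on_char_mat_mult:
  "continuous_on S (\<lambda>p. char_mat M N r \<tau> (fst p) *v snd p)"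
  unfolding char_mat_mult
  by (intro continuous_intros bounded_bilinear.continuous_on[OF bounded_bilinear_vector_scalar_mult]
      bounded_linear.continuous_on[OF matrix_vector_mul_bounded_linear])

lemma holomorphic_char_mat_component: "(\<lambda>s. char_mat M N r \<tau> s $ i $ j) holomorphic_on S"
  unfolding char_mat_def
  by (cases "i = j")
    (auto simp: matrix_matrix_mult_def mat_def if_distrib if_distribR cong: if_cong intro!: holomorphic_intros)

text \<open>Negative real parts alone would allow roots to approach the imaginary axis at infinity.
  This is excluded because the delay exponentials are bounded on Re s >= -1, so there all roots lie
  in one disc and their real parts stay away from 0. On the remaining compact set of pairs of a
  point \<open>s\<close> and a unit vector, the norm attains a positive minimum.\<close>

lemma char_mat_coercive:
  fixes M N :: "real ^ 'n ^ 'n"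
  assumes r: "r \<ge> 0" and \<tau>: "\<tau> \<ge> 0"
    and roots: "\<And>s. det (char_mat M N r \<tau> s) = 0 \<Longrightarrow> Re s < 0"
  obtains \<epsilon> c where "0 < \<epsilon>" "\<epsilon> \<le> 1 / 2" "c > 0"
    "\<And>s v. Re s \<ge> - \<epsilon> \<Longrightarrow> norm (char_mat M N r \<tau> s *v v) \<ge> c * (1 + norm s) * norm v"
proof -
  obtain m where m: "m \<ge> 0" "\<And>v. norm (cmat M *v v) \<le> norm v * m"
    using bounded_linear.nonneg_bounded[OF matrix_vector_mul_bounded_linear[of "cmat M"]] by blast
  obtain n where n: "n \<ge> 0" "\<And>v. norm (cmat N *v v) \<le> norm v * n"
    using bounded_linear.nonneg_bounded[OF matrix_vector_mul_bounded_linear[of "cmat N"]] by blast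
  define \<kappa> where "\<kappa> = m + (exp r + exp \<tau>) * n"
  have \<kappa>0: "\<kappa> \<ge> 0" using m n by (simp add: \<kappa>_def)
  have lower: "norm (char_mat M N r \<tau> s *v v) \<ge> (norm s - \<kappa>) * norm v" if "Re s \<ge> -1" for s v
  proof -
    let ?\<phi> = "exp (- of_real r * s) - exp (- of_real \<tau> * s)"
    have \<phi>: "norm ?\<phi> \<le> exp r + exp \<tau>"
      by (rule order_trans[OF norm_triangle_ineq4]) (intro add_mono norm_exp_delay_le that r \<tau>)
    have "norm (?\<phi> *s (cmat N *v v)) \<le> (exp r + exp \<tau>) * (norm v * n)"
      unfolding norm_vector_scalar_mult by (intro mult_mono \<phi> n) auto
    moreover have "norm (s *s v) \<le> norm (char_mat M N r \<tau> s *v v) + norm (cmat M *v v) + norm (?\<phi> *s (cmat N *v v))"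
    proof -
      have "s *s v = char_mat M N r \<tau> s *v v + cmat M *v v - ?\<phi> *s (cmat N *v v)"
        by (simp add: char_mat_mult)
      then show ?thesis
        using norm_triangle_ineq4[of "char_mat M N r \<tau> s *v v + cmat M *v v" "?\<phi> *s (cmat N *v v)"]
          norm_triangle_ineq[of "char_mat M N r \<tau> s *v v" "cmat M *v v"] by simp
    qed
    ultimately show ?thesis using m(2)[of v] by (simp add: \<kappa>_def algebra_simps)
  qed
  \<comment> \<open>The radius from which |s| - \<kappa> >= (1 + |s|) / 2.\<close>
  define R where "R = 2 * \<kappa> + 1"
  have large: "norm (char_mat M N r \<tau> s *v v) \<ge> 1 / 2 * (1 + norm s) * norm v" if "Re s \<ge> -1" "norm s \<ge> R" for s v
    by (rule order_trans[OF mult_right_mono lower]) (use that in \<open>auto simp: R_def\<close>)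
  \<comment> \<open>By \<open>large\<close>, roots with Re s >= -1 have norm below \<open>R\<close>,
    so \<open>Z\<close> contains all of them. It is compact, hence the largest real part is attained
    at a root and is negative.\<close>
  define Z where "Z = cball 0 R \<inter> {s. Re s \<ge> -1} \<inter> (\<lambda>s. det (char_mat M N r \<tau> s)) -` {0}"
  have contdet: "continuous_on UNIV (\<lambda>s. det (char_mat M N r \<tau> s))"
    by (intro holomorphic_on_imp_continuous_on holomorphic_on_det holomorphic_char_mat_component)
  have Zc: "compact Z"
    unfolding Z_def by (intro compact_Int_closed compact_cball closed_halfspace_Re_ge closed_vimage contdet closed_singleton)
  obtain \<epsilon>0 where \<epsilon>0: "\<epsilon>0 > 0" "\<And>s. s \<in> Z \<Longrightarrow> Re s \<le> - \<epsilon>0"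
  proof (cases "Z = {}")
    case True
    show ?thesis by (rule that[of 1]) (simp_all only: True empty_iff zero_less_one)
  next
    case False
    have "continuous_on Z Re" by (intro continuous_intros)
    from continuous_attains_sup[OF Zc False this]
    obtain z where z: "z \<in> Z" "\<And>s. s \<in> Z \<Longrightarrow> Re s \<le> Re z" by blast
    have "Re z < 0" using z(1) by (intro roots) (simp add: Z_def)
    with z(2) show ?thesis by (intro that[of "- Re z"]) auto
  qed
  \<comment> \<open>Halving \<epsilon>0 leaves the closed strip Re s >= -\<epsilon> free of roots.
    The cap 1/2 keeps the strip away from s = -1, the pole of the transform of exp(-t).\<close>
  define \<epsilon> where "\<epsilon> = min (1 / 2) (\<epsilon>0 / 2)"
  have \<epsilon>: "0 < \<epsilon>" "\<epsilon> \<le> 1 / 2" "\<epsilon> < \<epsilon>0" using \<epsilon>0 by (auto simp: \<epsilon>_def)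
  define S where "S = (cball 0 R \<inter> {s. Re s \<ge> - \<epsilon>}) \<times> sphere (0 :: complex ^ 'n) 1"
  have "compact S"
    unfolding S_def by (intro compact_Times compact_Int_closed compact_cball closed_halfspace_Re_ge compact_sphere)
  moreover have "S \<noteq> {}"
  proof -
    have "(0, axis undefined 1) \<in> S" using \<kappa>0 \<epsilon>(1) by (simp add: S_def R_def)
    then show ?thesis by auto
  qed
  ultimately obtain p where p: "p \<in> S"
    "\<And>q. q \<in> S \<Longrightarrow> norm (char_mat M N r \<tau> (fst p) *v snd p) \<le> norm (char_mat M N r \<tau> (fst q) *v snd q)"
    using continuous_attains_inf[of S "\<lambda>p. norm (char_mat M N r \<tau> (fst p) *v snd p)"]
      continuous_on_norm[OF continuous_on_char_mat_mult[of S M N r \<tau>]] by blast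
  define \<mu> where "\<mu> = norm (char_mat M N r \<tau> (fst p) *v snd p)"
  have "\<mu> > 0"
  proof (rule ccontr)
    assume "\<not> \<mu> > 0"
    then have "char_mat M N r \<tau> (fst p) *v snd p = 0" by (simp add: \<mu>_def)
    moreover have "snd p \<noteq> 0" using p(1) by (auto simp: S_def)
    ultimately have "det (char_mat M N r \<tau> (fst p)) = 0" using det_eq_0_ker by blast
    then have "fst p \<in> Z" using p(1) \<epsilon> by (auto simp: S_def Z_def)
    with \<epsilon>0(2) p(1) \<epsilon>(3) show False by (force simp: S_def)
  qed
  have small: "norm (char_mat M N r \<tau> s *v v) \<ge> \<mu> / (1 + R) * (1 + norm s) * norm v"
    if s: "Re s \<ge> - \<epsilon>" "norm s \<le> R" for s v
  proof (cases "v = 0")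
    case False
    have "(s, v /\<^sub>R norm v) \<in> S" using s False by (auto simp: S_def)
    from p(2)[OF this] have "\<mu> \<le> norm (char_mat M N r \<tau> s *v (v /\<^sub>R norm v))" by (simp add: \<mu>_def)
    also have "\<dots> = norm (char_mat M N r \<tau> s *v v) / norm v"
      by (simp add: linear_cmul[OF bounded_linear.linear[OF matrix_vector_mul_bounded_linear]] divide_inverse mult.commute)
    finally have "\<mu> * norm v \<le> norm (char_mat M N r \<tau> s *v v)" using False by (simp add: field_simps)
    moreover have "\<mu> / (1 + R) * (1 + norm s) \<le> \<mu> / (1 + R) * (1 + R)"
      using s \<open>\<mu> > 0\<close> \<kappa>0 by (intro mult_left_mono) (auto simp: R_def)
    then have "\<mu> / (1 + R) * (1 + norm s) \<le> \<mu>" using \<kappa>0 by (simp add: R_def)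
    then have "\<mu> / (1 + R) * (1 + norm s) * norm v \<le> \<mu> * norm v" by (rule mult_right_mono) simp
    ultimately show ?thesis by simp
  qed simp
  define c where "c = min (1 / 2) (\<mu> / (1 + R))"
  have c: "c > 0" "c \<le> 1 / 2" "c \<le> \<mu> / (1 + R)"
    using \<open>\<mu> > 0\<close> \<kappa>0 unfolding c_def by (simp_all only: min.cobounded1 min.cobounded2) (simp add: R_def)
  show ?thesis
  proof (rule that[OF \<epsilon>(1,2) c(1)])
    fix s v assume s: "Re s \<ge> - \<epsilon>"
    show "norm (char_mat M N r \<tau> s *v v) \<ge> c * (1 + norm s) * norm v"
    proof (cases "norm s \<le> R")
      case True
      have "c * (1 + norm s) * norm v \<le> \<mu> / (1 + R) * (1 + norm s) * norm v"
        by (intro mult_right_mono c) auto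
      with small[OF s True, of v] show ?thesis by simp
    next
      case False
      have "c * (1 + norm s) * norm v \<le> 1 / 2 * (1 + norm s) * norm v"
        by (intro mult_right_mono c) auto
      moreover have "norm (char_mat M N r \<tau> s *v v) \<ge> 1 / 2 * (1 + norm s) * norm v"
        by (rule large) (use s False \<epsilon> in auto)
      ultimately show ?thesis by simp
    qed
  qed
qed

text \<open>Cramer's rule writes each component of the solution as a quotient of determinants with
  holomorphic entries, so no holomorphic inverse matrix has to be constructed.\<close>

lemma char_mat_solution_holomorphic:
  assumes nz: "\<And>s. s \<in> S \<Longrightarrow> det (char_mat M N r \<tau> s) \<noteq> 0"
    and hol: "\<And>i. (\<lambda>s. F s $ i) holomorphic_on S"
  obtains Y where "\<And>s v. s \<in> S \<Longrightarrow> char_mat M N r \<tau> s *v v = F s \<longleftrightarrow> v = Y s"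
    "\<And>i. (\<lambda>s. Y s $ i) holomorphic_on S"
proof -
  define Y where "Y s = (\<chi> k. det (\<chi> i j. if j = k then F s $ i else char_mat M N r \<tau> s $ i $ j)
      / det (char_mat M N r \<tau> s))" for s
  have "char_mat M N r \<tau> s *v v = F s \<longleftrightarrow> v = Y s" if "s \<in> S" for s v
    unfolding Y_def using cramer[OF nz[OF that]] .
  moreover have "(\<lambda>s. Y s $ k) holomorphic_on S" for k
  proof -
    have ent: "(\<lambda>s. (\<chi> i j. if j = k then F s $ i else char_mat M N r \<tau> s $ i $ j) $ i $ j) holomorphic_on S" for i j
      by (cases "j = k") (simp_all add: hol holomorphic_char_mat_component)
    then show ?thesis
      unfolding Y_def vec_lambda_beta
      by (intro holomorphic_on_divide holomorphic_on_det ent nz holomorphic_char_mat_component)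
  qed
  ultimately show ?thesis using that by blast
qed

section \<open>Fourier inversion and shifting vertical lines\<close>

text \<open>This is the characteristic function of the standard normal distribution at
  \<open>y / \<delta>\<close>, after rescaling the integration variable by
  \<open>\<delta>\<close>.\<close>

lemma integral_iexp_gauss:
  fixes \<delta> y :: real
  assumes "\<delta> > 0"
  shows "(LBINT w. iexp (w * y) * complex_of_real (exp (- (\<delta> * w)\<^sup>2 / 2)))
         = complex_of_real (sqrt (2 * pi) / \<delta> * exp (- (y / \<delta>)\<^sup>2 / 2))"
proof -
  have "complex_of_real (exp (- (y / \<delta>)\<^sup>2 / 2)) = char std_normal_distribution (y / \<delta>)"
    by (simp add: char_std_normal_distribution)
  also have "\<dots> = (LBINT v. std_normal_density v *\<^sub>R iexp (y / \<delta> * v))"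
    unfolding char_def by (subst integral_density) (auto simp: normal_density_nonneg)
  also have "\<dots> = (LBINT v. complex_of_real (1 / sqrt (2 * pi)) * (iexp (y / \<delta> * v) * complex_of_real (exp (- v\<^sup>2 / 2))))"
    by (intro Bochner_Integration.integral_cong) (auto simp: std_normal_density_def scaleR_conv_of_real)
  also have "\<dots> = complex_of_real (1 / sqrt (2 * pi)) * (LBINT v. iexp (y / \<delta> * v) * complex_of_real (exp (- v\<^sup>2 / 2)))"
    by (rule integral_mult_right_zero)
  also have "(LBINT v. iexp (y / \<delta> * v) * complex_of_real (exp (- v\<^sup>2 / 2)))
     = \<delta> *\<^sub>R (LBINT w. iexp (y / \<delta> * (0 + \<delta> * w)) * complex_of_real (exp (- (0 + \<delta> * w)\<^sup>2 / 2)))"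
    using lborel_integral_real_affine[of \<delta> "\<lambda>v. iexp (y / \<delta> * v) * complex_of_real (exp (- v\<^sup>2 / 2))" 0] assms
    by simp
  also have "(LBINT w. iexp (y / \<delta> * (0 + \<delta> * w)) * complex_of_real (exp (- (0 + \<delta> * w)\<^sup>2 / 2)))
     = (LBINT w. iexp (w * y) * complex_of_real (exp (- (\<delta> * w)\<^sup>2 / 2)))"
    using assms by (intro Bochner_Integration.integral_cong) (auto simp: mult.commute)
  finally show ?thesis using assms by (simp add: scaleR_conv_of_real field_simps)
qed

lemma integrable_gauss:
  fixes \<delta> :: real
  assumes "\<delta> > 0"
  shows "integrable lborel (\<lambda>w. exp (- (\<delta> * w)\<^sup>2 / 2))"
proof -
  have "integrable lborel (\<lambda>v. sqrt (2 * pi) * std_normal_density v)"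
    by (intro integrable_mult_right) (simp add: integrable_normal_density)
  then have "integrable lborel (\<lambda>v::real. exp (- v\<^sup>2 / 2))"
    by (simp add: std_normal_density_def)
  from lborel_integrable_real_affine[OF this, of \<delta> 0] assms show ?thesis by simp
qed

lemma integral_gauss: "(LBINT v. exp (- v\<^sup>2 / 2)) = sqrt (2 * pi)"
proof -
  have "complex_of_real (LBINT v. exp (- v\<^sup>2 / 2)) = complex_of_real (sqrt (2 * pi))"
    using integral_iexp_gauss[of 1 0] by (subst integral_complex_of_real[symmetric]) simp
  then show ?thesis using of_real_eq_iff by blast
qed

text \<open>Gaussian summation. Damping the inversion integral by a wide Gaussian permits Fubini,
  and the inner integral becomes a narrow Gaussian centred at \<open>t\<close>. As the damping is
  removed, dominated convergence with majorant |gh| handles the inversion integral, and boundedness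
  together with continuity at \<open>t\<close> handles the averages of \<open>g\<close>.\<close>

theorem fourier_inversion:
  fixes g gh :: "real \<Rightarrow> complex"
  assumes g: "integrable lborel g" and bd: "\<And>x. norm (g x) \<le> C" and cont: "isCont g t"
    and gh: "\<And>w. gh w = (LBINT x. g x * iexp (- (w * x)))" and ghi: "integrable lborel gh"
  shows "(LBINT w. gh w * iexp (w * t)) = complex_of_real (2 * pi) * g t"
proof -
  define d where "d n = 1 / real (Suc n)" for n
  have d0: "d n > 0" for n by (simp add: d_def)
  have dl: "d \<longlonglongrightarrow> 0" unfolding d_def using LIMSEQ_inverse_real_of_nat by (simp add: inverse_eq_divide)
  define e where "e n w = complex_of_real (exp (- (d n * w)\<^sup>2 / 2))" for n w
  have gm [measurable]: "g \<in> borel_measurable borel" using g by simp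
  have ghm [measurable]: "gh \<in> borel_measurable borel" using ghi by simp
  have em [measurable]: "e n \<in> borel_measurable borel" for n unfolding e_def by measurable
  have e1: "norm (e n w) \<le> 1" for n w by (simp add: e_def)
  have ei: "integrable lborel (e n)" for n
    unfolding e_def using integrable_gauss[OF d0] by simp
  define G where "G n = (LBINT w. gh w * iexp (w * t) * e n w)" for n
  have lim1: "G \<longlonglongrightarrow> (LBINT w. gh w * iexp (w * t))"
    unfolding G_def
  proof (rule integral_dominated_convergence[where w="\<lambda>w. norm (gh w)"])
    show "AE w in lborel. (\<lambda>n. gh w * iexp (w * t) * e n w) \<longlonglongrightarrow> gh w * iexp (w * t)"
    proof (intro AE_I2)
      fix w
      have "(\<lambda>n. complex_of_real (exp (- (d n * w)\<^sup>2 / 2))) \<longlonglongrightarrow> complex_of_real (exp (- (0 * w)\<^sup>2 / 2))"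
        by (intro tendsto_intros dl) auto
      then have "(\<lambda>n. e n w) \<longlonglongrightarrow> 1" by (simp add: e_def)
      from tendsto_mult_left[OF this, of "gh w * iexp (w * t)"]
      show "(\<lambda>n. gh w * iexp (w * t) * e n w) \<longlonglongrightarrow> gh w * iexp (w * t)" by simp
    qed
    show "AE w in lborel. norm (gh w * iexp (w * t) * e n w) \<le> norm (gh w)" for n
      using e1 by (auto simp: norm_mult intro!: mult_left_le)
  qed (use ghi in auto)
  have eq: "G n = complex_of_real (sqrt (2 * pi)) * (LBINT v. g (t + (- d n) * v) * complex_of_real (exp (- v\<^sup>2 / 2)))" for n
  proof -
    let ?F = "\<lambda>w x. g x * (iexp (w * (t - x)) * e n w)"
    have "G n = (LBINT w. (LBINT x. ?F w x))"
      unfolding G_def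
    proof (rule Bochner_Integration.integral_cong[OF refl])
      fix w
      have "gh w * iexp (w * t) * e n w = gh w * (iexp (w * t) * e n w)" by simp
      also have "\<dots> = (LBINT x. (g x * iexp (- (w * x))) * (iexp (w * t) * e n w))"
        unfolding gh by (rule integral_mult_left_zero[symmetric])
      also have "\<dots> = (LBINT x. ?F w x)"
        by (intro Bochner_Integration.integral_cong) (auto simp: exp_add[symmetric] algebra_simps mult_exp_exp)
      finally show "gh w * iexp (w * t) * e n w = (LBINT x. ?F w x)" .
    qed
    also have "\<dots> = (LBINT x. (LBINT w. ?F w x))"
    proof (rule lborel_pair.Fubini_integral)
      show "integrable (lborel \<Otimes>\<^sub>M lborel) (\<lambda>(x, w). ?F w x)"
      proof (rule lborel_pair.Fubini_integrable)
        show "(\<lambda>(x, w). ?F w x) \<in> borel_measurable (lborel \<Otimes>\<^sub>M lborel)" by measurable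
        have "(LBINT w. norm (?F w x)) = norm (g x) * (LBINT w. norm (e n w))" for x
          by (simp add: norm_mult)
        then show "integrable lborel (\<lambda>x. LBINT w. norm (case (x, w) of (x, w) \<Rightarrow> ?F w x))"
          using g by simp
        have "integrable lborel (\<lambda>w. ?F w x)" for x
        proof (rule Bochner_Integration.integrable_bound)
          show "integrable lborel (\<lambda>w. g x * e n w)" using ei by simp
        qed (auto simp: norm_mult)
        then show "AE x in lborel. integrable lborel (\<lambda>w. case (x, w) of (x, w) \<Rightarrow> ?F w x)" by simp
      qed
    qed
    also have "\<dots> = (LBINT x. g x * complex_of_real (sqrt (2 * pi) / d n * exp (- ((t - x) / d n)\<^sup>2 / 2)))"
      using integral_iexp_gauss[OF d0[of n]] unfolding e_def
      by (intro Bochner_Integration.integral_cong) (auto simp del: of_real_mult of_real_divide)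
    \<comment> \<open>The substitution x = t - d v moves the shrinking width out of the kernel and
      into the argument of \<open>g\<close>, so that the Gaussian weight no longer depends on
      \<open>n\<close>.\<close>
    also have "\<dots> = \<bar>- d n\<bar> *\<^sub>R (LBINT v. g (t + (- d n) * v) *
        complex_of_real (sqrt (2 * pi) / d n * exp (- ((t - (t + (- d n) * v)) / d n)\<^sup>2 / 2)))"
      using d0[of n] by (intro lborel_integral_real_affine) auto
    also have "\<dots> = \<bar>- d n\<bar> *\<^sub>R (LBINT v. complex_of_real (sqrt (2 * pi) / d n) *
        (g (t + (- d n) * v) * complex_of_real (exp (- v\<^sup>2 / 2))))"
      using d0[of n] by (intro arg_cong2[where f=scaleR] refl Bochner_Integration.integral_cong) auto
    also have "\<dots> = \<bar>- d n\<bar> *\<^sub>R (complex_of_real (sqrt (2 * pi) / d n) * (LBINT v.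
        (g (t + (- d n) * v) * complex_of_real (exp (- v\<^sup>2 / 2)))))"
      by (subst integral_mult_right_zero) simp
    finally show ?thesis using d0[of n] by (simp add: scaleR_conv_of_real)
  qed
  have "(\<lambda>n. (LBINT v. g (t + (- d n) * v) * complex_of_real (exp (- v\<^sup>2 / 2))))
     \<longlonglongrightarrow> (LBINT v. g t * complex_of_real (exp (- v\<^sup>2 / 2)))"
  proof (rule integral_dominated_convergence[where w="\<lambda>v. C * exp (- v\<^sup>2 / 2)"])
    show "AE v in lborel. (\<lambda>n. g (t + (- d n) * v) * complex_of_real (exp (- v\<^sup>2 / 2)))
       \<longlonglongrightarrow> g t * complex_of_real (exp (- v\<^sup>2 / 2))"
    proof (intro AE_I2 tendsto_intros)
      fix v
      have "(\<lambda>n. t + (- d n) * v) \<longlonglongrightarrow> t + (- 0) * v" by (intro tendsto_intros dl)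
      then show "(\<lambda>n. g (t + (- d n) * v)) \<longlonglongrightarrow> g t"
        using cont by (intro isCont_tendsto_compose[where g=g]) auto
    qed
    show "AE v in lborel. norm (g (t + - d n * v) * complex_of_real (exp (- v\<^sup>2 / 2))) \<le> C * exp (- v\<^sup>2 / 2)" for n
      using bd by (auto simp: norm_mult)
    show "integrable lborel (\<lambda>v. C * exp (- v\<^sup>2 / 2))"
      using integrable_gauss[of 1] by (intro integrable_mult_right) simp
  qed auto
  also have "(LBINT v. g t * complex_of_real (exp (- v\<^sup>2 / 2))) = g t * complex_of_real (sqrt (2 * pi))"
    by (subst integral_mult_right_zero, subst integral_complex_of_real, subst integral_gauss) simp
  finally have "G \<longlonglongrightarrow> complex_of_real (sqrt (2 * pi)) * (g t * complex_of_real (sqrt (2 * pi)))"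
    unfolding eq by (intro tendsto_intros)
  from LIMSEQ_unique[OF lim1 this]
  show ?thesis by (simp flip: of_real_mult)
qed


section \<open>Integrals along vertical lines\<close>

lemma integrable_inverse_square: "integrable lborel (\<lambda>w::real. 1 / (1 + w\<^sup>2))"
  and integral_inverse_square: "(LBINT w::real. 1 / (1 + w\<^sup>2)) = pi"
  using integrable_inverse_1_plus_square LBINT_inverse_1_plus_square
  by (simp_all add: set_integrable_def set_lebesgue_integral_def interval_lebesgue_integral_def inverse_eq_divide)

text \<open>Cauchy's theorem for a growing rectangle, expressed through a primitive, which exists
  because a half plane is convex. The bound on \<open>H\<close> makes the horizontal sides vanish in
  the limit. With \<open>c1 = c2\<close> the second conclusion still provides integrability on a
  single line.\<close>

lemma vertical_line_shift:
  fixes H :: "complex \<Rightarrow> complex"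
  assumes hol: "H holomorphic_on {s. Re s > b}" and bc: "b < c1" "c1 \<le> c2"
    and bound: "\<And>s. c1 \<le> Re s \<Longrightarrow> Re s \<le> c2 \<Longrightarrow> norm (H s) \<le> K / (1 + (Im s)\<^sup>2)"
  shows "(LBINT w. H (Complex c1 w)) = (LBINT w. H (Complex c2 w))"
    and "integrable lborel (\<lambda>w. H (Complex c1 w))"
proof -
  have op: "open {s. Re s > b}" by (simp add: open_halfspace_Re_gt)
  have cv: "convex {s. Re s > b}" by (rule convex_halfspace_Re_gt)
  obtain P where P: "\<And>s. s \<in> {s. Re s > b} \<Longrightarrow> (P has_field_derivative H s) (at s within {s. Re s > b})"
    using holomorphic_convex_primitive'[OF cv op hol] by metis
  have P': "(P has_field_derivative H s) (at s)" if "Re s > b" for s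
    using P[of s] that at_within_open[OF _ op, of s] by simp
  have contH: "continuous_on {s. Re s > b} H" using hol by (rule holomorphic_on_imp_continuous_on)
  have contl: "continuous_on UNIV (\<lambda>w. H (Complex c w))" if "c > b" for c
  proof (rule continuous_on_compose2[OF contH])
    show "continuous_on UNIV (\<lambda>w. Complex c w)" unfolding Complex_eq by (intro continuous_intros)
  qed (use that in auto)
  have int: "integrable lborel (\<lambda>w. H (Complex c w))" if "c1 \<le> c" "c \<le> c2" for c
  proof (rule Bochner_Integration.integrable_bound)
    show "integrable lborel (\<lambda>w::real. K * (1 / (1 + w\<^sup>2)))"
      by (intro integrable_mult_right integrable_inverse_square)
    show "(\<lambda>w. H (Complex c w)) \<in> borel_measurable lborel"
      using contl[of c] that bc by (simp add: borel_measurable_continuous_onI)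
    have "norm (H (Complex c w)) \<le> \<bar>K / (1 + w\<^sup>2)\<bar>" for w
      by (rule order_trans[OF _ abs_ge_self]) (use bound[of "Complex c w"] that in simp)
    then show "AE w in lborel. norm (H (Complex c w)) \<le> norm (K * (1 / (1 + w\<^sup>2)))"
      by (simp only: AE_I2 real_norm_def times_divide_eq_right mult_1_right)
  qed
  \<comment> \<open>Along the line the derivative of \<open>P\<close> with respect to the height is
    \<i> H, so truncated integrals are differences of \<open>P\<close> between two corners of the
    rectangle.\<close>
  have lim: "(\<lambda>n. P (Complex c (real n)) - P (Complex c (- real n))) \<longlonglongrightarrow> \<i> * (LBINT w. H (Complex c w))"
    if c: "c1 \<le> c" "c \<le> c2" for c
  proof -
    have "(\<lambda>n. LBINT w. indicator {- real n..real n} w *\<^sub>R H (Complex c w)) \<longlonglongrightarrow> (LBINT w. H (Complex c w))"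
    proof (rule integral_dominated_convergence[where w="\<lambda>w. norm (H (Complex c w))"])
      show "AE w in lborel. (\<lambda>n. indicator {- real n..real n} w *\<^sub>R H (Complex c w)) \<longlonglongrightarrow> H (Complex c w)"
      proof (intro AE_I2 tendsto_eventually)
        fix w :: real
        show "\<forall>\<^sub>F n in sequentially. indicator {- real n..real n} w *\<^sub>R H (Complex c w) = H (Complex c w)"
          using eventually_ge_at_top[of "nat \<lceil>\<bar>w\<bar>\<rceil>"]
        proof eventually_elim
          case (elim n)
          then have "\<bar>w\<bar> \<le> real n" by linarith
          then show ?case by (simp add: indicator_def abs_le_iff)
        qed
      qed
      show "AE w in lborel. norm (indicator {- real n..real n} w *\<^sub>R H (Complex c w)) \<le> norm (H (Complex c w))" for n
        by (simp add: indicator_def)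
      show "(\<lambda>w. H (Complex c w)) \<in> borel_measurable lborel" using int[OF c] by simp
      then show "(\<lambda>w. indicator {- real n..real n} w *\<^sub>R H (Complex c w)) \<in> borel_measurable lborel" for n
        by simp
    qed (use int[OF c] in auto)
    then have "(\<lambda>n. \<i> * (LBINT w. indicator {- real n..real n} w *\<^sub>R H (Complex c w))) \<longlonglongrightarrow> \<i> * (LBINT w. H (Complex c w))"
      by (intro tendsto_intros)
    moreover have "\<i> * (LBINT w. indicator {- real n..real n} w *\<^sub>R H (Complex c w))
       = P (Complex c (real n)) - P (Complex c (- real n))" for n
    proof -
      have "(LBINT w. indicator {- real n..real n} w *\<^sub>R (\<i> * H (Complex c w)))
         = P (Complex c (real n)) - P (Complex c (- real n))"
      proof (rule integral_FTC_Icc[where F="\<lambda>w. P (Complex c w)"])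
        fix w
        have "(P has_field_derivative H (Complex c w)) (at (Complex c w))" using P' c bc by auto
        moreover have "((\<lambda>w. Complex c w) has_vector_derivative \<i>) (at w within {- real n..real n})"
          unfolding Complex_eq by (auto intro!: derivative_eq_intros simp: has_vector_derivative_complex_iff)
        ultimately show "((\<lambda>w. P (Complex c w)) has_vector_derivative (\<i> * H (Complex c w))) (at w within {- real n..real n})"
          using field_vector_diff_chain_within[of "\<lambda>w. Complex c w" \<i> w "{- real n..real n}" P]
          by (auto simp: o_def intro: has_field_derivative_at_within)
      next
        show "continuous_on {- real n..real n} (\<lambda>w. \<i> * H (Complex c w))"
          using contl[of c] c bc by (intro continuous_intros) (auto intro: continuous_on_subset)
      qed auto
      moreover have "(LBINT w. indicator {- real n..real n} w *\<^sub>R (\<i> * H (Complex c w)))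
         = (LBINT w. \<i> * (indicator {- real n..real n} w *\<^sub>R H (Complex c w)))"
        by (intro Bochner_Integration.integral_cong) auto
      ultimately show ?thesis by (simp only: integral_mult_right_zero)
    qed
    ultimately show ?thesis by (simp only:)
  qed
  \<comment> \<open>The mean value inequality on a horizontal side, where the imaginary part is
    constantly \<open>y\<close>.\<close>
  have hor: "norm (P (Complex c2 y) - P (Complex c1 y)) \<le> (K / (1 + y\<^sup>2)) * (c2 - c1)" for y
  proof -
    have "norm (P (Complex c2 y) - P (Complex c1 y)) \<le> (K / (1 + y\<^sup>2)) * norm (Complex c2 y - Complex c1 y)"
    proof (rule field_differentiable_bound[where S="closed_segment (Complex c1 y) (Complex c2 y)" and f'=H])
      fix z assume "z \<in> closed_segment (Complex c1 y) (Complex c2 y)"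
      then have "Im z = y \<and> c1 \<le> Re z \<and> Re z \<le> c2"
        using bc closed_segment_same_Im[of "Complex c1 y" "Complex c2 y"]
        by (auto simp: closed_segment_eq_real_ivl)
      then show "(P has_field_derivative H z) (at z within closed_segment (Complex c1 y) (Complex c2 y))"
        "norm (H z) \<le> K / (1 + y\<^sup>2)"
        using P'[of z] bound[of z] bc by (auto intro: has_field_derivative_at_within)
    qed auto
    moreover have "Complex c2 y - Complex c1 y = complex_of_real (c2 - c1)"
      by (simp add: complex_eq_iff)
    then have "norm (Complex c2 y - Complex c1 y) = c2 - c1"
      using bc by (simp only: norm_of_real)
    ultimately show ?thesis by simp
  qed
  have i0: "(\<lambda>n. (K / (1 + (real n)\<^sup>2)) * (c2 - c1)) \<longlonglongrightarrow> 0"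
  proof -
    have "filterlim (\<lambda>n. 1 + (real n)\<^sup>2) at_top sequentially"
      by (intro filterlim_tendsto_add_at_top[OF tendsto_const] filterlim_pow_at_top filterlim_real_sequentially) auto
    then have "(\<lambda>n. K / (1 + (real n)\<^sup>2)) \<longlonglongrightarrow> 0"
      by (intro real_tendsto_divide_at_top[OF tendsto_const])
    from tendsto_mult_right[OF this, of "c2 - c1"] show ?thesis by simp
  qed
  have a1: "(\<lambda>n. P (Complex c2 (real n)) - P (Complex c1 (real n))) \<longlonglongrightarrow> 0"
    by (rule Lim_null_comparison[OF _ i0]) (use hor in auto)
  have a2: "(\<lambda>n. P (Complex c2 (- real n)) - P (Complex c1 (- real n))) \<longlonglongrightarrow> 0"
    by (rule Lim_null_comparison[OF _ i0]) (use hor[of "- real _"] in auto)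
  have "(\<lambda>n. (P (Complex c2 (real n)) - P (Complex c1 (real n))) - (P (Complex c2 (- real n)) - P (Complex c1 (- real n)))) \<longlonglongrightarrow> 0"
    using tendsto_diff[OF a1 a2] by simp
  \<comment> \<open>The same four corner values as before, now paired along the vertical
    sides.\<close>
  moreover have "(\<lambda>n. (P (Complex c2 (real n)) - P (Complex c1 (real n))) - (P (Complex c2 (- real n)) - P (Complex c1 (- real n))))
     \<longlonglongrightarrow> \<i> * (LBINT w. H (Complex c2 w)) - \<i> * (LBINT w. H (Complex c1 w))"
    using tendsto_diff[OF lim[of c2] lim[of c1]] bc by (simp add: algebra_simps)
  ultimately have "\<i> * (LBINT w. H (Complex c2 w)) - \<i> * (LBINT w. H (Complex c1 w)) = 0"
    by (rule LIMSEQ_unique[OF _ _, symmetric])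
  then show "(LBINT w. H (Complex c1 w)) = (LBINT w. H (Complex c2 w))" by simp
  show "integrable lborel (\<lambda>w. H (Complex c1 w))" using int[of c1] bc by simp
qed

section \<open>Linear delay equations\<close>

lemma integral_has_vector_derivative_atLeast:
  fixes f :: "real \<Rightarrow> 'a::banach"
  assumes "continuous_on {a..} f" "a \<le> t"
  shows "((\<lambda>u. integral {a..u} f) has_vector_derivative f t) (at t within {a..})"
proof -
  have "((\<lambda>u. integral {a..u} f) has_vector_derivative f t) (at t within {a..t + 1})"
    using assms by (intro integral_has_vector_derivative) (auto intro: continuous_on_subset)
  moreover have "at t within {a..t + 1} = at t within {a..}"
    by (rule at_within_nhd[of t "{..<t + 1}"]) auto
  ultimately show ?thesis by simp
qed

text \<open>Integrating exp(\<mu> s) gains a factor 1/\<mu>. This gain lets a large weight absorb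
  the size of the matrices, both in the growth bound and in the contraction estimate. The term
  \<open>P * t\<close> is dominated by exp(\<mu> t) times \<open>P\<close> because \<mu> >=
  1.\<close>

lemma norm_integral_exp_bound:
  fixes f :: "real \<Rightarrow> 'a::banach"
  assumes f: "f integrable_on {0..t}" and t: "t \<ge> 0" and \<mu>: "\<mu> \<ge> 1" and KP: "K \<ge> 0" "P \<ge> 0"
    and le: "\<And>s. 0 \<le> s \<Longrightarrow> s \<le> t \<Longrightarrow> norm (f s) \<le> K * exp (\<mu> * s) + P"
  shows "norm (integral {0..t} f) \<le> exp (\<mu> * t) * (K / \<mu> + P)"
proof -
  have I: "((\<lambda>s. K * exp (\<mu> * s) + P) has_integral
      (K * exp (\<mu> * t) / \<mu> + P * t) - (K * exp (\<mu> * 0) / \<mu> + P * 0)) {0..t}"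
    using t \<mu> by (intro fundamental_theorem_of_calculus)
      (auto intro!: derivative_eq_intros simp: has_real_derivative_iff_has_vector_derivative[symmetric])
  have "norm (integral {0..t} f) \<le> integral {0..t} (\<lambda>s. K * exp (\<mu> * s) + P)"
    using le by (intro integral_norm_bound_integral f has_integral_integrable[OF I]) auto
  also have "\<dots> = K * exp (\<mu> * t) / \<mu> + P * t - K / \<mu>"
    using integral_unique[OF I] by simp
  also have "\<dots> \<le> K * exp (\<mu> * t) / \<mu> + P * exp (\<mu> * t)"
  proof -
    have "t \<le> \<mu> * t" using t \<mu> mult_right_mono[of 1 \<mu> t] by simp
    also have "\<dots> \<le> exp (\<mu> * t)" using exp_ge_add_one_self[of "\<mu> * t"] by linarith
    finally have "P * t \<le> P * exp (\<mu> * t)" using KP by (intro mult_left_mono)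
    moreover have "K / \<mu> \<ge> 0" using KP \<mu> by simp
    ultimately show ?thesis by linarith
  qed
  finally show ?thesis by (simp add: algebra_simps)
qed

definition delay_rhs ::
  "real ^ 'n ^ 'n \<Rightarrow> real ^ 'n ^ 'n \<Rightarrow> real \<Rightarrow> real \<Rightarrow> (real \<Rightarrow> real ^ 'n) \<Rightarrow> (real \<Rightarrow> real ^ 'n) \<Rightarrow> real \<Rightarrow> real ^ 'n" where
  "delay_rhs M N r \<tau> p z t = M *v z t + N *v (z (t - \<tau>) - z (t - r)) + p t"

text \<open>Freezing the history at the constant \<open>z0\<close> keeps \<open>z\<close> continuous
  on the whole line and reduces the initial state to one vector; the true input history is carried
  by \<open>p\<close>. In general \<open>z\<close> has a corner at 0, hence the derivative within
  \<open>{0..}\<close>.\<close>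

definition delay_solution ::
  "real ^ 'n ^ 'n \<Rightarrow> real ^ 'n ^ 'n \<Rightarrow> real \<Rightarrow> real \<Rightarrow> (real \<Rightarrow> real ^ 'n) \<Rightarrow> real ^ 'n \<Rightarrow> (real \<Rightarrow> real ^ 'n) \<Rightarrow> bool" where
  "delay_solution M N r \<tau> p z0 z \<longleftrightarrow> continuous_on UNIV z \<and> (\<forall>t\<le>0. z t = z0) \<and>
     (\<forall>t\<ge>0. (z has_vector_derivative delay_rhs M N r \<tau> p z t) (at t within {0..}))"

lemma continuous_on_delay_rhs:
  assumes "continuous_on UNIV z" "continuous_on UNIV p"
  shows "continuous_on S (delay_rhs M N r \<tau> p z)"
proof -
  have "continuous_on UNIV (\<lambda>t. z (t - c))" for c
    by (rule continuous_on_compose2[OF assms(1)]) (auto intro!: continuous_intros)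
  then have "continuous_on UNIV (delay_rhs M N r \<tau> p z)"
    unfolding delay_rhs_def
    by (intro continuous_intros assms bounded_linear.continuous_on[OF matrix_vector_mul_bounded_linear])
  then show ?thesis by (rule continuous_on_subset) simp
qed

text \<open>The 3 counts one value of \<open>z\<close> under \<open>M\<close> and two under
  \<open>N\<close>. It is the origin of the weight \<open>6 * \<kappa> + 1\<close> in the lemmas
  that follow, for which 3 \<kappa> divided by the weight is at most 1/2.\<close>

lemma norm_delay_rhs_le:
  fixes M N :: "real ^ 'n ^ 'n"
  assumes \<kappa>: "\<And>v. norm (M *v v) \<le> \<kappa> * norm v" "\<And>v. norm (N *v v) \<le> \<kappa> * norm v"
    and z: "norm (z t) \<le> b" "norm (z (t - \<tau>)) \<le> b" "norm (z (t - r)) \<le> b" "\<kappa> \<ge> 0"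
  shows "norm (delay_rhs M N r \<tau> p z t) \<le> 3 * \<kappa> * b + norm (p t)"
proof -
  have "norm (delay_rhs M N r \<tau> p z t) \<le> norm (M *v z t) + norm (N *v (z (t - \<tau>) - z (t - r))) + norm (p t)"
    unfolding delay_rhs_def by (intro norm_triangle_mono order_refl)
  also have "norm (M *v z t) \<le> \<kappa> * b"
    by (rule order_trans[OF \<kappa>(1)]) (intro mult_left_mono z)
  also have "norm (N *v (z (t - \<tau>) - z (t - r))) \<le> \<kappa> * (b + b)"
    by (rule order_trans[OF \<kappa>(2)])
      (intro mult_left_mono z order_trans[OF norm_triangle_ineq4] add_mono)
  finally show ?thesis by (simp add: algebra_simps)
qed

text \<open>The supremum of \<open>e\<^sup>-\<^sup>\<mu>\<^sup>t |z(t)|\<close> bounds itself with factor \<open>1 / 2\<close> once \<open>\<mu>\<close> is large; no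
  Gronwall argument is needed.\<close>

lemma delay_solution_growth:
  fixes M N :: "real ^ 'n ^ 'n"
  assumes r: "r \<ge> 0" "\<tau> \<ge> 0"
    and \<kappa>: "\<kappa> \<ge> 0" "\<And>v. norm (M *v v) \<le> \<kappa> * norm v" "\<And>v. norm (N *v v) \<le> \<kappa> * norm v"
    and p: "continuous_on UNIV p" "\<And>t. norm (p t) \<le> P"
    and sol: "delay_solution M N r \<tau> p z0 z" and t: "t \<ge> 0"
  shows "norm (z t) \<le> 2 * (norm z0 + P) * exp ((6 * \<kappa> + 1) * t)"
proof -
  define \<mu> where "\<mu> = 6 * \<kappa> + 1"
  have \<mu>1: "\<mu> \<ge> 1" using \<kappa>(1) by (simp add: \<mu>_def)
  have zc: "continuous_on UNIV z" and z0: "\<And>s. s \<le> 0 \<Longrightarrow> z s = z0"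
    and zd: "\<And>s. s \<ge> 0 \<Longrightarrow> (z has_vector_derivative delay_rhs M N r \<tau> p z s) (at s within {0..})"
    using sol by (auto simp: delay_solution_def)
  have P0: "P \<ge> 0" using p(2)[of 0] norm_ge_zero order_trans by blast
  have "continuous_on {0..t} (\<lambda>s. exp (- \<mu> * s) * norm (z s))"
    by (intro continuous_intros continuous_on_subset[OF zc]) auto
  \<comment> \<open>The weighted norm attains its maximum on the compact interval. The integral
    equation evaluated at the maximiser \<open>t0\<close> bounds \<open>m\<close> by m/2 plus the
    data.\<close>
  then obtain t0 where t0: "t0 \<in> {0..t}"
    "\<And>s. s \<in> {0..t} \<Longrightarrow> exp (- \<mu> * s) * norm (z s) \<le> exp (- \<mu> * t0) * norm (z t0)"
    using continuous_attains_sup[of "{0..t}" "\<lambda>s. exp (- \<mu> * s) * norm (z s)"] t by auto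
  define m where "m = exp (- \<mu> * t0) * norm (z t0)"
  have m0: "m \<ge> 0" by (simp add: m_def)
  have zm: "norm (z s) \<le> m * exp (\<mu> * s)" if "0 \<le> s" "s \<le> t" for s
  proof -
    have "exp (- \<mu> * s) * norm (z s) \<le> m" using t0(2)[of s] that by (simp add: m_def)
    then show ?thesis by (simp add: exp_minus field_simps)
  qed
  \<comment> \<open>A delayed argument may be negative; there \<open>z\<close> equals its value at
    0, which \<open>m\<close> controls as well.\<close>
  have zm': "norm (z (s - d)) \<le> m * exp (\<mu> * s)" if s: "0 \<le> s" "s \<le> t" and d: "d \<ge> 0" for s d
  proof (cases "s - d \<ge> 0")
    case True
    have "norm (z (s - d)) \<le> m * exp (\<mu> * (s - d))" by (rule zm) (use s d True in auto)
    also have "\<dots> \<le> m * exp (\<mu> * s)" using m0 \<mu>1 d by (intro mult_left_mono) auto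
    finally show ?thesis .
  next
    case False
    then have "norm (z (s - d)) \<le> m * 1" using zm[of 0] t z0[of "s - d"] z0[of 0] by simp
    also have "\<dots> \<le> m * exp (\<mu> * s)" using m0 \<mu>1 s by (intro mult_left_mono) auto
    finally show ?thesis .
  qed
  have "(delay_rhs M N r \<tau> p z has_integral (z t0 - z 0)) {0..t0}"
    using t0(1) by (intro fundamental_theorem_of_calculus has_vector_derivative_within_subset[OF zd]) auto
  then have I: "delay_rhs M N r \<tau> p z integrable_on {0..t0}"
    and z_eq: "z t0 = z0 + integral {0..t0} (delay_rhs M N r \<tau> p z)"
    using z0[of 0] by (auto dest: has_integral_integrable integral_unique)
  have "norm (integral {0..t0} (delay_rhs M N r \<tau> p z)) \<le> exp (\<mu> * t0) * ((3 * \<kappa> * m) / \<mu> + P)"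
  proof (rule norm_integral_exp_bound[OF I])
    fix s assume s: "0 \<le> s" "s \<le> t0"
    have "norm (delay_rhs M N r \<tau> p z s) \<le> 3 * \<kappa> * (m * exp (\<mu> * s)) + norm (p s)"
      by (intro norm_delay_rhs_le \<kappa> zm zm' r) (use s t0 in auto)
    then show "norm (delay_rhs M N r \<tau> p z s) \<le> 3 * \<kappa> * m * exp (\<mu> * s) + P"
      using p(2)[of s] by (simp add: mult.assoc)
  qed (use t0 \<mu>1 \<kappa> m0 P0 in auto)
  then have "norm (z t0) \<le> norm z0 + exp (\<mu> * t0) * ((3 * \<kappa> * m) / \<mu> + P)"
    unfolding z_eq by (rule norm_triangle_le[OF add_left_mono])
  then have "m \<le> exp (- \<mu> * t0) * (norm z0 + exp (\<mu> * t0) * ((3 * \<kappa> * m) / \<mu> + P))"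
    unfolding m_def by (intro mult_left_mono) auto
  also have "\<dots> = exp (- \<mu> * t0) * norm z0 + ((3 * \<kappa> * m) / \<mu> + P)"
    by (simp add: exp_minus field_simps)
  also have "exp (- \<mu> * t0) * norm z0 \<le> 1 * norm z0"
    using t0(1) \<mu>1 by (intro mult_right_mono) auto
  also have "(3 * \<kappa> * m) / \<mu> \<le> m / 2"
  proof -
    have "m * (6 * \<kappa>) \<le> m * \<mu>" using m0 by (intro mult_left_mono) (auto simp: \<mu>_def)
    then show ?thesis using \<mu>1 by (simp add: field_simps)
  qed
  finally have "m \<le> 2 * (norm z0 + P)" by simp
  then have "m * exp (\<mu> * t) \<le> 2 * (norm z0 + P) * exp (\<mu> * t)" by (rule mult_right_mono) simp
  from order_trans[OF zm[OF t order_refl] this] show ?thesis by (simp only: \<mu>_def)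
qed

text \<open>Picard iteration for the weighted unknown w(t) = exp(-\<mu> t) z(t). With this weight
  the integral operator maps bounded continuous functions to bounded continuous functions and
  contracts by 1/2, so one fixed point covers all times at once.\<close>

lemma delay_solution_exists:
  fixes M N :: "real ^ 'n ^ 'n"
  assumes r: "r \<ge> 0" "\<tau> \<ge> 0"
    and p: "continuous_on UNIV p" "\<And>t. norm (p t) \<le> P"
  obtains z where "delay_solution M N r \<tau> p z0 z"
proof -
  obtain m where m: "m \<ge> 0" "\<And>v. norm (M *v v) \<le> norm v * m"
    using bounded_linear.nonneg_bounded[OF matrix_vector_mul_bounded_linear[of M]] by blast
  obtain n where n: "n \<ge> 0" "\<And>v. norm (N *v v) \<le> norm v * n"
    using bounded_linear.nonneg_bounded[OF matrix_vector_mul_bounded_linear[of N]] by blast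
  define \<kappa> where "\<kappa> = m + n"
  have \<kappa>: "\<kappa> \<ge> 0" "norm (M *v v) \<le> \<kappa> * norm v" "norm (N *v v) \<le> \<kappa> * norm v" for v
    using m(1) n(1) order_trans[OF m(2)[of v], of "\<kappa> * norm v"] order_trans[OF n(2)[of v], of "\<kappa> * norm v"]
    by (auto simp: \<kappa>_def algebra_simps)
  have P0: "P \<ge> 0" using p(2)[of 0] norm_ge_zero order_trans by blast
  define \<mu> where "\<mu> = 6 * \<kappa> + 1"
  have \<mu>1: "\<mu> \<ge> 1" using \<kappa>(1) by (simp add: \<mu>_def)
  \<comment> \<open>\<open>zz\<close> removes the weight; clamping time at 0 freezes the function at
    \<open>w 0\<close> on the negative axis. \<open>T\<close> puts the weight back after integrating
    the equation.\<close>
  define zz where "zz w t = exp (\<mu> * max 0 t) *\<^sub>R w (max 0 t)" for w :: "real \<Rightarrow> real ^ 'n" and t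
  define I where "I w t = integral {0..t} (delay_rhs M N r \<tau> p (zz w))" for w t
  define T where "T w t = exp (- \<mu> * max 0 t) *\<^sub>R (z0 + I w (max 0 t))" for w t
  have zzc: "continuous_on UNIV (zz w)" if "continuous_on UNIV w" for w
    unfolding zz_def
    by (intro continuous_intros continuous_on_compose2[OF that]) auto
  have rhsc: "continuous_on S (delay_rhs M N r \<tau> p (zz w))" if "continuous_on UNIV w" for w S
    by (intro continuous_on_delay_rhs zzc that p)
  have Id: "(I w has_vector_derivative delay_rhs M N r \<tau> p (zz w) t) (at t within {0..})"
    if "continuous_on UNIV w" "t \<ge> 0" for w t
    using integral_has_vector_derivative_atLeast[OF rhsc[OF that(1)] that(2)] by (simp add: I_def[abs_def])
  have Ic: "continuous_on {0..} (I w)" if "continuous_on UNIV w" for w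
    using Id[OF that] by (intro continuous_on_vector_derivative) auto
  have Tc: "continuous_on UNIV (T w)" if "continuous_on UNIV w" for w
    unfolding T_def
    by (intro continuous_intros continuous_on_compose2[OF Ic[OF that]]) auto
  have zz_le: "norm (zz w (s - d)) \<le> b * exp (\<mu> * s)"
    if "\<And>x. norm (w x) \<le> b" "d \<ge> 0" "s \<ge> 0" for w b d s
  proof -
    have "exp (\<mu> * max 0 (s - d)) \<le> exp (\<mu> * s)"
      using that \<mu>1 by (simp add: mult_left_mono)
    then have "norm (zz w (s - d)) \<le> exp (\<mu> * s) * b"
      unfolding zz_def norm_scaleR using that(1) by (intro mult_mono) auto
    then show ?thesis by (simp add: mult.commute)
  qed
  have Tb: "norm (T w t) \<le> norm z0 + (3 * \<kappa> * b / \<mu> + P)"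
    if w: "continuous_on UNIV w" and b: "\<And>x. norm (w x) \<le> b" for w b t
  proof -
    let ?t = "max 0 t"
    have b0: "b \<ge> 0" using b[of 0] norm_ge_zero order_trans by blast
    have "norm (I w ?t) \<le> exp (\<mu> * ?t) * ((3 * \<kappa> * b) / \<mu> + P)"
      unfolding I_def
    proof (rule norm_integral_exp_bound)
      show "delay_rhs M N r \<tau> p (zz w) integrable_on {0..?t}"
        by (intro integrable_continuous_interval rhsc w)
      fix s assume s: "0 \<le> s" "s \<le> ?t"
      have "norm (delay_rhs M N r \<tau> p (zz w) s) \<le> 3 * \<kappa> * (b * exp (\<mu> * s)) + norm (p s)"
        using zz_le[OF b, of 0 s] s by (intro norm_delay_rhs_le \<kappa> zz_le b r) auto
      then show "norm (delay_rhs M N r \<tau> p (zz w) s) \<le> 3 * \<kappa> * b * exp (\<mu> * s) + P"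
        using p(2)[of s] by (simp add: mult.assoc)
    qed (use \<mu>1 \<kappa> b0 P0 in auto)
    then have "norm (z0 + I w ?t) \<le> norm z0 + exp (\<mu> * ?t) * (3 * \<kappa> * b / \<mu> + P)"
      by (rule norm_triangle_le[OF add_left_mono])
    then have "norm (T w t) \<le> exp (- \<mu> * ?t) * (norm z0 + exp (\<mu> * ?t) * (3 * \<kappa> * b / \<mu> + P))"
      by (simp add: T_def)
    also have "\<dots> = exp (- \<mu> * ?t) * norm z0 + (3 * \<kappa> * b / \<mu> + P)"
      by (simp add: exp_minus distrib_left mult.assoc[symmetric])
    also have "exp (- \<mu> * ?t) * norm z0 \<le> 1 * norm z0"
      using \<mu>1 by (intro mult_right_mono) auto
    finally show ?thesis by simp
  qed
  have Td: "norm (T w t - T v t) \<le> 1 / 2 * b"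
    if w: "continuous_on UNIV w" and v: "continuous_on UNIV v" and b: "\<And>x. norm (w x - v x) \<le> b" for w v b t
  proof -
    let ?t = "max 0 t"
    have b0: "b \<ge> 0" using b[of 0] norm_ge_zero order_trans by blast
    have diff: "delay_rhs M N r \<tau> p (zz w) s - delay_rhs M N r \<tau> p (zz v) s
       = delay_rhs M N r \<tau> (\<lambda>_. 0) (zz (\<lambda>x. w x - v x)) s" for s
      by (simp add: delay_rhs_def zz_def matrix_vector_mult_diff_distrib scaleR_diff_right)
    have "norm (I w ?t - I v ?t) \<le> exp (\<mu> * ?t) * ((3 * \<kappa> * b) / \<mu> + 0)"
      unfolding I_def
    proof (subst integral_diff[symmetric], goal_cases)
      case 3
      show ?case
      proof (rule norm_integral_exp_bound)
        show "(\<lambda>s. delay_rhs M N r \<tau> p (zz w) s - delay_rhs M N r \<tau> p (zz v) s) integrable_on {0..?t}"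
          by (intro integrable_continuous_interval continuous_intros rhsc w v)
        fix s assume s: "0 \<le> s" "s \<le> ?t"
        have "norm (delay_rhs M N r \<tau> (\<lambda>_. 0) (zz (\<lambda>x. w x - v x)) s) \<le> 3 * \<kappa> * (b * exp (\<mu> * s)) + norm (0 :: real ^ 'n)"
          using zz_le[OF b, of 0 s] s by (intro norm_delay_rhs_le \<kappa> zz_le b r) auto
        then show "norm (delay_rhs M N r \<tau> p (zz w) s - delay_rhs M N r \<tau> p (zz v) s) \<le> 3 * \<kappa> * b * exp (\<mu> * s) + 0"
          unfolding diff by (simp add: mult.assoc)
      qed (use \<mu>1 \<kappa> b0 in auto)
    qed (auto intro!: integrable_continuous_interval rhsc w v)
    then have "exp (- \<mu> * ?t) * norm (I w ?t - I v ?t) \<le> exp (- \<mu> * ?t) * (exp (\<mu> * ?t) * (3 * \<kappa> * b / \<mu> + 0))"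
      by (rule mult_left_mono) simp
    moreover have "T w t - T v t = exp (- \<mu> * ?t) *\<^sub>R (I w ?t - I v ?t)"
      by (simp add: T_def scaleR_diff_right scaleR_add_right)
    ultimately have "norm (T w t - T v t) \<le> exp (- \<mu> * ?t) * (exp (\<mu> * ?t) * (3 * \<kappa> * b / \<mu>))"
      by simp
    also have "\<dots> = 3 * \<kappa> * b / \<mu>" by (simp add: exp_minus)
    also have "\<dots> \<le> 1 / 2 * b"
    proof -
      have "b * (6 * \<kappa>) \<le> b * \<mu>" using b0 by (intro mult_left_mono) (auto simp: \<mu>_def)
      then show ?thesis using \<mu>1 by (simp add: field_simps)
    qed
    finally show ?thesis .
  qed
  define TB where "TB W = Bcontfun (T (apply_bcontfun W))" for W :: "(real, real ^ 'n) bcontfun"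
  have TB: "apply_bcontfun (TB W) = T (apply_bcontfun W)" for W
  proof -
    have "T (apply_bcontfun W) \<in> bcontfun"
      by (rule bcontfun_normI[OF Tc[OF continuous_on_apply_bcontfun] Tb[OF continuous_on_apply_bcontfun norm_bounded]])
    then show ?thesis unfolding TB_def by (rule Bcontfun_inverse)
  qed
  have "\<exists>!W. TB W = W"
  proof (rule banach_fix_type[of "1 / 2"])
    have "dist (TB W) (TB V) \<le> 1 / 2 * dist W V" for W V
    proof (rule dist_bound)
      fix x
      have "norm (apply_bcontfun W y - apply_bcontfun V y) \<le> dist W V" for y
        using dist_bounded[of W y V] by (simp add: dist_norm)
      from Td[OF continuous_on_apply_bcontfun continuous_on_apply_bcontfun this]
      show "dist (apply_bcontfun (TB W) x) (apply_bcontfun (TB V) x) \<le> 1 / 2 * dist W V"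
        unfolding TB dist_norm .
    qed
    then show "\<forall>W V. dist (TB W) (TB V) \<le> 1 / 2 * dist W V" by blast
  qed auto
  then obtain W where "TB W = W" by blast
  with TB[of W] have fix_eq: "apply_bcontfun W = T (apply_bcontfun W)" by simp
  let ?w = "apply_bcontfun W"
  let ?z = "zz ?w"
  have w: "continuous_on UNIV ?w" by (rule continuous_on_apply_bcontfun)
  have z_eq: "?z t = z0 + I ?w (max 0 t)" for t
    unfolding zz_def by (subst fix_eq) (simp add: T_def exp_minus)
  have "delay_solution M N r \<tau> p z0 ?z"
    unfolding delay_solution_def
  proof (intro conjI allI impI)
    show "continuous_on UNIV ?z" by (rule zzc[OF w])
    show "?z t = z0" if "t \<le> 0" for t
      using that by (simp add: z_eq I_def)
    fix t :: real assume t: "t \<ge> 0"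
    have "((\<lambda>t. z0 + I ?w t) has_vector_derivative delay_rhs M N r \<tau> p ?z t) (at t within {0..})"
      using has_vector_derivative_add[OF has_vector_derivative_const Id[OF w t]] by simp
    then show "(?z has_vector_derivative delay_rhs M N r \<tau> p ?z t) (at t within {0..})"
      by (rule has_vector_derivative_transform[rotated 2]) (use t in \<open>auto simp: z_eq\<close>)
  qed
  then show ?thesis by (rule that)
qed

section \<open>Laplace transforms\<close>

text \<open>The integral runs over the whole line, so a delay becomes a plain translation and
  \<open>laplace_shift\<close> has no boundary terms. Support on nonnegative times is imposed by
  \<open>exp_order\<close>; the history parts of delayed functions are added separately.\<close>

definition laplace :: "(real \<Rightarrow> real ^ 'n) \<Rightarrow> complex \<Rightarrow> complex ^ 'n" where
  "laplace f s = (LBINT t. exp (- (s * complex_of_real t)) *s cvec (f t))"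

definition exp_order :: "real \<Rightarrow> (real \<Rightarrow> real ^ 'n) \<Rightarrow> bool" where
  "exp_order \<mu> f \<longleftrightarrow> f \<in> borel_measurable borel \<and> (\<forall>t<0. f t = 0) \<and>
     (\<exists>C. \<forall>t\<ge>0. norm (f t) \<le> C * exp (\<mu> * t))"

section \<open>Functions of exponential order and the rules of the transform\<close>

lemma exp_order_mult:
  assumes "exp_order \<mu> f"
  shows "exp_order \<mu> (\<lambda>t. M *v f t)"
proof -
  have bl: "bounded_linear ((*v) M)" by (rule matrix_vector_mul_bounded_linear)
  obtain m where m: "m \<ge> 0" "\<And>v. norm (M *v v) \<le> norm v * m"
    using bounded_linear.nonneg_bounded[OF bl] by blast
  obtain C where C: "\<And>t. t \<ge> 0 \<Longrightarrow> norm (f t) \<le> C * exp (\<mu> * t)"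
    using assms by (auto simp: exp_order_def)
  have "norm (M *v f t) \<le> (C * m) * exp (\<mu> * t)" if "t \<ge> 0" for t
    using order_trans[OF m(2) mult_right_mono[OF C[OF that] m(1)]] by (simp add: mult_ac)
  moreover have "(\<lambda>t. M *v f t) \<in> borel_measurable borel"
    using assms borel_measurable_continuous_onI[OF bounded_linear.continuous_on[OF bl continuous_on_id]]
    by (auto simp: exp_order_def)
  ultimately show ?thesis using assms by (auto simp: exp_order_def)
qed

lemma exp_order_add:
  assumes "exp_order \<mu> f" "exp_order \<mu> g"
  shows "exp_order \<mu> (\<lambda>t. f t + g t)"
proof -
  obtain C1 C2 where C: "\<And>t. t \<ge> 0 \<Longrightarrow> norm (f t) \<le> C1 * exp (\<mu> * t)"
    "\<And>t. t \<ge> 0 \<Longrightarrow> norm (g t) \<le> C2 * exp (\<mu> * t)"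
    using assms by (auto simp: exp_order_def)
  have "norm (f t + g t) \<le> (C1 + C2) * exp (\<mu> * t)" if "t \<ge> 0" for t
    using norm_triangle_mono[OF C[OF that]] by (simp add: algebra_simps)
  then show ?thesis using assms by (auto simp: exp_order_def)
qed

lemma exp_order_diff:
  assumes "exp_order \<mu> f" "exp_order \<mu> g"
  shows "exp_order \<mu> (\<lambda>t. f t - g t)"
  using exp_order_add[OF assms(1) exp_order_mult[OF assms(2), of "- mat 1"]]
  by (simp add: bounded_bilinear.minus_left[OF bounded_bilinear_matrix_vector_mult])

lemma exp_order_shift:
  assumes f: "exp_order \<mu> f" and "d \<ge> 0" "\<mu> \<ge> 0"
  shows "exp_order \<mu> (\<lambda>t. f (t - d))"
proof -
  obtain C where C: "\<And>t. t \<ge> 0 \<Longrightarrow> norm (f t) \<le> C * exp (\<mu> * t)"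
    using f by (auto simp: exp_order_def)
  have C0: "C \<ge> 0" using order_trans[OF norm_ge_zero C[of 0]] by simp
  have "norm (f (t - d)) \<le> C * exp (\<mu> * t)" if "t \<ge> 0" for t
  proof (cases "t \<ge> d")
    case True
    have "norm (f (t - d)) \<le> C * exp (\<mu> * (t - d))" using C[of "t - d"] True by simp
    also have "\<dots> \<le> C * exp (\<mu> * t)" using C0 assms by (intro mult_left_mono) (auto intro: mult_left_mono)
    finally show ?thesis .
  next
    case False
    then show ?thesis using f C0 by (simp add: exp_order_def)
  qed
  then show ?thesis using assms by (auto simp: exp_order_def)
qed

lemma measurable_vector_scalar_mult [measurable]:
  assumes [measurable]: "f \<in> borel_measurable M" "g \<in> borel_measurable M"
  shows "(\<lambda>x. (f x :: complex) *s (g x :: complex ^ 'n)) \<in> borel_measurable M"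
proof -
  have "continuous_on UNIV (\<lambda>p. fst p *s (snd p :: complex ^ 'n))"
    by (intro bounded_bilinear.continuous_on[OF bounded_bilinear_vector_scalar_mult] continuous_intros)
  from borel_measurable_continuous_on[OF this, of "\<lambda>x. (f x, g x)" M] show ?thesis by simp
qed

lemma measurable_cvec [measurable]: "cvec \<in> borel_measurable borel"
  by (intro borel_measurable_continuous_onI bounded_linear.continuous_on[OF bounded_linear_cvec] continuous_on_id)

lemma integrable_exp_atLeast:
  assumes "(a::real) > 0"
  shows "integrable lborel (\<lambda>t. indicator {0..} t * exp (- a * t))"
proof -
  have "integrable lborel (\<lambda>t::real. indicator {0<..} t * exp (- (t * a)))"
    using integrable_I0i_exp_mscale[OF assms] by (simp add: set_integrable_def)
  moreover have "AE t in lborel. indicator {0<..} t * exp (- (t * a)) = indicator {0..} t * exp (- a * t)"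
    using AE_lborel_singleton[of 0] by eventually_elim (auto simp: indicator_def mult.commute)
  ultimately show ?thesis by (subst (asm) integrable_cong_AE) auto
qed

lemma integrable_laplace:
  assumes f: "exp_order \<mu> f" and s: "Re s > \<mu>"
  shows "integrable lborel (\<lambda>t. exp (- (s * complex_of_real t)) *s cvec (f t))"
proof -
  obtain C where C: "\<And>t. t \<ge> 0 \<Longrightarrow> norm (f t) \<le> C * exp (\<mu> * t)"
    using f by (auto simp: exp_order_def)
  have [measurable]: "f \<in> borel_measurable borel" using f by (simp add: exp_order_def)
  show ?thesis
  proof (rule Bochner_Integration.integrable_bound)
    show "integrable lborel (\<lambda>t. C * (indicator {0..} t * exp (- (Re s - \<mu>) * t)))"
      using s by (intro integrable_mult_right integrable_exp_atLeast) simp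
    show "AE t in lborel. norm (exp (- (s * complex_of_real t)) *s cvec (f t))
        \<le> norm (C * (indicator {0..} t * exp (- (Re s - \<mu>) * t)))"
    proof (intro AE_I2)
      fix t :: real
      show "norm (exp (- (s * complex_of_real t)) *s cvec (f t))
        \<le> norm (C * (indicator {0..} t * exp (- (Re s - \<mu>) * t)))"
      proof (cases "t \<ge> 0")
        case True
        have "norm (exp (- (s * complex_of_real t)) *s cvec (f t)) \<le> exp (- (Re s * t)) * (C * exp (\<mu> * t))"
          using C[OF True] by (simp add: norm_exp_eq_Re)
        also have "\<dots> = C * exp (- (Re s - \<mu>) * t)" by (simp add: exp_add[symmetric] algebra_simps mult_exp_exp)
        also have "\<dots> \<le> norm (C * (indicator {0..} t * exp (- (Re s - \<mu>) * t)))" using True by simp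
        finally show ?thesis .
      next
        case False
        then show ?thesis using f by (simp add: exp_order_def)
      qed
    qed
  qed measurable
qed

lemma laplace_add:
  assumes "exp_order \<mu> f" "exp_order \<mu> g" "Re s > \<mu>"
  shows "laplace (\<lambda>t. f t + g t) s = laplace f s + laplace g s"
  using Bochner_Integration.integral_add[OF integrable_laplace[OF assms(1,3)] integrable_laplace[OF assms(2,3)]]
  by (simp add: laplace_def linear_add[OF bounded_linear.linear[OF bounded_linear_cvec]] vector_add_ldistrib)

lemma laplace_mult:
  assumes "exp_order \<mu> f" "Re s > \<mu>"
  shows "laplace (\<lambda>t. M *v f t) s = cmat M *v laplace f s"
  using integral_bounded_linear[OF matrix_vector_mul_bounded_linear integrable_laplace[OF assms], of "cmat M"]
  by (simp add: laplace_def cmat_mult_cvec[symmetric] vector_scalar_commute)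

lemma laplace_diff:
  assumes "exp_order \<mu> f" "exp_order \<mu> g" "Re s > \<mu>"
  shows "laplace (\<lambda>t. f t - g t) s = laplace f s - laplace g s"
  using Bochner_Integration.integral_diff[OF integrable_laplace[OF assms(1,3)] integrable_laplace[OF assms(2,3)]]
  by (simp add: laplace_def linear_diff[OF bounded_linear.linear[OF bounded_linear_cvec]] vector_ssub_ldistrib)

lemma laplace_shift:
  assumes "exp_order \<mu> f" "Re s > \<mu>"
  shows "laplace (\<lambda>t. f (t - d)) s = exp (- (s * complex_of_real d)) *s laplace f s"
proof -
  have "laplace (\<lambda>t. f (t - d)) s = (LBINT t. exp (- (s * complex_of_real (d + 1 * t))) *s cvec (f ((d + 1 * t) - d)))"
    unfolding laplace_def
    using lborel_integral_real_affine[of 1 "\<lambda>t. exp (- (s * complex_of_real t)) *s cvec (f (t - d))" d] by simp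
  also have "\<dots> = (LBINT t. exp (- (s * complex_of_real d)) *s (exp (- (s * complex_of_real t)) *s cvec (f t)))"
    by (intro Bochner_Integration.integral_cong)
      (auto simp: vector_smult_assoc mult_exp_exp algebra_simps)
  also have "\<dots> = exp (- (s * complex_of_real d)) *s laplace f s"
    unfolding laplace_def
    by (intro integral_bounded_linear integrable_laplace[OF assms]
        bounded_bilinear.bounded_linear_right[OF bounded_bilinear_vector_scalar_mult])
  finally show ?thesis .
qed

lemma has_vector_derivative_exp_cvec:
  assumes "(y has_vector_derivative y') (at t within S)"
  shows "((\<lambda>t. exp (- (s * complex_of_real t)) *s cvec (y t)) has_vector_derivative
    exp (- (s * complex_of_real t)) *s cvec y' - s *s (exp (- (s * complex_of_real t)) *s cvec (y t))) (at t within S)"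
proof -
  have "((\<lambda>t. exp (- (s * complex_of_real t))) has_vector_derivative (- s * exp (- (s * complex_of_real t)))) (at t within S)"
    by (rule has_vector_derivative_real_field) (auto intro!: derivative_eq_intros)
  from bounded_bilinear.has_vector_derivative[OF bounded_bilinear_vector_scalar_mult this
      bounded_linear.has_vector_derivative[OF bounded_linear_cvec assms]]
  show ?thesis by (simp add: vector_smult_assoc vector_smult_lneg algebra_simps)
qed

text \<open>The derivative of exp(-st) y(t) is integrated over the open half line. The end at
  infinity contributes nothing since Re s > \<mu>. At 0 only the right limit \<open>y0\<close>
  enters, so \<open>y\<close> may jump there, as the truncated exponential does.\<close>

lemma laplace_derivative:
  assumes y: "exp_order \<mu> y" and g: "exp_order \<mu> g" and s: "Re s > \<mu>"
    and d: "\<And>t. t > 0 \<Longrightarrow> (y has_vector_derivative g t) (at t)"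
    and gc: "continuous_on {0<..} g" and y0: "(y \<longlongrightarrow> y0) (at_right 0)"
  shows "laplace g s = s *s laplace y s - cvec y0"
proof -
  let ?G = "\<lambda>t. exp (- (s * complex_of_real t)) *s cvec (y t)"
  let ?g = "\<lambda>t. exp (- (s * complex_of_real t)) *s cvec (g t)"
  obtain C where C: "\<And>t. t \<ge> 0 \<Longrightarrow> norm (y t) \<le> C * exp (\<mu> * t)"
    using y by (auto simp: exp_order_def)
  have int: "integrable lborel (\<lambda>t. ?g t - s *s ?G t)"
    by (intro Bochner_Integration.integrable_diff integrable_laplace[OF g s]
        integrable_bounded_linear[OF bounded_bilinear.bounded_linear_right[OF bounded_bilinear_vector_scalar_mult]]
        integrable_laplace[OF y s])
  have ein: "einterval 0 \<infinity> = {0::real<..}" by (auto simp: einterval_def)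
  have "(LBINT t=0..\<infinity>. ?g t - s *s ?G t) = 0 - cvec y0"
  proof (rule interval_integral_FTC_integrable)
    fix t :: real assume "0 < ereal t"
    then have t: "t > 0" by simp
    show "(?G has_vector_derivative (?g t - s *s ?G t)) (at t)"
      by (rule has_vector_derivative_exp_cvec[OF d[OF t]])
    have "isCont g t" using gc t by (simp add: continuous_on_eq_continuous_at)
    moreover have "isCont y t" using d[OF t] by (rule has_vector_derivative_continuous)
    ultimately show "isCont (\<lambda>t. ?g t - s *s ?G t) t"
      by (intro continuous_intros bounded_bilinear.continuous[OF bounded_bilinear_vector_scalar_mult]
          bounded_linear.continuous[OF bounded_linear_cvec])
  next
    show "set_integrable lborel (einterval 0 \<infinity>) (\<lambda>t. ?g t - s *s ?G t)"
      unfolding set_integrable_def by (intro integrable_mult_indicator int) simp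
    have "(?G \<longlongrightarrow> exp (- (s * complex_of_real 0)) *s cvec y0) (at_right 0)"
      by (intro bounded_bilinear.tendsto[OF bounded_bilinear_vector_scalar_mult]
          bounded_linear.tendsto[OF bounded_linear_cvec] y0 tendsto_intros)
    then show "((?G \<circ> real_of_ereal) \<longlongrightarrow> cvec y0) (at_right 0)"
      by (simp add: zero_ereal_def ereal_tendsto_simps)
    have "(?G \<longlongrightarrow> 0) at_top"
    proof (rule Lim_null_comparison)
      show "\<forall>\<^sub>F t in at_top. norm (?G t) \<le> C * exp (- (Re s - \<mu>) * t)"
        using eventually_ge_at_top[of 0]
      proof eventually_elim
        case (elim t)
        have "norm (?G t) \<le> exp (- (Re s * t)) * (C * exp (\<mu> * t))"
          using C[OF elim] by (simp add: norm_exp_eq_Re)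
        also have "\<dots> = C * exp (- (Re s - \<mu>) * t)" by (simp add: algebra_simps mult_exp_exp)
        finally show ?case .
      qed
      have "((\<lambda>t. exp (- (Re s - \<mu>) * t)) \<longlongrightarrow> 0) at_top"
        using s by real_asymp
      from tendsto_mult_left[OF this, of C] show "((\<lambda>t. C * exp (- (Re s - \<mu>) * t)) \<longlongrightarrow> 0) at_top" by simp
    qed
    then show "((?G \<circ> real_of_ereal) \<longlongrightarrow> 0) (at_left \<infinity>)"
      by (simp add: ereal_tendsto_simps)
  qed simp
  then have h1: "(LBINT t. indicator {0<..} t *\<^sub>R (?g t - s *s ?G t)) = - cvec y0"
    by (simp add: interval_lebesgue_integral_def set_lebesgue_integral_def ein)
  have h2: "(LBINT t. indicator {0<..} t *\<^sub>R (?g t - s *s ?G t)) = (LBINT t. ?g t - s *s ?G t)"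
  proof (rule integral_cong_AE)
    show "AE t in lborel. indicator {0<..} t *\<^sub>R (?g t - s *s ?G t) = ?g t - s *s ?G t"
      using AE_lborel_singleton[of 0]
    proof eventually_elim
      case (elim t)
      then show ?case using y g linear_0[OF bounded_linear.linear[OF bounded_linear_cvec]]
        by (cases "t > 0") (auto simp: exp_order_def)
    qed
  qed (use int in auto)
  have h3: "(LBINT t. ?g t - s *s ?G t) = laplace g s - s *s laplace y s"
  proof -
    note bl = bounded_bilinear.bounded_linear_right[OF bounded_bilinear_vector_scalar_mult, of s]
    have "(LBINT t. ?g t - s *s ?G t) = (LBINT t. ?g t) - (LBINT t. s *s ?G t)"
      by (rule Bochner_Integration.integral_diff[OF integrable_laplace[OF g s]
          integrable_bounded_linear[OF bl integrable_laplace[OF y s]]])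
    also have "(LBINT t. s *s ?G t) = s *s (LBINT t. ?G t)"
      by (rule integral_bounded_linear[OF bl integrable_laplace[OF y s]])
    finally show ?thesis by (simp only: laplace_def)
  qed
  have "laplace g s - s *s laplace y s = - cvec y0"
    by (rule trans[OF trans[OF h3[symmetric] h2[symmetric]] h1])
  then show ?thesis by (simp add: algebra_simps)
qed

section \<open>Transforms of the subtracted exponential and of history segments\<close>

lemma exp_order_exp_minus:
  assumes "\<mu> \<ge> 0"
  shows "exp_order \<mu> (\<lambda>t. indicator {0<..} t *\<^sub>R (exp (- t) *\<^sub>R v))"
proof -
  have "norm (indicator {0<..} t *\<^sub>R (exp (- t) *\<^sub>R v)) \<le> norm v * exp (\<mu> * t)" if "t \<ge> 0" for t
  proof -
    have "\<mu> * t \<ge> 0" using that assms by simp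
    then have "exp (- t) \<le> exp (\<mu> * t)" using that by simp
    then have "exp (- t) * norm v \<le> exp (\<mu> * t) * norm v" by (rule mult_right_mono) simp
    then show ?thesis by (auto simp: indicator_def mult.commute)
  qed
  then show ?thesis by (auto simp: exp_order_def)
qed

text \<open>The truncated exponential satisfies q' = -q for positive times and has right limit
  \<open>v\<close> at 0, so the derivative rule becomes the algebraic equation (s + 1) q^ = v.
  Writing -q as \<open>- mat 1 *v q\<close> makes the rule for matrix multiples applicable.\<close>

lemma laplace_exp_minus:
  assumes s: "Re s > 0"
  shows "laplace (\<lambda>t. indicator {0<..} t *\<^sub>R (exp (- t) *\<^sub>R v)) s = (1 / (s + 1)) *s cvec v"
proof -
  let ?q = "\<lambda>t. indicator {0::real<..} t *\<^sub>R (exp (- t) *\<^sub>R v)"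
  have q: "exp_order 0 ?q" by (rule exp_order_exp_minus) simp
  have ev: "((\<lambda>t. exp (- t) *\<^sub>R v) has_vector_derivative (- mat 1 *v (exp (- t) *\<^sub>R v))) (at t)" for t
    by (auto intro!: derivative_eq_intros
        simp: has_real_derivative_iff_has_vector_derivative[symmetric]
        bounded_bilinear.minus_left[OF bounded_bilinear_matrix_vector_mult])
  have "laplace (\<lambda>t. - mat 1 *v ?q t) s = s *s laplace ?q s - cvec v"
  proof (rule laplace_derivative[OF q exp_order_mult[OF q] s])
    fix t :: real assume t: "t > 0"
    show "(?q has_vector_derivative (- mat 1 *v ?q t)) (at t)"
      by (rule has_vector_derivative_transform_within_open[of "\<lambda>t. exp (- t) *\<^sub>R v" _ _ "{0<..}"])
        (use ev[of t] t in auto)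
  next
    have "continuous_on {0<..} (\<lambda>t. - mat 1 *v (exp (- t) *\<^sub>R v))"
      by (intro bounded_linear.continuous_on[OF matrix_vector_mul_bounded_linear] continuous_intros)
    then show "continuous_on {0<..} (\<lambda>t. - mat 1 *v ?q t)"
      by (rule continuous_on_eq) auto
    have "((\<lambda>t. exp (- t) *\<^sub>R v) \<longlongrightarrow> exp (- 0) *\<^sub>R v) (at_right (0::real))"
      by (intro tendsto_intros)
    moreover have "\<forall>\<^sub>F t in at_right (0::real). exp (- t) *\<^sub>R v = ?q t"
      by (auto simp: eventually_at_right_field intro!: exI[of _ 1])
    ultimately show "(?q \<longlongrightarrow> v) (at_right 0)" using tendsto_cong by fastforce
  qed
  moreover have "laplace (\<lambda>t. - mat 1 *v ?q t) s = cmat (- mat 1) *v laplace ?q s"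
    by (rule laplace_mult[OF q s])
  moreover have "cmat (- mat 1) *v laplace ?q s = - laplace ?q s"
    by (simp add: vec_eq_iff matrix_vector_mult_def mat_def if_distrib if_distribR sum_negf cong: if_cong)
  ultimately have "(s + 1) *s laplace ?q s = cvec v"
    by (simp add: vector_sadd_rdistrib algebra_simps)
  moreover have "s + 1 \<noteq> 0" using s by (auto simp: complex_eq_iff)
  ultimately show ?thesis
    by (metis (no_types) nonzero_eq_divide_eq vector_smult_assoc vector_smult_lid)
qed

lemma continuous_on_exp_cvec:
  assumes "continuous_on S z"
  shows "continuous_on S (\<lambda>t. exp (- (s * complex_of_real t)) *s cvec (z t))"
  by (intro bounded_bilinear.continuous_on[OF bounded_bilinear_vector_scalar_mult] continuous_intros
      bounded_linear.continuous_on[OF bounded_linear_cvec] assms)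

text \<open>Passes from the Lebesgue to the gauge integral, for which the fundamental theorem and
  the Leibniz rule are used below.\<close>

lemma laplace_segment_eq_integral:
  assumes "continuous_on {0..d} z"
  shows "laplace (\<lambda>t. indicator {0..d} t *\<^sub>R z t) s
    = integral {0..d} (\<lambda>t. exp (- (s * complex_of_real t)) *s cvec (z t))"
proof -
  have "set_integrable lborel {0..d} (\<lambda>t. exp (- (s * complex_of_real t)) *s cvec (z t))"
    by (intro borel_integrable_atLeastAtMost' continuous_on_exp_cvec assms)
  then have "integral {0..d} (\<lambda>t. exp (- (s * complex_of_real t)) *s cvec (z t))
    = (LBINT t:{0..d}. exp (- (s * complex_of_real t)) *s cvec (z t))"
    by (rule set_borel_integral_eq_integral(2)[symmetric])
  also have "\<dots> = laplace (\<lambda>t. indicator {0..d} t *\<^sub>R z t) s"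
    unfolding laplace_def set_lebesgue_integral_def
    by (intro Bochner_Integration.integral_cong refl)
      (auto simp: indicator_def linear_0[OF bounded_linear.linear[OF bounded_linear_cvec]])
  finally show ?thesis ..
qed

lemma exp_order_segment:
  assumes z: "continuous_on {0..d} z" and \<mu>: "\<mu> \<ge> 0"
  shows "exp_order \<mu> (\<lambda>t. indicator {0..d} t *\<^sub>R z t)"
proof -
  obtain b where b: "\<And>t. t \<in> {0..d} \<Longrightarrow> norm (z t) \<le> b"
    using compact_imp_bounded[OF compact_continuous_image[OF z compact_Icc]] unfolding bounded_iff by blast
  have "norm (indicator {0..d} t *\<^sub>R z t) \<le> \<bar>b\<bar> * exp (\<mu> * t)" if "t \<ge> 0" for t
  proof -
    have "norm (indicator {0..d} t *\<^sub>R z t) \<le> \<bar>b\<bar> * 1" using b[of t] by (auto simp: indicator_def)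
    also have "\<dots> \<le> \<bar>b\<bar> * exp (\<mu> * t)" using that \<mu> by (intro mult_left_mono) auto
    finally show ?thesis .
  qed
  moreover have "(\<lambda>t. indicator {0..d} t *\<^sub>R z t) \<in> borel_measurable borel"
    by (rule borel_measurable_continuous_on_indicator[OF _ z]) simp
  ultimately show ?thesis by (auto simp: exp_order_def)
qed

text \<open>One integration by parts trades a factor \<open>s\<close> for a derivative of
  \<open>z\<close>. Every integrand is at most exp(d) D: the two end points contribute 2, the
  integral of z' contributes d, and the unweighted transform another d, in total 2 + 2d.\<close>

lemma laplace_segment_bound:
  assumes d: "d \<ge> 0" and z: "\<And>t. t \<in> {0..d} \<Longrightarrow> (z has_vector_derivative z' t) (at t within {0..d})"
    and z'c: "continuous_on {0..d} z'"
    and D: "\<And>t. t \<in> {0..d} \<Longrightarrow> norm (z t) \<le> D" "\<And>t. t \<in> {0..d} \<Longrightarrow> norm (z' t) \<le> D"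
    and s: "Re s \<ge> -1"
  shows "(1 + norm s) * norm (laplace (\<lambda>t. indicator {0..d} t *\<^sub>R z t) s) \<le> (2 + 2 * d) * exp d * D"
proof -
  have zc: "continuous_on {0..d} z" using z by (rule continuous_on_vector_derivative)
  have D0: "D \<ge> 0" using order_trans[OF norm_ge_zero D(1)[of 0]] d by simp
  let ?E = "\<lambda>w t. exp (- (s * complex_of_real t)) *s cvec (w t)"
  have Ec: "?E w integrable_on {0..d}" if "continuous_on {0..d} w" for w
    by (intro integrable_continuous_interval continuous_on_exp_cvec that)
  have En: "norm (?E w t) \<le> exp d * D" if "t \<in> {0..d}" "norm (w t) \<le> D" for w t
  proof -
    have "- (Re s * t) \<le> t" using mult_right_mono[OF s, of t] that by simp
    then have "exp (- (Re s * t)) \<le> exp d" using that by auto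
    then have "exp (- (Re s * t)) * norm (w t) \<le> exp d * D" using that by (intro mult_mono) auto
    then show ?thesis by (simp add: norm_exp_eq_Re)
  qed
  have In: "norm (integral {0..d} (?E w)) \<le> exp d * D * d"
    if "continuous_on {0..d} w" "\<And>t. t \<in> {0..d} \<Longrightarrow> norm (w t) \<le> D" for w
    using integral_bound[OF d continuous_on_exp_cvec[OF that(1), where s=s], where B="exp d * D"] En[of _ w] that(2) by simp
  have "((\<lambda>t. ?E z' t - s *s ?E z t) has_integral (?E z d - ?E z 0)) {0..d}"
    by (rule fundamental_theorem_of_calculus[OF d]) (rule has_vector_derivative_exp_cvec[OF z])
  moreover have "((\<lambda>t. ?E z' t - s *s ?E z t) has_integral (integral {0..d} (?E z') - s *s integral {0..d} (?E z))) {0..d}"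
    using has_integral_diff[OF integrable_integral[OF Ec[OF z'c]]
        has_integral_linear[OF integrable_integral[OF Ec[OF zc]]
          bounded_bilinear.bounded_linear_right[OF bounded_bilinear_vector_scalar_mult, of s]]]
    by (simp only: o_def)
  ultimately have "?E z d - ?E z 0 = integral {0..d} (?E z') - s *s integral {0..d} (?E z)"
    by (rule has_integral_unique)
  then have "s *s integral {0..d} (?E z) = ?E z 0 - ?E z d + integral {0..d} (?E z')"
    by (simp add: algebra_simps)
  from arg_cong[OF this, of norm] have "norm s * norm (integral {0..d} (?E z)) = norm (?E z 0 - ?E z d + integral {0..d} (?E z'))"
    by (simp only: norm_vector_scalar_mult)
  also have "\<dots> \<le> exp d * D + exp d * D + exp d * D * d"
    using d by (intro norm_triangle_mono order_trans[OF norm_triangle_ineq4] add_mono En D In z'c) auto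
  finally have "norm s * norm (integral {0..d} (?E z)) \<le> exp d * D + exp d * D + exp d * D * d" .
  moreover have "norm (integral {0..d} (?E z)) \<le> exp d * D * d" by (intro In zc D)
  ultimately show ?thesis
    unfolding laplace_segment_eq_integral[OF zc] by (simp add: algebra_simps)
qed

lemma holomorphic_laplace_segment:
  assumes d: "d \<ge> 0" and z: "continuous_on {0..d} z"
  shows "(\<lambda>s. laplace (\<lambda>t. indicator {0..d} t *\<^sub>R z t) s $ i) holomorphic_on UNIV"
proof -
  have eq: "laplace (\<lambda>t. indicator {0..d} t *\<^sub>R z t) s $ i
    = integral (cbox 0 d) (\<lambda>t. exp (- (s * complex_of_real t)) * complex_of_real (z t $ i))" for s
  proof -
    have "integral {0..d} ((\<lambda>v. v $ i) \<circ> (\<lambda>t. exp (- (s * complex_of_real t)) *s cvec (z t)))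
      = integral {0..d} (\<lambda>t. exp (- (s * complex_of_real t)) *s cvec (z t)) $ i"
      by (intro integral_linear integrable_continuous_interval continuous_on_exp_cvec z bounded_linear_vec_nth)
    then show ?thesis by (simp add: laplace_segment_eq_integral[OF z] o_def cbox_interval)
  qed
  have zi: "continuous_on {0..d} (\<lambda>t. z t $ i)"
    by (intro continuous_intros z)
  show ?thesis
    unfolding eq
  proof (rule leibniz_rule_holomorphic[where fx="\<lambda>s t. - complex_of_real t * exp (- (s * complex_of_real t)) * complex_of_real (z t $ i)"])
    show "((\<lambda>s. exp (- (s * complex_of_real t)) * complex_of_real (z t $ i)) has_field_derivative
        - complex_of_real t * exp (- (s * complex_of_real t)) * complex_of_real (z t $ i)) (at s within UNIV)" for s t
      by (auto intro!: derivative_eq_intros)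
    show "(\<lambda>t. exp (- (s * complex_of_real t)) * complex_of_real (z t $ i)) integrable_on cbox 0 d" for s
      unfolding cbox_interval by (intro integrable_continuous_interval continuous_intros zi)
    have "continuous_on (UNIV \<times> {0..d}) (\<lambda>p. z (snd p))"
      by (rule continuous_on_compose2[OF z continuous_on_snd[OF continuous_on_id]]) auto
    then show "continuous_on (UNIV \<times> cbox 0 d)
       (\<lambda>(s, t). - complex_of_real t * exp (- (s * complex_of_real t)) * complex_of_real (z t $ i))"
      unfolding cbox_interval case_prod_unfold by (intro continuous_intros) auto
  qed simp
qed

text \<open>On the line Re s = \<mu> + 1 the transform is the Fourier transform of an integrable
  function, so inversion recovers y(t). After the shift to Re s = -\<epsilon>/2 the kernel has
  modulus exp(-\<epsilon> t/2), and the integral of K / (1 + w^2) is K \<pi>; division by 2 \<pi>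
  leaves K/2. The cardinality comes from estimating the norm by the sum of the components. Neither
  \<mu> nor the growth constant survives in the bound.\<close>

lemma inverse_laplace_decay:
  fixes y :: "real \<Rightarrow> real ^ 'n" and Y :: "complex \<Rightarrow> complex ^ 'n"
  assumes \<epsilon>: "\<epsilon> > 0" and \<mu>: "\<mu> \<ge> 0" and y: "exp_order \<mu> y" and yc: "continuous_on UNIV y"
    and Y: "\<And>s. Re s > \<mu> \<Longrightarrow> laplace y s = Y s"
    and hol: "\<And>i. (\<lambda>s. Y s $ i) holomorphic_on {s. Re s > - \<epsilon>}"
    and bound: "\<And>s. Re s > - \<epsilon> \<Longrightarrow> norm (Y s) \<le> K / (1 + (Im s)\<^sup>2)"
    and t: "t \<ge> 0"
  shows "norm (y t) \<le> real CARD('n) * (K / 2 * exp (- (\<epsilon> / 2) * t))"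
proof -
  have comp: "\<bar>y t $ i\<bar> \<le> K / 2 * exp (- (\<epsilon> / 2) * t)" for i
  proof -
    define c where "c = \<mu> + 1"
    define g where "g x = exp (- c * x) *\<^sub>R complex_of_real (y x $ i)" for x
    define H where "H s = Y s $ i * exp (s * complex_of_real t)" for s
    have bi: "norm (Y s $ i) \<le> K / (1 + (Im s)\<^sup>2)" if "Re s > - \<epsilon>" for s
      by (rule order_trans[OF Finite_Cartesian_Product.norm_nth_le bound[OF that]])
    have K0: "K \<ge> 0" using order_trans[OF norm_ge_zero bound[of 0]] \<epsilon> by simp
    have nexp: "norm (exp (s * complex_of_real t)) = exp (Re s * t)" for s
      by (simp add: norm_exp_eq_Re)
    have holH: "H holomorphic_on {s. Re s > - \<epsilon>}"
      unfolding H_def by (intro holomorphic_intros hol)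
    have bH: "norm (H s) \<le> (K * exp (c * t)) / (1 + (Im s)\<^sup>2)" if s: "- (\<epsilon> / 2) \<le> Re s" "Re s \<le> c" for s
    proof -
      have "norm (H s) \<le> K / (1 + (Im s)\<^sup>2) * exp (c * t)"
        unfolding H_def norm_mult nexp
        using bi[of s] s \<epsilon> t K0 by (intro mult_mono) (auto intro: mult_right_mono divide_nonneg_nonneg add_nonneg_nonneg)
      then show ?thesis by simp
    qed
    have line: "(LBINT w. H (Complex (- (\<epsilon> / 2)) w)) = (LBINT w. H (Complex c w))"
      "integrable lborel (\<lambda>w. H (Complex (- (\<epsilon> / 2)) w))"
      using \<epsilon> \<mu> by (auto intro!: vertical_line_shift[OF holH _ _ bH] simp: c_def)
    have gh: "Y (Complex c w) $ i = (LBINT x. g x * iexp (- (w * x)))" for w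
    proof -
      have "Y (Complex c w) $ i = laplace y (Complex c w) $ i" by (subst Y) (auto simp: c_def)
      also have "\<dots> = (LBINT x. (exp (- (Complex c w * complex_of_real x)) *s cvec (y x)) $ i)"
        unfolding laplace_def
        by (rule integral_bounded_linear[symmetric, OF bounded_linear_vec_nth integrable_laplace[OF y]])
          (simp add: c_def)
      also have "\<dots> = (LBINT x. g x * iexp (- (w * x)))"
      proof (rule Bochner_Integration.integral_cong[OF refl])
        fix x
        have "- (Complex c w * complex_of_real x) = complex_of_real (- c * x) + \<i> * complex_of_real (- (w * x))"
          by (simp add: complex_eq_iff)
        then have "exp (- (Complex c w * complex_of_real x)) = complex_of_real (exp (- c * x)) * iexp (- (w * x))"
          by (simp only: exp_add exp_of_real)
        then show "(exp (- (Complex c w * complex_of_real x)) *s cvec (y x)) $ i = g x * iexp (- (w * x))"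
          by (simp add: g_def scaleR_conv_of_real)
      qed
      finally show ?thesis .
    qed
    have gint: "integrable lborel g"
    proof -
      have "integrable lborel (\<lambda>x. (exp (- (complex_of_real c * complex_of_real x)) *s cvec (y x)) $ i)"
        by (intro integrable_bounded_linear[OF bounded_linear_vec_nth] integrable_laplace[OF y]) (simp add: c_def)
      moreover have "(\<lambda>x. (exp (- (complex_of_real c * complex_of_real x)) *s cvec (y x)) $ i) = g"
        by (simp add: fun_eq_iff g_def scaleR_conv_of_real exp_of_real[symmetric])
      ultimately show ?thesis by simp
    qed
    obtain C where C: "\<And>x. x \<ge> 0 \<Longrightarrow> norm (y x) \<le> C * exp (\<mu> * x)"
      using y by (auto simp: exp_order_def)
    have C0: "C \<ge> 0" using order_trans[OF norm_ge_zero C[of 0]] by simp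
    have gb: "norm (g x) \<le> C" for x
    proof (cases "x \<ge> 0")
      case True
      have "norm (g x) = exp (- c * x) * \<bar>y x $ i\<bar>" by (simp add: g_def)
      also have "\<dots> \<le> exp (- c * x) * (C * exp (\<mu> * x))"
        using order_trans[OF component_le_norm_cart C[OF True]] by (intro mult_left_mono) auto
      also have "\<dots> = C * exp (- x)" by (simp add: c_def algebra_simps mult_exp_exp)
      also have "\<dots> \<le> C * 1" using True C0 by (intro mult_left_mono) auto
      finally show ?thesis by simp
    next
      case False
      then show ?thesis using y C0 by (simp add: exp_order_def g_def)
    qed
    \<comment> \<open>Both lines are taken equal here; what is wanted is the integrability in the
      shifting lemma.\<close>
    have ghi: "integrable lborel (\<lambda>w. Y (Complex c w) $ i)"
    proof (rule vertical_line_shift(2)[OF hol[of i], of c c K])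
      show "norm (Y s $ i) \<le> K / (1 + (Im s)\<^sup>2)" if "c \<le> Re s" for s
        using that \<mu> \<epsilon> by (intro bi) (simp add: c_def)
    qed (use \<mu> \<epsilon> in \<open>auto simp: c_def\<close>)
    have gc: "isCont g t"
    proof -
      have "continuous_on UNIV g" unfolding g_def by (intro continuous_intros yc)
      then show ?thesis by (simp add: continuous_on_eq_continuous_at)
    qed
    have "(LBINT w. Y (Complex c w) $ i * iexp (w * t)) = complex_of_real (2 * pi) * g t"
      by (rule fourier_inversion[OF gint gb gc gh ghi])
    moreover have "H (Complex c w) = complex_of_real (exp (c * t)) * (Y (Complex c w) $ i * iexp (w * t))" for w
    proof -
      have "Complex c w * complex_of_real t = complex_of_real (c * t) + \<i> * complex_of_real (w * t)"
        by (simp add: complex_eq_iff)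
      then show ?thesis by (simp only: H_def exp_add exp_of_real mult_ac)
    qed
    ultimately have "(LBINT w. H (Complex c w)) = complex_of_real (exp (c * t)) * (complex_of_real (2 * pi) * g t)"
      by (simp only: integral_mult_right_zero)
    also have "\<dots> = complex_of_real (2 * pi * (y t $ i) * (exp (c * t) * exp (- c * t)))"
      by (simp only: g_def scaleR_conv_of_real of_real_mult mult_ac)
    also have "exp (c * t) * exp (- c * t) = 1" by (simp add: mult_exp_exp)
    finally have val: "(LBINT w. H (Complex (- (\<epsilon> / 2)) w)) = complex_of_real (2 * pi * (y t $ i) * 1)"
      unfolding line(1) .
    have "2 * pi * \<bar>y t $ i\<bar> = \<bar>2 * pi * (y t $ i) * 1\<bar>" by (simp add: abs_mult)
    also have "\<dots> = norm (LBINT w. H (Complex (- (\<epsilon> / 2)) w))" by (simp only: val norm_of_real)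
    also have "\<dots> \<le> (LBINT w. K * exp (- (\<epsilon> / 2) * t) * (1 / (1 + w\<^sup>2)))"
    proof (rule Bochner_Integration.integral_norm_bound_integral[OF line(2)])
      show "integrable lborel (\<lambda>w. K * exp (- (\<epsilon> / 2) * t) * (1 / (1 + w\<^sup>2)))"
        by (intro integrable_mult_right integrable_inverse_square)
      show "norm (H (Complex (- (\<epsilon> / 2)) w)) \<le> K * exp (- (\<epsilon> / 2) * t) * (1 / (1 + w\<^sup>2))" for w
      proof -
        have "norm (H (Complex (- (\<epsilon> / 2)) w)) \<le> K / (1 + w\<^sup>2) * exp (- (\<epsilon> / 2) * t)"
          unfolding H_def norm_mult nexp using bi[of "Complex (- (\<epsilon> / 2)) w"] \<epsilon> K0
          by (intro mult_mono) (auto intro!: divide_nonneg_nonneg add_nonneg_nonneg)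
        then show ?thesis by simp
      qed
    qed
    also have "\<dots> = K * exp (- (\<epsilon> / 2) * t) * pi"
      by (simp only: integral_mult_right_zero integral_inverse_square)
    finally show ?thesis using pi_gt_zero by (simp add: field_simps)
  qed
  have "norm (y t) \<le> (\<Sum>i\<in>UNIV. \<bar>y t $ i\<bar>)" by (rule norm_le_l1_cart)
  also have "\<dots> \<le> (\<Sum>i\<in>(UNIV :: 'n set). K / 2 * exp (- (\<epsilon> / 2) * t))" by (intro sum_mono comp)
  finally show ?thesis by simp
qed

section \<open>Decay of solutions of the delay equation\<close>

lemma has_vector_derivative_translate:
  fixes f :: "real \<Rightarrow> 'a::real_normed_vector"
  assumes "(f has_vector_derivative f') (at (t + c) within T)" "(\<lambda>s. s + c) ` S \<subseteq> T"
  shows "((\<lambda>s. f (s + c)) has_vector_derivative f') (at t within S)"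
proof -
  have "((\<lambda>s. s + c) has_vector_derivative 1) (at t within S)"
    by (auto intro!: derivative_eq_intros)
  from vector_diff_chain_within[OF this has_vector_derivative_within_subset[OF assms]]
  show ?thesis by (simp add: o_def)
qed

lemma has_vector_derivative_translate_minus:
  fixes f :: "real \<Rightarrow> 'a::real_normed_vector"
  assumes "(f has_vector_derivative f') (at (t - c) within T)" "(\<lambda>s. s - c) ` S \<subseteq> T"
  shows "((\<lambda>s. f (s - c)) has_vector_derivative f') (at t within S)"
  using has_vector_derivative_translate[of f f' t "- c" T S] assms by simp

lemma holomorphic_matrix_vector_component:
  fixes A :: "complex ^ 'n ^ 'm"
  assumes "\<And>j. (\<lambda>s. f s $ j) holomorphic_on S"
  shows "(\<lambda>s. (A *v f s) $ i) holomorphic_on S"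
  unfolding matrix_vector_mult_def vec_lambda_beta by (intro holomorphic_intros assms)

text \<open>On this half plane |s + 1| >= 1/2, hence 1 + |s| <= |s + 1| + 2 <= 5 |s + 1|. It
  supplies the 1/|s| decay of the transform of the subtracted exponential.\<close>

lemma cmod_inverse_succ_le:
  assumes "Re s \<ge> - (1 / 2)"
  shows "(1 + norm s) * norm (1 / (s + 1)) \<le> 5"
proof -
  have "1 / 2 \<le> norm (s + 1)" using complex_Re_le_cmod[of "s + 1"] assms by simp
  moreover have "norm s \<le> norm (s + 1) + 1" using norm_triangle_ineq4[of "s + 1" 1] by simp
  ultimately have "1 + norm s \<le> 5 * norm (s + 1)" by linarith
  moreover have "norm (s + 1) > 0" using \<open>1 / 2 \<le> norm (s + 1)\<close> by linarith
  ultimately show ?thesis by (simp add: norm_divide pos_divide_le_eq)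
qed

text \<open>Subtracting \<open>e\<^sup>-\<^sup>t Z(0)\<close> from the solution makes it vanish at \<open>0\<close>, so that its transform is
  \<open>O(|s|\<^sup>-\<^sup>2)\<close> and the inversion integral converges absolutely. The bounds on \<open>Z'\<close> over the
  history interval provide the factor \<open>1 / |s|\<close> for the right-hand side.\<close>

lemma delay_equation_decay:
  fixes M N :: "real ^ 'n ^ 'n"
  assumes r: "r \<ge> 0" and \<tau>: "\<tau> \<ge> 0"
    and roots: "\<And>s. det (char_mat M N r \<tau> s) = 0 \<Longrightarrow> Re s < 0"
  obtains Q \<sigma> where "Q > 0" "\<sigma> > 0"
    "\<And>Z Z' D C \<mu> t. \<lbrakk>\<mu> \<ge> 0;
       \<And>t. t \<ge> - max r \<tau> \<Longrightarrow> (Z has_vector_derivative Z' t) (at t within {- max r \<tau>..});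
       continuous_on {- max r \<tau>..} Z';
       \<And>t. t \<in> {- max r \<tau>..0} \<Longrightarrow> norm (Z t) \<le> D;
       \<And>t. t \<in> {- max r \<tau>..0} \<Longrightarrow> norm (Z' t) \<le> D;
       \<And>t. t \<ge> 0 \<Longrightarrow> norm (Z t) \<le> C * exp (\<mu> * t);
       \<And>t. t \<ge> 0 \<Longrightarrow> Z' t = M *v Z t + N *v (Z (t - \<tau>) - Z (t - r));
       t \<ge> 0\<rbrakk> \<Longrightarrow> norm (Z t) \<le> Q * D * exp (- \<sigma> * t)"
proof -
  obtain \<epsilon> c where \<epsilon>: "0 < \<epsilon>" "\<epsilon> \<le> 1 / 2" and c: "c > 0"
    and coer: "\<And>s v. Re s \<ge> - \<epsilon> \<Longrightarrow> norm (char_mat M N r \<tau> s *v v) \<ge> c * (1 + norm s) * norm v"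
    using char_mat_coercive[OF r \<tau> roots] by metis
  obtain m where m: "m \<ge> 0" "\<And>v. norm (cmat M *v v) \<le> norm v * m"
    using bounded_linear.nonneg_bounded[OF matrix_vector_mul_bounded_linear[of "cmat M"]] by blast
  obtain n where n: "n \<ge> 0" "\<And>v. norm (cmat N *v v) \<le> norm v * n"
    using bounded_linear.nonneg_bounded[OF matrix_vector_mul_bounded_linear[of "cmat N"]] by blast
  \<comment> \<open>The summands bound, in order, the terms of \<open>F\<close> below: the
    exponential under \<open>M\<close>, the exponential alone, its two delayed copies under
    \<open>N\<close>, and the two history segments.\<close>
  define KF where "KF = 5 * m + 5 + (exp \<tau> + exp r) * (5 * n) + ((2 + 2 * \<tau>) * exp \<tau> + (2 + 2 * r) * exp r) * n"
  have KF0: "KF \<ge> 0" using m n r \<tau> by (simp add: KF_def)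
  \<comment> \<open>The final 1 pays for exp(-t) Z(0), which is added back at the end.\<close>
  define Q where "Q = real CARD('n) * (KF / c / 2) + 1"
  have nonsing: "det (char_mat M N r \<tau> s) \<noteq> 0" if "Re s > - \<epsilon>" for s
  proof
    assume "det (char_mat M N r \<tau> s) = 0"
    then obtain v where v: "v \<noteq> 0" "char_mat M N r \<tau> s *v v = 0" using det_eq_0_ker by blast
    then have "c * (1 + norm s) * norm v \<le> 0" using coer[of s v] that by simp
    moreover have "c * (1 + norm s) * norm v > 0"
      using v(1) c by (intro mult_pos_pos) (auto intro: add_pos_nonneg)
    ultimately show False by simp
  qed
  show ?thesis
  proof (rule that[of Q "\<epsilon> / 2"])
    show "Q > 0" using KF0 c by (simp add: Q_def add_nonneg_pos)
    show "\<epsilon> / 2 > 0" using \<epsilon> by simp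
    fix Z Z' :: "real \<Rightarrow> real ^ 'n" and D C \<mu> t :: real
    define h where "h = max r \<tau>"
    assume \<mu>: "\<mu> \<ge> 0" and t: "t \<ge> 0"
      and "\<And>t. t \<ge> - max r \<tau> \<Longrightarrow> (Z has_vector_derivative Z' t) (at t within {- max r \<tau>..})"
      and "continuous_on {- max r \<tau>..} Z'"
      and "\<And>t. t \<in> {- max r \<tau>..0} \<Longrightarrow> norm (Z t) \<le> D"
      and "\<And>t. t \<in> {- max r \<tau>..0} \<Longrightarrow> norm (Z' t) \<le> D"
      and C: "\<And>t. t \<ge> 0 \<Longrightarrow> norm (Z t) \<le> C * exp (\<mu> * t)"
      and eqn: "\<And>t. t \<ge> 0 \<Longrightarrow> Z' t = M *v Z t + N *v (Z (t - \<tau>) - Z (t - r))"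
    then have Zd: "\<And>t. t \<ge> - h \<Longrightarrow> (Z has_vector_derivative Z' t) (at t within {- h..})"
      and Z'c: "continuous_on {- h..} Z'"
      and ZD: "\<And>t. - h \<le> t \<Longrightarrow> t \<le> 0 \<Longrightarrow> norm (Z t) \<le> D"
      and Z'D: "\<And>t. - h \<le> t \<Longrightarrow> t \<le> 0 \<Longrightarrow> norm (Z' t) \<le> D"
      by (simp_all add: h_def)
    have h: "h \<ge> 0" "r \<le> h" "\<tau> \<le> h" using r \<tau> by (auto simp: h_def)
    have D0: "D \<ge> 0" using order_trans[OF norm_ge_zero ZD[of 0]] h by simp
    have Zc: "continuous_on {- h..} Z" using Zd by (intro continuous_on_vector_derivative) auto
    \<comment> \<open>A delayed value Z(t - d) is split into three parts: \<open>y\<close> is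
      continuous and zero up to time 0, \<open>q\<close> is the subtracted exponential, and
      \<open>\<zeta> d\<close> is what still comes from the history. At t = d the value Z(0) is
      counted once, because the indicator in \<open>q\<close> is open at 0 while the one in
      \<open>\<zeta>\<close> is closed at \<open>d\<close>.\<close>
    define y where "y t = Z (max 0 t) - exp (- max 0 t) *\<^sub>R Z 0" for t
    define q where "q t = indicator {0<..} t *\<^sub>R (exp (- t) *\<^sub>R Z 0)" for t :: real
    define \<zeta> where "\<zeta> d t = indicator {0..d} t *\<^sub>R Z (t - d)" for d t :: real
    \<comment> \<open>The derivative of \<open>y\<close> for positive times, written only with
      functions that vanish for negative times, so that the transform rules apply termwise.\<close>
    define g where "g t = M *v (y t + q t) + N *v ((y (t - \<tau>) + q (t - \<tau>) + \<zeta> \<tau> t) - (y (t - r) + q (t - r) + \<zeta> r t)) + q t" for t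
    have split: "Z (t - d) = y (t - d) + q (t - d) + \<zeta> d t" if "t > 0" "d \<ge> 0" for t d
      using that by (cases "t > d") (auto simp: y_def q_def \<zeta>_def max_def)
    have split0: "Z t = y t + q t" if "t > 0" for t
      using that by (simp add: y_def q_def max_def)
    have g_eq: "g t = Z' t + exp (- t) *\<^sub>R Z 0" if "t > 0" for t
      unfolding g_def split[OF that \<tau>, symmetric] split[OF that r, symmetric] split0[OF that, symmetric]
      using eqn[of t] that by (simp add: q_def)
    have Zdc: "continuous_on {0..d} (\<lambda>t. Z (t - d))" if "0 \<le> d" "d \<le> h" for d
      by (rule continuous_on_compose2[OF Zc]) (use that in \<open>auto intro!: continuous_intros\<close>)
    have Z'dc: "continuous_on {0..d} (\<lambda>t. Z' (t - d))" if "0 \<le> d" "d \<le> h" for d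
      by (rule continuous_on_compose2[OF Z'c]) (use that in \<open>auto intro!: continuous_intros\<close>)
    have Zdd: "((\<lambda>t. Z (t - d)) has_vector_derivative Z' (t - d)) (at t within {0..d})"
      if "0 \<le> d" "d \<le> h" "t \<in> {0..d}" for d t
      by (rule has_vector_derivative_translate_minus[OF Zd]) (use that in auto)
    have yc: "continuous_on UNIV y"
      unfolding y_def by (intro continuous_intros continuous_on_compose2[OF Zc]) (use h in auto)
    have y0: "y t = 0" if "t \<le> 0" for t using that by (simp add: y_def)
    have y_order: "exp_order \<mu> y"
    proof -
      have "norm (y t) \<le> (C + D) * exp (\<mu> * t)" if t: "t \<ge> 0" for t
      proof -
        have "norm (y t) \<le> norm (Z t) + norm (exp (- t) *\<^sub>R Z 0)"
          unfolding y_def using t norm_triangle_ineq4[of "Z t" "exp (- t) *\<^sub>R Z 0"] by (simp add: max_def)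
        also have "norm (Z t) \<le> C * exp (\<mu> * t)" by (rule C[OF t])
        also have "norm (exp (- t) *\<^sub>R Z 0) \<le> 1 * D"
          unfolding norm_scaleR by (intro mult_mono ZD) (use t h in auto)
        also have "1 * D \<le> exp (\<mu> * t) * D" using t \<mu> D0 by (intro mult_right_mono) auto
        finally show ?thesis by (simp add: algebra_simps)
      qed
      then show ?thesis
        using borel_measurable_continuous_onI[OF yc] y0 by (auto simp: exp_order_def)
    qed
    have q_order: "exp_order \<mu> q" unfolding q_def by (rule exp_order_exp_minus[OF \<mu>])
    have \<zeta>_order: "exp_order \<mu> (\<zeta> d)" if "0 \<le> d" "d \<le> h" for d
      unfolding \<zeta>_def by (rule exp_order_segment[OF Zdc[OF that] \<mu>])
    note orders = exp_order_add exp_order_diff exp_order_mult exp_order_shift y_order q_order \<zeta>_order h r \<tau> \<mu>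
    have g_order: "exp_order \<mu> g" unfolding g_def by (intro orders)
    define a where "a s = 1 / (s + 1)" for s :: complex
    define J where "J d s = laplace (\<zeta> d) s" for d s
    define w where "w = cvec (Z 0)"
    define \<psi> where "\<psi> s = exp (- (s * complex_of_real \<tau>)) - exp (- (s * complex_of_real r))" for s
    define F where "F s = cmat M *v (a s *s w) + a s *s w + \<psi> s *s (cmat N *v (a s *s w)) + cmat N *v (J \<tau> s - J r s)" for s
    have lap_eq: "char_mat M N r \<tau> s *v laplace y s = F s" if s: "Re s > \<mu>" for s
    proof -
      have "laplace g s = s *s laplace y s - cvec 0"
      proof (rule laplace_derivative[OF y_order g_order s])
        fix t :: real assume t: "t > 0"
        have "((\<lambda>t. Z t - exp (- t) *\<^sub>R Z 0) has_vector_derivative Z' t - (- exp (- t)) *\<^sub>R Z 0) (at t)"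
        proof (rule has_vector_derivative_diff)
          have "(Z has_vector_derivative Z' t) (at t within {0<..})"
            by (rule has_vector_derivative_within_subset[OF Zd]) (use t h in auto)
          then show "(Z has_vector_derivative Z' t) (at t)"
            using t at_within_open[of t "{0<..}"] by simp
          have "((\<lambda>t. exp (- t)) has_real_derivative - exp (- t)) (at t)"
            by (auto intro!: derivative_eq_intros)
          from has_vector_derivative_scaleR[OF this has_vector_derivative_const[of "Z 0"]]
          show "((\<lambda>t. exp (- t) *\<^sub>R Z 0) has_vector_derivative (- exp (- t)) *\<^sub>R Z 0) (at t)" by simp
        qed
        then have "(y has_vector_derivative Z' t - (- exp (- t)) *\<^sub>R Z 0) (at t)"
          by (rule has_vector_derivative_transform_within_open[where S="{0<..}"]) (use t in \<open>auto simp: y_def max_def\<close>)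
        then show "(y has_vector_derivative g t) (at t)" by (simp add: g_eq[OF t])
      next
        have "continuous_on {0<..} (\<lambda>t. Z' t + exp (- t) *\<^sub>R Z 0)"
          by (intro continuous_intros continuous_on_subset[OF Z'c]) (use h in auto)
        then show "continuous_on {0<..} g" by (rule continuous_on_eq) (simp add: g_eq)
        have "isCont y 0" using yc by (simp add: continuous_on_eq_continuous_at)
        then show "(y \<longlongrightarrow> 0) (at_right 0)"
          using y0[of 0] by (auto simp: isCont_def intro: tendsto_mono[OF at_le])
      qed
      then have 1: "laplace g s = s *s laplace y s"
        using linear_0[OF bounded_linear.linear[OF bounded_linear_cvec]] by simp
      have q: "laplace q s = a s *s w"
        unfolding q_def a_def w_def by (rule laplace_exp_minus) (use s \<mu> in auto)
      \<comment> \<open>Comparing the transform of \<open>g\<close> as a derivative with its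
        transform term by term gives a linear system for the transform of \<open>y\<close>.\<close>
      have 2: "laplace g s = cmat M *v (laplace y s + laplace q s)
          + cmat N *v ((exp (- (s * complex_of_real \<tau>)) *s laplace y s + exp (- (s * complex_of_real \<tau>)) *s laplace q s + J \<tau> s)
             - (exp (- (s * complex_of_real r)) *s laplace y s + exp (- (s * complex_of_real r)) *s laplace q s + J r s))
          + laplace q s"
        unfolding g_def J_def
        by (subst laplace_add[where \<mu>=\<mu>] laplace_diff[where \<mu>=\<mu>] laplace_mult[where \<mu>=\<mu>] laplace_shift[where \<mu>=\<mu>], (intro orders | rule s)+)+ (rule refl)
      have "s *s laplace y s = cmat M *v laplace y s + \<psi> s *s (cmat N *v laplace y s) + F s"
        unfolding 1[symmetric] 2 q F_def \<psi>_def
        by (simp add: matrix_vector_right_distrib matrix_vector_mult_diff_distrib vector_scalar_commute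
            vec_eq_iff algebra_simps del: vector_smult_assoc)
      then show ?thesis
        unfolding char_mat_mult \<psi>_def by (simp add: vec_eq_iff mult.commute algebra_simps)
    qed
    have a_bound: "(1 + norm s) * norm (a s *s w) \<le> 5 * D" if "Re s \<ge> - \<epsilon>" for s
    proof -
      have "(1 + norm s) * norm (a s) * norm (Z 0) \<le> 5 * D"
        unfolding a_def using cmod_inverse_succ_le[of s] that \<epsilon> ZD[of 0] h by (intro mult_mono) auto
      then show ?thesis by (simp add: w_def mult.assoc)
    qed
    have J_bound: "(1 + norm s) * norm (J d s) \<le> (2 + 2 * d) * exp d * D"
      if "0 \<le> d" "d \<le> h" "Re s \<ge> - \<epsilon>" for d s
      unfolding J_def \<zeta>_def
      by (rule laplace_segment_bound[OF that(1) Zdd[OF that(1,2)] Z'dc[OF that(1,2)]])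
        (use that \<epsilon> in \<open>auto intro!: ZD Z'D\<close>)
    have F_bound: "(1 + norm s) * norm (F s) \<le> KF * D" if s: "Re s \<ge> - \<epsilon>" for s
    proof -
      have s1: "Re s \<ge> -1" using s \<epsilon> by simp
      let ?L = "1 + norm s"
      have L0: "?L \<ge> 0" by simp
      have \<psi>: "norm (\<psi> s) \<le> exp \<tau> + exp r"
        unfolding \<psi>_def
        using norm_exp_delay_le[OF s1 \<tau>] norm_exp_delay_le[OF s1 r]
        by (intro order_trans[OF norm_triangle_ineq4] add_mono)
          (simp_all only: mult_minus_left mult.commute[of s])
      have "norm (F s) \<le> norm (a s *s w) * m + norm (a s *s w) + (exp \<tau> + exp r) * (norm (a s *s w) * n)
          + (norm (J \<tau> s) + norm (J r s)) * n"
        unfolding F_def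
      proof (intro norm_triangle_mono order_refl m(2))
        show "norm (\<psi> s *s (cmat N *v (a s *s w))) \<le> (exp \<tau> + exp r) * (norm (a s *s w) * n)"
          unfolding norm_vector_scalar_mult[of "\<psi> s"] by (intro mult_mono \<psi> n(2)) auto
        show "norm (cmat N *v (J \<tau> s - J r s)) \<le> (norm (J \<tau> s) + norm (J r s)) * n"
          by (rule order_trans[OF n(2)]) (intro mult_right_mono norm_triangle_ineq4 n(1))
      qed
      then have "?L * norm (F s) \<le> ?L * (norm (a s *s w) * m + norm (a s *s w) + (exp \<tau> + exp r) * (norm (a s *s w) * n)
          + (norm (J \<tau> s) + norm (J r s)) * n)" by (rule mult_left_mono) simp
      also have "\<dots> = (?L * norm (a s *s w)) * m + ?L * norm (a s *s w) + (exp \<tau> + exp r) * ((?L * norm (a s *s w)) * n)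
          + (?L * norm (J \<tau> s) + ?L * norm (J r s)) * n" by (simp only: algebra_simps)
      also have "\<dots> \<le> (5 * D) * m + 5 * D + (exp \<tau> + exp r) * ((5 * D) * n)
          + ((2 + 2 * \<tau>) * exp \<tau> * D + (2 + 2 * r) * exp r * D) * n"
        by (intro add_mono mult_right_mono mult_left_mono a_bound J_bound s m n r \<tau> h) auto
      also have "\<dots> = KF * D" by (simp add: KF_def algebra_simps)
      finally show ?thesis .
    qed
    have F_hol: "(\<lambda>s. F s $ i) holomorphic_on {s. Re s > - \<epsilon>}" for i
    proof -
      have ahol: "a holomorphic_on {s. Re s > - \<epsilon>}"
        unfolding a_def
      proof (intro holomorphic_intros)
        fix s assume "s \<in> {s. Re s > - \<epsilon>}"
        then have "Re (s + 1) > 0" using \<epsilon> by simp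
        then show "s + 1 \<noteq> 0" by (metis less_irrefl zero_complex.sel(1))
      qed
      have J: "(\<lambda>s. J d s $ j) holomorphic_on {s. Re s > - \<epsilon>}" if "0 \<le> d" "d \<le> h" for d j
        unfolding J_def \<zeta>_def
        by (rule holomorphic_on_subset[OF holomorphic_laplace_segment[OF that(1) Zdc[OF that]]]) simp
      show ?thesis
        unfolding F_def \<psi>_def vector_add_component vector_smult_component
        by (intro holomorphic_intros holomorphic_matrix_vector_component)
          (auto simp: vector_minus_component intro!: holomorphic_intros ahol J h r \<tau>)
    qed
    obtain Y where Y: "\<And>s v. s \<in> {s. Re s > - \<epsilon>} \<Longrightarrow> char_mat M N r \<tau> s *v v = F s \<longleftrightarrow> v = Y s"
      and Y_hol: "\<And>i. (\<lambda>s. Y s $ i) holomorphic_on {s. Re s > - \<epsilon>}"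
      using char_mat_solution_holomorphic[of "{s. Re s > - \<epsilon>}" M N r \<tau> F, OF _ F_hol] nonsing by auto
    have "norm (y t) \<le> real CARD('n) * ((KF * D / c) / 2 * exp (- (\<epsilon> / 2) * t))"
    proof (rule inverse_laplace_decay[OF \<epsilon>(1) \<mu> y_order yc _ Y_hol _ t])
      show "laplace y s = Y s" if "Re s > \<mu>" for s
        using lap_eq[OF that] Y[of s "laplace y s"] that \<mu> \<epsilon> by simp
      show "norm (Y s) \<le> KF * D / c / (1 + (Im s)\<^sup>2)" if s: "Re s > - \<epsilon>" for s
      proof -
        have "char_mat M N r \<tau> s *v Y s = F s" using Y[of s "Y s"] s by simp
        then have 1: "c * (1 + norm s) * norm (Y s) \<le> norm (F s)" using coer[of s "Y s"] s by simp
        \<comment> \<open>One factor 1 + |s| is supplied by coercivity and the other by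
          \<open>F_bound\<close>; their product dominates 1 + (Im s)^2.\<close>
        have "1 + (Im s)\<^sup>2 \<le> (1 + norm s) * (1 + norm s)"
          using power_mono[OF abs_Im_le_cmod[of s], of 2] norm_ge_zero[of s]
          by (simp add: algebra_simps power2_eq_square del: norm_ge_zero)
        then have "(1 + (Im s)\<^sup>2) * (c * norm (Y s)) \<le> (1 + norm s) * (1 + norm s) * (c * norm (Y s))"
          using c by (intro mult_right_mono) auto
        also have "\<dots> = (1 + norm s) * (c * (1 + norm s) * norm (Y s))" by (simp only: mult_ac)
        also have "\<dots> \<le> (1 + norm s) * norm (F s)" by (intro mult_left_mono 1) simp
        also have "\<dots> \<le> KF * D" by (rule F_bound) (use s in simp)
        finally have "norm (Y s) * (c * (1 + (Im s)\<^sup>2)) \<le> KF * D" by (simp only: mult_ac)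
        moreover have "c * (1 + (Im s)\<^sup>2) > 0" using c by (intro mult_pos_pos) (auto intro: add_pos_nonneg)
        ultimately have "norm (Y s) \<le> KF * D / (c * (1 + (Im s)\<^sup>2))" by (simp only: pos_le_divide_eq)
        then show ?thesis by simp
      qed
    qed
    moreover have "norm (exp (- t) *\<^sub>R Z 0) \<le> exp (- (\<epsilon> / 2) * t) * D"
    proof -
      have "\<epsilon> / 2 * t \<le> 1 * t" using \<epsilon> t by (intro mult_right_mono) auto
      then show ?thesis unfolding norm_scaleR by (intro mult_mono ZD) (use h in auto)
    qed
    moreover have "norm (Z t) \<le> norm (y t) + norm (exp (- t) *\<^sub>R Z 0)"
      using norm_triangle_ineq[of "y t" "exp (- t) *\<^sub>R Z 0"] t by (simp add: y_def max_def)
    ultimately show "norm (Z t) \<le> Q * D * exp (- (\<epsilon> / 2) * t)"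
      by (simp add: Q_def algebra_simps)
  qed
qed

text \<open>The solution is restarted at time \<open>h\<close>. The forcing has vanished by then,
  and the equation itself shows that the piece on [0, h] has a continuous derivative, so it can
  serve as a history for \<open>delay_equation_decay\<close>. The growth lemma bounds that
  piece.\<close>

lemma delay_solution_decay:
  fixes M N :: "real ^ 'n ^ 'n"
  assumes r: "r \<ge> 0" and \<tau>: "\<tau> \<ge> 0"
    and roots: "\<And>s. det (char_mat M N r \<tau> s) = 0 \<Longrightarrow> Re s < 0"
  obtains Q \<sigma> where "Q > 0" "\<sigma> > 0"
    "\<And>p P z0 z t. \<lbrakk>continuous_on UNIV p; \<And>t. norm (p t) \<le> P; \<And>t. t \<ge> max r \<tau> \<Longrightarrow> p t = 0;
       delay_solution M N r \<tau> p z0 z; t \<ge> 0\<rbrakk> \<Longrightarrow> norm (z t) \<le> Q * (norm z0 + P) * exp (- \<sigma> * t)"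
proof -
  obtain m where m: "m \<ge> 0" "\<And>v. norm (M *v v) \<le> norm v * m"
    using bounded_linear.nonneg_bounded[OF matrix_vector_mul_bounded_linear[of M]] by blast
  obtain n where n: "n \<ge> 0" "\<And>v. norm (N *v v) \<le> norm v * n"
    using bounded_linear.nonneg_bounded[OF matrix_vector_mul_bounded_linear[of N]] by blast
  define \<kappa> where "\<kappa> = m + n"
  have \<kappa>: "\<kappa> \<ge> 0" "norm (M *v v) \<le> \<kappa> * norm v" "norm (N *v v) \<le> \<kappa> * norm v" for v
    using m(1) n(1) order_trans[OF m(2)[of v], of "\<kappa> * norm v"] order_trans[OF n(2)[of v], of "\<kappa> * norm v"]
    by (auto simp: \<kappa>_def algebra_simps)
  define \<mu> where "\<mu> = 6 * \<kappa> + 1"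
  have \<mu>: "\<mu> \<ge> 0" using \<kappa>(1) by (simp add: \<mu>_def)
  define h where "h = max r \<tau>"
  have h: "h \<ge> 0" "r \<le> h" "\<tau> \<le> h" using r \<tau> by (auto simp: h_def)
  show ?thesis
  proof (rule delay_equation_decay[of r \<tau> M N, OF r \<tau> roots, folded h_def])
    fix Q0 \<sigma> :: real
    assume Q0: "Q0 > 0" and \<sigma>: "\<sigma> > 0"
      and decay: "\<And>Z Z' D C \<mu> t. \<lbrakk>\<mu> \<ge> 0;
         \<And>t. t \<ge> - h \<Longrightarrow> (Z has_vector_derivative Z' t) (at t within {- h..});
         continuous_on {- h..} Z';
         \<And>t. t \<in> {- h..0} \<Longrightarrow> norm (Z t) \<le> D;
         \<And>t. t \<in> {- h..0} \<Longrightarrow> norm (Z' t) \<le> D;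
         \<And>t. t \<ge> 0 \<Longrightarrow> norm (Z t) \<le> C * exp (\<mu> * t);
         \<And>t. t \<ge> 0 \<Longrightarrow> Z' t = M *v Z t + N *v (Z (t - \<tau>) - Z (t - r));
         t \<ge> 0\<rbrakk> \<Longrightarrow> norm (Z t) \<le> Q0 * D * exp (- \<sigma> * t)"
    \<comment> \<open>The factor 2 exp(\<mu> h) bounds \<open>z\<close> up to time \<open>h\<close>
      relative to the data; 3 \<kappa> + 1 covers its derivative, the 1 being for the
      forcing.\<close>
    define d where "d = (3 * \<kappa> + 1) * (2 * exp (\<mu> * h))"
    have d: "d > 0" using \<kappa>(1) unfolding d_def by (intro mult_pos_pos) auto
    \<comment> \<open>exp(\<sigma> h) compensates the restart at \<open>h\<close>, and the extra 1
      makes the constant large enough for times before \<open>h\<close>, where only the bound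
      \<open>D\<close> is available.\<close>
    define Q where "Q = (Q0 + 1) * d * exp (\<sigma> * h)"
    show ?thesis
    proof (rule that[of Q \<sigma>])
      show "Q > 0" using Q0 d unfolding Q_def by (intro mult_pos_pos) auto
      fix p P z0 z and t :: real
      assume pc: "continuous_on UNIV p" and pP: "\<And>t. norm (p t) \<le> P" and p0: "\<And>t. t \<ge> max r \<tau> \<Longrightarrow> p t = 0"
        and sol: "delay_solution M N r \<tau> p z0 z" and t: "t \<ge> 0"
      have P0: "P \<ge> 0" using order_trans[OF norm_ge_zero pP[of 0]] .
      define D where "D = d * (norm z0 + P)"
      have D0: "D \<ge> 0" using d P0 by (simp add: D_def)
      have growth: "norm (z s) \<le> 2 * (norm z0 + P) * exp (\<mu> * s)" if "s \<ge> 0" for s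
        unfolding \<mu>_def by (rule delay_solution_growth[OF r \<tau> \<kappa> pc pP sol that])
      have zneg: "z s = z0" if "s \<le> 0" for s using sol that by (simp add: delay_solution_def)
      have small: "norm (z s) \<le> 2 * (norm z0 + P) * exp (\<mu> * h)" if "s \<le> h" for s
      proof (cases "s \<ge> 0")
        case True
        have "norm (z s) \<le> 2 * (norm z0 + P) * exp (\<mu> * s)" by (rule growth[OF True])
        also have "\<dots> \<le> 2 * (norm z0 + P) * exp (\<mu> * h)"
          using that \<mu> P0 by (intro mult_left_mono) (auto intro: mult_left_mono)
        finally show ?thesis .
      next
        case False
        then have "norm (z s) \<le> 2 * (norm z0 + P) * 1" using zneg[of s] P0 by simp
        also have "\<dots> \<le> 2 * (norm z0 + P) * exp (\<mu> * h)" using \<mu> h P0 by (intro mult_left_mono) auto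
        finally show ?thesis .
      qed
      have smallD: "norm (z s) \<le> D" if "s \<le> h" for s
      proof (rule order_trans[OF small[OF that]])
        have "1 * (2 * (norm z0 + P) * exp (\<mu> * h)) \<le> (3 * \<kappa> + 1) * (2 * (norm z0 + P) * exp (\<mu> * h))"
          using \<kappa>(1) P0 by (intro mult_right_mono) auto
        then show "2 * (norm z0 + P) * exp (\<mu> * h) \<le> D" by (simp add: D_def d_def algebra_simps)
      qed
      have late: "norm (z (s + h)) \<le> Q0 * D * exp (- \<sigma> * s)" if s: "s \<ge> 0" for s
      proof (rule decay[where Z="\<lambda>s. z (s + h)" and Z'="\<lambda>s. delay_rhs M N r \<tau> p z (s + h)"
            and C="2 * (norm z0 + P) * exp (\<mu> * h)", OF \<mu> _ _ _ _ _ _ s])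
        fix s assume s: "s \<ge> - h"
        show "((\<lambda>s. z (s + h)) has_vector_derivative delay_rhs M N r \<tau> p z (s + h)) (at s within {- h..})"
          by (rule has_vector_derivative_translate[where T="{0..}"]) (use sol s in \<open>auto simp: delay_solution_def\<close>)
      next
        have "continuous_on UNIV (delay_rhs M N r \<tau> p z)"
          using sol by (intro continuous_on_delay_rhs pc) (auto simp: delay_solution_def)
        then show "continuous_on {- h..} (\<lambda>s. delay_rhs M N r \<tau> p z (s + h))"
          by (rule continuous_on_compose2) (auto intro!: continuous_intros)
      next
        fix s assume s: "s \<in> {- h..0}"
        show "norm (z (s + h)) \<le> D" using s by (intro smallD) simp
        have "norm (delay_rhs M N r \<tau> p z (s + h)) \<le> 3 * \<kappa> * (2 * (norm z0 + P) * exp (\<mu> * h)) + norm (p (s + h))"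
          by (intro norm_delay_rhs_le \<kappa> small) (use s r \<tau> in auto)
        also have "norm (p (s + h)) \<le> 2 * (norm z0 + P) * exp (\<mu> * h)"
        proof -
          have "norm (p (s + h)) \<le> 0 + P" using pP[of "s + h"] by simp
          also have "\<dots> \<le> norm z0 + P" by (rule add_right_mono) simp
          also have "\<dots> = 1 * (norm z0 + P) * 1" by simp
          also have "\<dots> \<le> 2 * (norm z0 + P) * 1" using P0 by (intro mult_right_mono) auto
          also have "\<dots> \<le> 2 * (norm z0 + P) * exp (\<mu> * h)" using \<mu> h P0 by (intro mult_left_mono) auto
          finally show ?thesis .
        qed
        finally show "norm (delay_rhs M N r \<tau> p z (s + h)) \<le> D" by (simp add: D_def d_def algebra_simps)
      next
        fix s :: real assume s: "s \<ge> 0"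
        show "norm (z (s + h)) \<le> 2 * (norm z0 + P) * exp (\<mu> * h) * exp (\<mu> * s)"
          using growth[of "s + h"] s h by (simp add: algebra_simps exp_add)
        show "delay_rhs M N r \<tau> p z (s + h) = M *v z (s + h) + N *v (z (s - \<tau> + h) - z (s - r + h))"
          using p0[of "s + h"] s by (simp add: delay_rhs_def h_def algebra_simps)
      qed
      have "norm (z t) \<le> (Q0 + 1) * D * exp (\<sigma> * h) * exp (- \<sigma> * t)"
      proof (cases "t \<ge> h")
        case True
        have "norm (z t) \<le> Q0 * D * exp (- \<sigma> * (t - h))" using late[of "t - h"] True by simp
        also have "\<dots> \<le> (Q0 + 1) * D * exp (- \<sigma> * (t - h))" using D0 by (intro mult_right_mono) auto
        also have "\<dots> = (Q0 + 1) * D * exp (\<sigma> * h) * exp (- \<sigma> * t)"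
          by (simp add: mult.assoc mult_exp_exp algebra_simps)
        finally show ?thesis .
      next
        case False
        have "norm (z t) \<le> 1 * D * 1" using smallD False by simp
        also have "\<dots> \<le> (Q0 + 1) * D * exp (\<sigma> * (h - t))"
          using Q0 \<sigma> False D0 by (intro mult_mono) auto
        also have "\<dots> = (Q0 + 1) * D * exp (\<sigma> * h) * exp (- \<sigma> * t)"
          by (simp add: mult.assoc mult_exp_exp algebra_simps)
        finally show ?thesis .
      qed
      then show "norm (z t) \<le> Q * (norm z0 + P) * exp (- \<sigma> * t)" by (simp add: Q_def D_def mult_ac)
    qed (rule \<sigma>)
  qed
qed

section \<open>The closed loop\<close>

definition input_integral :: "real ^ 'n ^ 'n \<Rightarrow> real ^ 'm ^ 'n \<Rightarrow> real \<Rightarrow> (real \<Rightarrow> real ^ 'm) \<Rightarrow> real \<Rightarrow> real ^ 'n" where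
  "input_integral A B r u t = integral {t..t + r} (\<lambda>s. mat_exp ((t + r - s) *\<^sub>R A) *v (B *v u (s - r)))"

lemma continuous_on_mat_exp_input:
  fixes A :: "real ^ 'n ^ 'n" and B :: "real ^ 'm ^ 'n"
  assumes "continuous_on S f" "continuous_on S v"
  shows "continuous_on S (\<lambda>t. mat_exp (f t *\<^sub>R A) *v (B *v v t))"
  by (intro bounded_bilinear.continuous_on[OF bounded_bilinear_matrix_vector_mult] continuous_mat_exp assms
      bounded_linear.continuous_on[OF matrix_vector_mul_bounded_linear])

text \<open>The group law factors the kernel as exp(tA) exp(-(s - r)A), so \<open>t\<close> leaves
  the integrand. What remains is a difference of one antiderivative at \<open>t\<close> and at
  \<open>t - r\<close>, which the product rule can differentiate.\<close>

lemma input_integral_eq: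
  fixes A :: "real ^ 'n ^ 'n" and B :: "real ^ 'm ^ 'n"
  assumes r: "r \<ge> 0" and u: "continuous_on {- r..} u" and t: "t \<ge> 0"
  defines "\<Phi> \<equiv> \<lambda>t. integral {- r..t} (\<lambda>w. mat_exp ((- w) *\<^sub>R A) *v (B *v u w))"
  shows "input_integral A B r u t = mat_exp (t *\<^sub>R A) *v (\<Phi> t - \<Phi> (t - r))"
proof -
  let ?f = "\<lambda>w. mat_exp ((- w) *\<^sub>R A) *v (B *v u w)"
  have fc: "continuous_on {- r..} ?f"
    by (intro continuous_on_mat_exp_input continuous_intros u)
  have fi: "?f integrable_on {a..b}" if "a \<ge> - r" for a b
    by (intro integrable_continuous_interval continuous_on_subset[OF fc]) (use that in auto)
  have "input_integral A B r u t = integral {t..t + r} (\<lambda>s. mat_exp (t *\<^sub>R A) *v ?f (s + - r))"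
    unfolding input_integral_def
  proof (rule integral_cong)
    fix s
    have "mat_exp ((t + r - s) *\<^sub>R A) = mat_exp (t *\<^sub>R A) ** mat_exp ((- (s + - r)) *\<^sub>R A)"
      by (subst mat_exp_add[symmetric]) (simp add: algebra_simps)
    then show "mat_exp ((t + r - s) *\<^sub>R A) *v (B *v u (s - r)) = mat_exp (t *\<^sub>R A) *v ?f (s + - r)"
      by (simp add: matrix_vector_mul_assoc matrix_mul_assoc)
  qed
  also have "\<dots> = mat_exp (t *\<^sub>R A) *v integral {t..t + r} (\<lambda>s. ?f (s + - r))"
  proof -
    have "continuous_on {t..t + r} (\<lambda>s. ?f (s + - r))"
      by (rule continuous_on_compose2[OF fc]) (use t in \<open>auto intro!: continuous_intros\<close>)
    then have "(\<lambda>s. ?f (s + - r)) integrable_on {t..t + r}" by (rule integrable_continuous_interval)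
    from integral_linear[OF this matrix_vector_mul_bounded_linear[of "mat_exp (t *\<^sub>R A)"]]
    show ?thesis by (simp add: o_def)
  qed
  also have "integral {t..t + r} (\<lambda>s. ?f (s + - r)) = integral {t + - r..t + r + - r} ?f"
  proof -
    have "integral {t..t + r} (?f \<circ> (\<lambda>s. s + - r)) = integral {t + - r..t + r + - r} ?f"
      by (intro integral_shift continuous_on_subset[OF fc]) (use t in auto)
    then show ?thesis by (simp only: o_def)
  qed
  also have "\<dots> = \<Phi> t - \<Phi> (t - r)"
  proof -
    have "integral {- r..t - r} ?f + integral {t - r..t} ?f = integral {- r..t} ?f"
      by (rule Henstock_Kurzweil_Integration.integral_combine[OF _ _ fi]) (use r t in auto)
    then show ?thesis by (simp add: \<Phi>_def algebra_simps)
  qed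
  finally show ?thesis .
qed

lemma input_integral_has_vector_derivative:
  fixes A :: "real ^ 'n ^ 'n" and B :: "real ^ 'm ^ 'n"
  assumes r: "r \<ge> 0" and u: "continuous_on {- r..} u" and t: "t \<ge> 0"
  shows "(input_integral A B r u has_vector_derivative
    A *v input_integral A B r u t + B *v u t - mat_exp (r *\<^sub>R A) *v (B *v u (t - r))) (at t within {0..})"
proof -
  define \<Phi> where "\<Phi> t = integral {- r..t} (\<lambda>w. mat_exp ((- w) *\<^sub>R A) *v (B *v u w))" for t
  have iq: "input_integral A B r u t = mat_exp (t *\<^sub>R A) *v (\<Phi> t - \<Phi> (t - r))" if "t \<ge> 0" for t
    unfolding \<Phi>_def by (rule input_integral_eq[OF r u that])
  let ?f = "\<lambda>w. mat_exp ((- w) *\<^sub>R A) *v (B *v u w)"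
  have fc: "continuous_on {- r..} ?f"
    by (intro continuous_on_mat_exp_input continuous_intros u)
  have \<Phi>d: "(\<Phi> has_vector_derivative ?f t) (at t within {- r..})" if "t \<ge> - r" for t
    unfolding \<Phi>_def[abs_def] by (rule integral_has_vector_derivative_atLeast[OF fc that])
  have d1: "(\<Phi> has_vector_derivative ?f t) (at t within {0..})"
    by (rule has_vector_derivative_within_subset[OF \<Phi>d]) (use r t in auto)
  have d2: "((\<lambda>t. \<Phi> (t - r)) has_vector_derivative ?f (t - r)) (at t within {0..})"
    by (rule has_vector_derivative_translate_minus[OF \<Phi>d]) (use r t in auto)
  have "((\<lambda>t. mat_exp (t *\<^sub>R A) *v (\<Phi> t - \<Phi> (t - r))) has_vector_derivative
      mat_exp (t *\<^sub>R A) *v (?f t - ?f (t - r)) + (A ** mat_exp (t *\<^sub>R A)) *v (\<Phi> t - \<Phi> (t - r))) (at t within {0..})"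
    by (intro bounded_bilinear.has_vector_derivative[OF bounded_bilinear_matrix_vector_mult]
        has_vector_derivative_diff mat_exp_has_vector_derivative d1 d2)
  moreover have "mat_exp (t *\<^sub>R A) *v ?f t = B *v u t"
    by (simp add: matrix_vector_mul_assoc matrix_mul_assoc)
  moreover have "mat_exp (t *\<^sub>R A) *v ?f (t - r) = mat_exp (r *\<^sub>R A) *v (B *v u (t - r))"
  proof -
    have "mat_exp (t *\<^sub>R A) ** mat_exp ((- (t - r)) *\<^sub>R A) = mat_exp (r *\<^sub>R A)"
      by (subst mat_exp_add[symmetric]) simp
    then show ?thesis by (simp only: matrix_vector_mul_assoc matrix_mul_assoc)
  qed
  ultimately have "((\<lambda>t. mat_exp (t *\<^sub>R A) *v (\<Phi> t - \<Phi> (t - r))) has_vector_derivative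
      A *v input_integral A B r u t + B *v u t - mat_exp (r *\<^sub>R A) *v (B *v u (t - r))) (at t within {0..})"
    unfolding iq[OF t]
    by (simp add: matrix_vector_mult_diff_distrib matrix_vector_mul_assoc[symmetric] algebra_simps)
  then show ?thesis
    by (rule has_vector_derivative_transform[rotated 2])
      (use t in \<open>auto simp: iq\<close>)
qed

text \<open>The predictor at time 0 in terms of the data alone; the compatibility condition says
  that \<open>u0 0\<close> is \<open>k\<close> applied to it.\<close>

definition initial_predictor :: "real ^ 'n ^ 'n \<Rightarrow> real ^ 'm ^ 'n \<Rightarrow> real \<Rightarrow> real ^ 'n \<Rightarrow> (real \<Rightarrow> real ^ 'm) \<Rightarrow> real ^ 'n" where
  "initial_predictor A B r x0 u0 = mat_exp (r *\<^sub>R A) *v x0 + integral {- r..0} (\<lambda>s. mat_exp ((- s) *\<^sub>R A) *v (B *v u0 s))"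

text \<open>With the predictor \<open>z\<close> continued by the constant \<open>z0\<close> to negative times, \<open>u = k z + c\<close> holds on
  the whole history interval, where the offset \<open>c\<close> below vanishes for \<open>t \<ge> 0\<close> by the compatibility
  condition.\<close>

definition input_offset :: "real ^ 'n ^ 'm \<Rightarrow> real \<Rightarrow> real ^ 'n \<Rightarrow> (real \<Rightarrow> real ^ 'm) \<Rightarrow> real \<Rightarrow> real ^ 'm" where
  "input_offset k h z0 u0 t = u0 (max (- h) (min 0 t)) - k *v z0"

text \<open>Putting u = k z + c into the delayed input terms leaves this remainder beside the delay
  terms in \<open>z\<close>. If the offset vanishes for nonnegative times, the remainder vanishes
  from time \<open>max r \<tau>\<close> on.\<close>

definition delay_forcing ::
  "real ^ 'n ^ 'n \<Rightarrow> real ^ 'm ^ 'n \<Rightarrow> real \<Rightarrow> real \<Rightarrow> (real \<Rightarrow> real ^ 'm) \<Rightarrow> real \<Rightarrow> real ^ 'n" where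
  "delay_forcing A B r \<tau> c t = mat_exp (r *\<^sub>R A) *v (B *v (c (t - \<tau>) - c (t - r)))"

lemma continuous_on_input_offset:
  assumes "continuous_on {- h..0} u0" "h \<ge> 0"
  shows "continuous_on UNIV (input_offset k h z0 u0)"
  unfolding input_offset_def
  by (intro continuous_intros continuous_on_compose2[OF assms(1)]) (use assms(2) in auto)

lemma continuous_on_delay_forcing:
  assumes "continuous_on UNIV c"
  shows "continuous_on UNIV (delay_forcing A B r \<tau> c)"
proof -
  have "continuous_on UNIV (\<lambda>t. c (t - d))" for d
    by (rule continuous_on_compose2[OF assms]) (auto intro!: continuous_intros)
  then show ?thesis
    unfolding delay_forcing_def
    by (intro continuous_intros bounded_linear.continuous_on[OF matrix_vector_mul_bounded_linear])
qed

lemma delay_rhs_feedback: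
  fixes A :: "real ^ 'n ^ 'n" and B :: "real ^ 'm ^ 'n" and k :: "real ^ 'n ^ 'm"
  shows "delay_rhs (A + B ** k) (mat_exp (r *\<^sub>R A) ** B ** k) r \<tau> (delay_forcing A B r \<tau> c) z t
    = A *v z t + B *v (k *v z t)
      + mat_exp (r *\<^sub>R A) *v (B *v ((k *v z (t - \<tau>) + c (t - \<tau>)) - (k *v z (t - r) + c (t - r))))"
  by (simp add: delay_rhs_def delay_forcing_def matrix_vector_mult_add_rdistrib matrix_vector_right_distrib
      matrix_vector_mult_diff_distrib matrix_vector_mul_assoc[symmetric] algebra_simps)

section \<open>From the closed loop to the delay equation and back\<close>

lemma input_integral_0:
  fixes A :: "real ^ 'n ^ 'n" and B :: "real ^ 'm ^ 'n"
  assumes r: "r \<ge> 0" and u: "continuous_on {- r..} u" and eq: "\<And>t. t \<in> {- r..0} \<Longrightarrow> u t = u0 t"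
  shows "input_integral A B r u 0 = integral {- r..0} (\<lambda>s. mat_exp ((- s) *\<^sub>R A) *v (B *v u0 s))"
proof -
  have "input_integral A B r u 0 = integral {- r..0} (\<lambda>s. mat_exp ((- s) *\<^sub>R A) *v (B *v u s))"
    by (subst input_integral_eq[OF r u order_refl]) simp
  also have "\<dots> = integral {- r..0} (\<lambda>s. mat_exp ((- s) *\<^sub>R A) *v (B *v u0 s))"
    by (rule integral_cong) (simp only: eq)
  finally show ?thesis .
qed

lemma admissible_initial_input:
  "admissible_initial_data A B k r \<tau> x0 u0 \<Longrightarrow> u0 0 = k *v initial_predictor A B r x0 u0"
  by (simp add: admissible_initial_data_def initial_predictor_def matrix_vector_right_distrib)

lemma closed_loop_input_eq:
  fixes A :: "real ^ 'n ^ 'n" and B :: "real ^ 'm ^ 'n" and k :: "real ^ 'n ^ 'm"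
  assumes "closed_loop_solution A B k r \<tau> x0 u0 x u" "t \<ge> 0"
  shows "u t = k *v (mat_exp (r *\<^sub>R A) *v x t + input_integral A B r u t)"
  using assms by (simp add: closed_loop_solution_def input_integral_def matrix_vector_right_distrib)

text \<open>The derivative of exp(rA) x contributes the input at \<open>t - \<tau>\<close>, and the
  lower limit of the integral contributes the input at \<open>t - r\<close> with the opposite sign.
  The mismatch of the two delays is what remains beside (A + B k) z; for \<open>r = \<tau>\<close>
  it disappears.\<close>

lemma closed_loop_delay_solution:
  fixes A :: "real ^ 'n ^ 'n" and B :: "real ^ 'm ^ 'n" and k :: "real ^ 'n ^ 'm"
  assumes r: "r \<ge> 0" and \<tau>: "\<tau> \<ge> 0"
    and adm: "admissible_initial_data A B k r \<tau> x0 u0"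
    and sol: "closed_loop_solution A B k r \<tau> x0 u0 x u"
  defines "z0 \<equiv> initial_predictor A B r x0 u0"
  shows "delay_solution (A + B ** k) (mat_exp (r *\<^sub>R A) ** B ** k) r \<tau>
    (delay_forcing A B r \<tau> (input_offset k (max r \<tau>) z0 u0)) z0
    (\<lambda>t. mat_exp (r *\<^sub>R A) *v x (max 0 t) + input_integral A B r u (max 0 t))"
proof -
  define h where "h = max r \<tau>"
  have h: "h \<ge> 0" "r \<le> h" "\<tau> \<le> h" using r \<tau> by (auto simp: h_def)
  define z where "z t = mat_exp (r *\<^sub>R A) *v x t + input_integral A B r u t" for t
  let ?c = "input_offset k h z0 u0"
  have x0: "x 0 = x0" and uu0: "\<And>t. t \<in> {- h..0} \<Longrightarrow> u t = u0 t" and uc: "continuous_on {- h..} u"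
    and xd: "\<And>t. t \<ge> 0 \<Longrightarrow> (x has_vector_derivative (A *v x t + B *v u (t - \<tau>))) (at t within {0..})"
    using sol by (auto simp: closed_loop_solution_def h_def)
  have uc': "continuous_on {- r..} u" by (rule continuous_on_subset[OF uc]) (use h in auto)
  have uz: "u t = k *v z t" if "t \<ge> 0" for t
    unfolding z_def by (rule closed_loop_input_eq[OF sol that])
  have z0: "z 0 = z0"
    unfolding z_def z0_def initial_predictor_def x0
    by (subst input_integral_0[OF r uc']) (use uu0 h in auto)
  have u_eq: "u t = k *v z (max 0 t) + ?c t" if "t \<ge> - h" for t
  proof (cases "t \<ge> 0")
    case True
    then show ?thesis
      using uz[OF True] admissible_initial_input[OF adm] h by (simp add: input_offset_def max_def z0_def)
  next
    case False
    then show ?thesis using uu0[of t] that z0 by (simp add: input_offset_def)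
  qed
  have zd: "(z has_vector_derivative A *v z t + B *v u t + mat_exp (r *\<^sub>R A) *v (B *v (u (t - \<tau>) - u (t - r)))) (at t within {0..})"
    if t: "t \<ge> 0" for t
  proof -
    have "(z has_vector_derivative mat_exp (r *\<^sub>R A) *v (A *v x t + B *v u (t - \<tau>))
        + (A *v input_integral A B r u t + B *v u t - mat_exp (r *\<^sub>R A) *v (B *v u (t - r)))) (at t within {0..})"
      unfolding z_def
      by (intro has_vector_derivative_add input_integral_has_vector_derivative[OF r uc' t]
          bounded_linear.has_vector_derivative[OF matrix_vector_mul_bounded_linear] xd t)
    moreover have "mat_exp (r *\<^sub>R A) *v (A *v x t) = A *v (mat_exp (r *\<^sub>R A) *v x t)"
      by (simp only: matrix_vector_mul_assoc mat_exp_commute)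
    ultimately show ?thesis
      by (simp add: z_def matrix_vector_right_distrib matrix_vector_mult_diff_distrib algebra_simps)
  qed
  have zc: "continuous_on {0..} z" using zd by (intro continuous_on_vector_derivative) auto
  have "delay_solution (A + B ** k) (mat_exp (r *\<^sub>R A) ** B ** k) r \<tau> (delay_forcing A B r \<tau> ?c) z0 (\<lambda>t. z (max 0 t))"
    unfolding delay_solution_def
  proof (intro conjI allI impI)
    show "continuous_on UNIV (\<lambda>t. z (max 0 t))"
      by (rule continuous_on_compose2[OF zc]) (auto intro!: continuous_intros)
    show "z (max 0 t) = z0" if "t \<le> 0" for t using that z0 by (simp add: max_def)
    fix t :: real assume t: "t \<ge> 0"
    have "delay_rhs (A + B ** k) (mat_exp (r *\<^sub>R A) ** B ** k) r \<tau> (delay_forcing A B r \<tau> ?c) (\<lambda>t. z (max 0 t)) t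
        = A *v z t + B *v u t + mat_exp (r *\<^sub>R A) *v (B *v (u (t - \<tau>) - u (t - r)))"
      unfolding delay_rhs_feedback
      using u_eq[of "t - \<tau>"] u_eq[of "t - r"] uz[OF t] t h by simp
    then show "((\<lambda>t. z (max 0 t)) has_vector_derivative
        delay_rhs (A + B ** k) (mat_exp (r *\<^sub>R A) ** B ** k) r \<tau> (delay_forcing A B r \<tau> ?c) (\<lambda>t. z (max 0 t)) t) (at t within {0..})"
      using has_vector_derivative_transform[OF _ _ zd[OF t], of "\<lambda>t. z (max 0 t)"] t by simp
  qed
  then show ?thesis by (simp only: z_def h_def)
qed

text \<open>Once \<open>z\<close> solves the delay equation, u = k z + c is explicit, and
  \<open>x\<close> is recovered by multiplying \<open>z\<close> minus the input integral by
  exp(-rA). Thus the implicit feedback law never has to be solved for \<open>u\<close>.\<close>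

lemma closed_loop_exists:
  fixes A :: "real ^ 'n ^ 'n" and B :: "real ^ 'm ^ 'n" and k :: "real ^ 'n ^ 'm"
  assumes r: "r \<ge> 0" and \<tau>: "\<tau> \<ge> 0"
    and adm: "admissible_initial_data A B k r \<tau> x0 u0"
  obtains x u where "closed_loop_solution A B k r \<tau> x0 u0 x u"
proof -
  define h where "h = max r \<tau>"
  have h: "h \<ge> 0" "r \<le> h" "\<tau> \<le> h" using r \<tau> by (auto simp: h_def)
  have u0c: "continuous_on {- h..0} u0" using adm by (simp add: admissible_initial_data_def h_def)
  define z0 where "z0 = initial_predictor A B r x0 u0"
  define c where "c = input_offset k h z0 u0"
  define p where "p = delay_forcing A B r \<tau> c"
  have cc: "continuous_on UNIV c" unfolding c_def by (rule continuous_on_input_offset[OF u0c h(1)])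
  have pc: "continuous_on UNIV p" unfolding p_def by (rule continuous_on_delay_forcing[OF cc])
  have c0: "c t = 0" if "t \<ge> 0" for t
    using that admissible_initial_input[OF adm] h by (simp add: c_def input_offset_def z0_def max_def)
  have c1: "c t = u0 t - k *v z0" if "- h \<le> t" "t \<le> 0" for t
    using that by (simp add: c_def input_offset_def)
  obtain b where b: "\<And>t. t \<in> {- h..h} \<Longrightarrow> norm (p t) \<le> b"
  proof -
    have "bounded (p ` {- h..h})"
      by (intro compact_imp_bounded compact_continuous_image continuous_on_subset[OF pc]) auto
    then show ?thesis using that unfolding bounded_iff by blast
  qed
  \<comment> \<open>The offset is clamped outside the history, so the forcing is constant beyond
    either end of [-h, h], and its bound on that interval holds globally.\<close>
  have p_const: "p t = p (max (- h) (min h t))" for t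
  proof -
    have "c (t - d) = c (max (- h) (min h t) - d)" if "0 \<le> d" "d \<le> h" for d
    proof -
      consider "t \<ge> h" | "- h \<le> t" "t \<le> h" | "t \<le> - h" by linarith
      then show ?thesis
      proof cases
        case 1
        then show ?thesis using that h by (simp add: c0)
      next
        case 3
        then have "max (- h) (min 0 (t - d)) = - h" "max (- h) (min h t) = - h" "max (- h) (min 0 (- h - d)) = - h"
          using that h by linarith+
        then show ?thesis by (simp only: c_def input_offset_def)
      qed (use h in auto)
    qed
    then show ?thesis using h r \<tau> unfolding p_def delay_forcing_def by metis
  qed
  have pb: "norm (p t) \<le> b" for t
    by (subst p_const) (rule b, use h in auto)
  obtain z where z: "delay_solution (A + B ** k) (mat_exp (r *\<^sub>R A) ** B ** k) r \<tau> p z0 z"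
    using delay_solution_exists[OF r \<tau> pc pb] by blast
  have zc: "continuous_on UNIV z" and zneg: "\<And>t. t \<le> 0 \<Longrightarrow> z t = z0"
    and zd: "\<And>t. t \<ge> 0 \<Longrightarrow> (z has_vector_derivative
        delay_rhs (A + B ** k) (mat_exp (r *\<^sub>R A) ** B ** k) r \<tau> p z t) (at t within {0..})"
    using z by (auto simp: delay_solution_def)
  define u where "u t = k *v z t + c t" for t
  have uc: "continuous_on UNIV u"
    unfolding u_def by (intro continuous_intros bounded_linear.continuous_on[OF matrix_vector_mul_bounded_linear] zc cc)
  then have uc': "continuous_on {- r..} u" by (rule continuous_on_subset) simp
  have uu0: "u t = u0 t" if "- h \<le> t" "t \<le> 0" for t
    using that by (simp add: u_def zneg c1)
  define q where "q = input_integral A B r u"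
  define x where "x t = mat_exp (- (r *\<^sub>R A)) *v (z t - q t)" for t
  have Ex: "mat_exp (r *\<^sub>R A) *v x t = z t - q t" for t
    by (simp add: x_def matrix_vector_mul_assoc)
  have "closed_loop_solution A B k r \<tau> x0 u0 x u"
    unfolding closed_loop_solution_def
  proof (intro conjI ballI allI impI)
    have "q 0 = integral {- r..0} (\<lambda>s. mat_exp ((- s) *\<^sub>R A) *v (B *v u0 s))"
      unfolding q_def by (rule input_integral_0[OF r uc']) (use uu0 h in auto)
    then have "z 0 - q 0 = mat_exp (r *\<^sub>R A) *v x0"
      by (simp add: zneg z0_def initial_predictor_def)
    then show "x 0 = x0" by (simp add: x_def matrix_vector_mul_assoc)
    show "u t = u0 t" if "t \<in> {- max r \<tau>..0}" for t
      using that uu0[of t] by (simp add: h_def)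
    show "continuous_on {- max r \<tau>..} u" by (rule continuous_on_subset[OF uc]) simp
    fix t :: real assume t: "t \<ge> 0"
    have ut: "u t = k *v z t" using c0[OF t] by (simp add: u_def)
    \<comment> \<open>The present input and the input delayed by \<open>r\<close> occur in both
      derivatives and cancel, leaving only the input delayed by \<open>\<tau>\<close>.\<close>
    have "((\<lambda>t. z t - q t) has_vector_derivative
       (A *v z t + B *v u t + mat_exp (r *\<^sub>R A) *v (B *v (u (t - \<tau>) - u (t - r))))
       - (A *v q t + B *v u t - mat_exp (r *\<^sub>R A) *v (B *v u (t - r)))) (at t within {0..})"
      using zd[OF t] unfolding q_def ut[symmetric] p_def delay_rhs_feedback u_def[symmetric]
      by (intro has_vector_derivative_diff input_integral_has_vector_derivative[OF r uc' t])
    then have "((\<lambda>t. z t - q t) has_vector_derivative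
       A *v (z t - q t) + mat_exp (r *\<^sub>R A) *v (B *v u (t - \<tau>))) (at t within {0..})"
      by (simp add: matrix_vector_mult_diff_distrib algebra_simps)
    then have "(x has_vector_derivative
       mat_exp (- (r *\<^sub>R A)) *v (A *v (z t - q t) + mat_exp (r *\<^sub>R A) *v (B *v u (t - \<tau>)))) (at t within {0..})"
      unfolding x_def by (rule bounded_linear.has_vector_derivative[OF matrix_vector_mul_bounded_linear])
    moreover have "mat_exp (- (r *\<^sub>R A)) *v (A *v (z t - q t)) = A *v x t"
      using mat_exp_commute[of "- r" A] by (simp add: x_def matrix_vector_mul_assoc)
    ultimately show "(x has_vector_derivative A *v x t + B *v u (t - \<tau>)) (at t within {0..})"
      by (simp add: matrix_vector_right_distrib matrix_vector_mul_assoc matrix_mul_assoc)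
    have "u t = k *v (mat_exp (r *\<^sub>R A) *v x t + q t)" by (simp add: Ex ut)
    then show "u t = k *v (mat_exp (r *\<^sub>R A) *v x t)
        + k *v integral {t..t + r} (\<lambda>s. mat_exp ((t + r - s) *\<^sub>R A) *v (B *v u (s - r)))"
      by (simp add: q_def input_integral_def matrix_vector_right_distrib)
  qed
  then show ?thesis by (rule that)
qed

section \<open>Exponential bounds for the input and the state\<close>

lemma mat_exp_bounded_on_interval:
  fixes A :: "real ^ 'n ^ 'n"
  obtains L where "L \<ge> 0" "\<And>t v. \<bar>t\<bar> \<le> r \<Longrightarrow> norm (mat_exp (t *\<^sub>R A) *v v) \<le> L * norm v"
proof -
  obtain K where K: "K > 0" "\<And>(X :: real ^ 'n ^ 'n) v. norm (X *v v) \<le> norm X * norm v * K"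
    using bounded_bilinear.pos_bounded[OF bounded_bilinear_matrix_vector_mult[where 'a=real]] by metis
  have "bounded ((\<lambda>t. mat_exp (t *\<^sub>R A)) ` {- r..r})"
    by (intro compact_imp_bounded compact_continuous_image continuous_mat_exp continuous_on_id) simp
  then obtain b where b: "\<And>t. t \<in> {- r..r} \<Longrightarrow> norm (mat_exp (t *\<^sub>R A)) \<le> b"
    unfolding bounded_iff by blast
  show ?thesis
  proof (rule that[of "\<bar>b\<bar> * K"])
    show "\<bar>b\<bar> * K \<ge> 0" using K by simp
    fix t :: real and v :: "real ^ 'n" assume "\<bar>t\<bar> \<le> r"
    then have "norm (mat_exp (t *\<^sub>R A)) \<le> \<bar>b\<bar>"
      by (intro order_trans[OF b abs_ge_self]) (simp add: abs_le_iff)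
    then have "norm (mat_exp (t *\<^sub>R A)) * norm v * K \<le> \<bar>b\<bar> * norm v * K"
      using K by (intro mult_right_mono) auto
    then show "norm (mat_exp (t *\<^sub>R A) *v v) \<le> \<bar>b\<bar> * K * norm v"
      using order_trans[OF K(2)] by (simp add: mult_ac)
  qed
qed

lemma norm_input_term_le:
  fixes A :: "real ^ 'n ^ 'n" and B :: "real ^ 'm ^ 'n"
  assumes L: "L \<ge> 0" "\<And>v. norm (mat_exp (t *\<^sub>R A) *v v) \<le> L * norm v" "\<And>v. norm (B *v v) \<le> L * norm v"
    and v: "norm v \<le> b"
  shows "norm (mat_exp (t *\<^sub>R A) *v (B *v v)) \<le> L * (L * b)"
proof -
  have "norm (B *v v) \<le> L * b" by (rule order_trans[OF L(3)]) (intro mult_left_mono v L)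
  then show ?thesis by (intro order_trans[OF L(2)] mult_left_mono L)
qed

text \<open>An arbitrary common bound \<open>S\<close> of the data postpones all suprema to the
  final theorem. The input is bounded from time -h on, since the window in the stability estimate
  reaches back that far.\<close>

lemma closed_loop_decay:
  fixes A :: "real ^ 'n ^ 'n" and B :: "real ^ 'm ^ 'n" and k :: "real ^ 'n ^ 'm"
  assumes r: "r \<ge> 0" and \<tau>: "\<tau> \<ge> 0"
    and roots: "\<And>s. det (char_mat (A + B ** k) (mat_exp (r *\<^sub>R A) ** B ** k) r \<tau> s) = 0 \<Longrightarrow> Re s < 0"
  obtains K \<sigma> where "K > 0" "\<sigma> > 0"
    "\<And>x0 u0 x u S t. \<lbrakk>admissible_initial_data A B k r \<tau> x0 u0; closed_loop_solution A B k r \<tau> x0 u0 x u;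
       norm x0 \<le> S; \<And>s. s \<in> {- max r \<tau>..0} \<Longrightarrow> norm (u0 s) \<le> S; t \<ge> - max r \<tau>\<rbrakk>
       \<Longrightarrow> norm (u t) \<le> K * S * exp (- \<sigma> * t) \<and> (t \<ge> 0 \<longrightarrow> norm (x t) \<le> K * S * exp (- \<sigma> * t))"
proof (rule delay_solution_decay[of r \<tau> "A + B ** k" "mat_exp (r *\<^sub>R A) ** B ** k", OF r \<tau> roots])
  fix Q \<sigma> :: real
  assume Q: "Q > 0" and \<sigma>: "\<sigma> > 0"
    and decay: "\<And>p P z0 z t. \<lbrakk>continuous_on UNIV p; \<And>t. norm (p t) \<le> P; \<And>t. t \<ge> max r \<tau> \<Longrightarrow> p t = 0;
       delay_solution (A + B ** k) (mat_exp (r *\<^sub>R A) ** B ** k) r \<tau> p z0 z; t \<ge> 0\<rbrakk>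
       \<Longrightarrow> norm (z t) \<le> Q * (norm z0 + P) * exp (- \<sigma> * t)"
  define h where "h = max r \<tau>"
  have h: "h \<ge> 0" "r \<le> h" "\<tau> \<le> h" using r \<tau> by (auto simp: h_def)
  obtain L1 where L1: "L1 \<ge> 0" "\<And>t v. \<bar>t\<bar> \<le> r \<Longrightarrow> norm (mat_exp (t *\<^sub>R A) *v v) \<le> L1 * norm v"
    using mat_exp_bounded_on_interval[where A=A and r=r] by blast
  obtain L2 where L2: "L2 \<ge> 0" "\<And>v. norm (B *v v) \<le> norm v * L2"
    using bounded_linear.nonneg_bounded[OF matrix_vector_mul_bounded_linear[of B]] by blast
  obtain L3 where L3: "L3 \<ge> 0" "\<And>v. norm (k *v v) \<le> norm v * L3"
    using bounded_linear.nonneg_bounded[OF matrix_vector_mul_bounded_linear[of k]] by blast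
  define L where "L = L1 + L2 + L3"
  have L: "L \<ge> 0" using L1 L2 L3 by (simp add: L_def)
  have LE: "norm (mat_exp (t *\<^sub>R A) *v v) \<le> L * norm v" if "\<bar>t\<bar> \<le> r" for t v
    by (rule order_trans[OF L1(2)[OF that]], rule mult_right_mono) (use L1 L2 L3 in \<open>auto simp: L_def\<close>)
  have LB: "norm (B *v v) \<le> L * norm v" for v
    by (rule order_trans[OF L2(2)], subst mult.commute, rule mult_right_mono) (use L1 L2 L3 in \<open>auto simp: L_def\<close>)
  have Lk: "norm (k *v v) \<le> L * norm v" for v
    by (rule order_trans[OF L3(2)], subst mult.commute, rule mult_right_mono) (use L1 L2 L3 in \<open>auto simp: L_def\<close>)
  \<comment> \<open>Successive factors of \<open>S\<close>: \<open>K1\<close> for the initial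
    predictor, \<open>K2\<close> with the forcing added, \<open>K3\<close> for the predictor,
    \<open>K4\<close> for the input (its 1 covers the history), and \<open>K5\<close> for the
    state.\<close>
  define K1 where "K1 = L + L * L * r"
  define K2 where "K2 = K1 + L * (L * (2 * (1 + L * K1)))"
  define K3 where "K3 = Q * K2"
  define K4 where "K4 = L * K3 + 1"
  define K5 where "K5 = L * (K3 + L * (L * (K4 * exp (\<sigma> * h))) * r)"
  define K where "K = K4 + K5"
  have K0: "K1 \<ge> 0" "K2 \<ge> 0" "K3 \<ge> 0" "K4 \<ge> 1" "K5 \<ge> 0"
    using L r Q by (simp_all add: K1_def K2_def K3_def K4_def K5_def)
  have "K > 0" using K0 by (simp add: K_def)
  show thesis
  proof (rule that[OF \<open>K > 0\<close> \<sigma>])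
    fix x0 u0 x u and S t :: real
    assume adm: "admissible_initial_data A B k r \<tau> x0 u0" and sol: "closed_loop_solution A B k r \<tau> x0 u0 x u"
      and x0S: "norm x0 \<le> S" and "\<And>s. s \<in> {- max r \<tau>..0} \<Longrightarrow> norm (u0 s) \<le> S"
      and "t \<ge> - max r \<tau>"
    then have u0S: "\<And>s. - h \<le> s \<Longrightarrow> s \<le> 0 \<Longrightarrow> norm (u0 s) \<le> S" and th: "t \<ge> - h" by (auto simp: h_def)
    have S0: "S \<ge> 0" using x0S norm_ge_zero order_trans by blast
    have u0c: "continuous_on {- h..0} u0" using adm by (simp add: admissible_initial_data_def h_def)
    have uu0: "\<And>t. t \<in> {- h..0} \<Longrightarrow> u t = u0 t" and uc: "continuous_on {- h..} u"
      using sol by (auto simp: closed_loop_solution_def h_def)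
    have uc': "continuous_on {- r..} u" by (rule continuous_on_subset[OF uc]) (use h in auto)
    define z0 where "z0 = initial_predictor A B r x0 u0"
    define c where "c = input_offset k h z0 u0"
    define p where "p = delay_forcing A B r \<tau> c"
    define z where "z t = mat_exp (r *\<^sub>R A) *v x t + input_integral A B r u t" for t
    have z0S: "norm z0 \<le> K1 * S"
    proof -
      have "norm (integral {- r..0} (\<lambda>s. mat_exp ((- s) *\<^sub>R A) *v (B *v u0 s))) \<le> (L * (L * S)) * (0 - (- r))"
      proof (rule integral_bound)
        show "continuous_on {- r..0} (\<lambda>s. mat_exp ((- s) *\<^sub>R A) *v (B *v u0 s))"
          by (intro continuous_on_mat_exp_input continuous_intros continuous_on_subset[OF u0c]) (use h in auto)
        fix s assume s: "s \<in> {- r..0}"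
        show "norm (mat_exp ((- s) *\<^sub>R A) *v (B *v u0 s)) \<le> L * (L * S)"
          by (rule norm_input_term_le[OF L LE LB]) (use s h in \<open>auto intro!: u0S\<close>)
      qed (use r in auto)
      moreover have "norm (mat_exp (r *\<^sub>R A) *v x0) \<le> L * S"
        by (rule order_trans[OF LE]) (use r in \<open>auto intro!: mult_left_mono L x0S\<close>)
      ultimately show ?thesis
        unfolding z0_def initial_predictor_def
        by (intro norm_triangle_le) (simp add: K1_def algebra_simps)
    qed
    have cS: "norm (c t) \<le> (1 + L * K1) * S" for t
    proof -
      have "norm (c t) \<le> S + L * (K1 * S)"
        unfolding c_def input_offset_def
        by (rule order_trans[OF norm_triangle_ineq4], rule add_mono[OF u0S order_trans[OF Lk mult_left_mono[OF z0S L]]])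
          (use h in auto)
      then show ?thesis by (simp add: algebra_simps)
    qed
    have pS: "norm (p t) \<le> L * (L * (2 * ((1 + L * K1) * S)))" for t
      unfolding p_def delay_forcing_def
    proof (rule norm_input_term_le[OF L LE LB])
      show "norm (c (t - \<tau>) - c (t - r)) \<le> 2 * ((1 + L * K1) * S)"
        using norm_triangle_ineq4[of "c (t - \<tau>)" "c (t - r)"] cS[of "t - \<tau>"] cS[of "t - r"] by linarith
    qed (use r in simp)
    have pc: "continuous_on UNIV p"
      unfolding p_def c_def by (intro continuous_on_delay_forcing continuous_on_input_offset u0c h)
    have c0: "c t = 0" if "t \<ge> 0" for t
      using that admissible_initial_input[OF adm] h by (simp add: c_def input_offset_def z0_def max_def)
    have p0: "p t = 0" if "t \<ge> h" for t
      using c0 that h by (simp add: p_def delay_forcing_def)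
    have zS: "norm (z t) \<le> K3 * S * exp (- \<sigma> * t)" if t: "t \<ge> 0" for t
    proof -
      have "norm (z (max 0 t)) \<le> Q * (norm z0 + L * (L * (2 * ((1 + L * K1) * S)))) * exp (- \<sigma> * t)"
        by (rule decay[OF pc pS _ _ t, of z0 "\<lambda>t. z (max 0 t)"])
          (use p0 closed_loop_delay_solution[OF r \<tau> adm sol] in \<open>simp_all add: h_def p_def c_def z0_def z_def\<close>)
      also have "\<dots> \<le> Q * (K1 * S + L * (L * (2 * ((1 + L * K1) * S)))) * exp (- \<sigma> * t)"
        using Q z0S by (intro mult_right_mono mult_left_mono add_right_mono) auto
      also have "\<dots> = K3 * S * exp (- \<sigma> * t)" by (simp add: K3_def K2_def algebra_simps)
      finally show ?thesis using t by (simp add: max_def)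
    qed
    have uS: "norm (u t) \<le> K4 * S * exp (- \<sigma> * t)" if t: "t \<ge> - h" for t
    proof (cases "t \<ge> 0")
      case True
      have "norm (u t) \<le> L * (K3 * S * exp (- \<sigma> * t))"
        unfolding closed_loop_input_eq[OF sol True] z_def[symmetric]
        by (intro order_trans[OF Lk] mult_left_mono zS True L)
      also have "\<dots> \<le> L * (K3 * S * exp (- \<sigma> * t)) + 1 * (S * exp (- \<sigma> * t))" using S0 by simp
      finally show ?thesis by (simp add: K4_def algebra_simps)
    next
      case False
      \<comment> \<open>At negative times exp(-\<sigma> t) is at least 1 and so is
        \<open>K4\<close>; the plain bound on the history suffices.\<close>
      have "norm (u t) \<le> 1 * S * 1" using uu0[of t] u0S[of t] t False by simp
      also have "\<dots> \<le> K4 * S * exp (- \<sigma> * t)"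
        using K0 S0 \<sigma> False by (intro mult_mono) (auto simp: mult_nonneg_nonpos2 mult_nonneg_nonpos)
      finally show ?thesis .
    qed
    have K: "K4 \<le> K" "K5 \<le> K" using K0 by (auto simp: K_def)
    have "norm (u t) \<le> K * S * exp (- \<sigma> * t)"
      by (rule order_trans[OF uS[OF th]]) (intro mult_right_mono K S0, simp)
    moreover have "norm (x t) \<le> K * S * exp (- \<sigma> * t)" if t: "t \<ge> 0"
    proof -
      \<comment> \<open>All inputs under the integral belong to times not before
        \<open>t - h\<close>, which costs a factor exp(\<sigma> h).\<close>
      have "norm (input_integral A B r u t) \<le> (L * (L * (K4 * S * exp (- \<sigma> * (t - h))))) * ((t + r) - t)"
        unfolding input_integral_def
      proof (rule integral_bound)
        have "continuous_on {t..t + r} (\<lambda>s. u (s - r))"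
          by (rule continuous_on_compose2[OF uc']) (use t in \<open>auto intro!: continuous_intros\<close>)
        then show "continuous_on {t..t + r} (\<lambda>s. mat_exp ((t + r - s) *\<^sub>R A) *v (B *v u (s - r)))"
          by (intro continuous_on_mat_exp_input continuous_intros)
        fix s assume s: "s \<in> {t..t + r}"
        show "norm (mat_exp ((t + r - s) *\<^sub>R A) *v (B *v u (s - r))) \<le> L * (L * (K4 * S * exp (- \<sigma> * (t - h))))"
        proof (rule norm_input_term_le[OF L LE LB])
          have "norm (u (s - r)) \<le> K4 * S * exp (- \<sigma> * (s - r))" by (rule uS) (use s t h in auto)
          also have "\<dots> \<le> K4 * S * exp (- \<sigma> * (t - h))"
            using K0 S0 \<sigma> s h by (intro mult_left_mono) auto
          finally show "norm (u (s - r)) \<le> K4 * S * exp (- \<sigma> * (t - h))" .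
        qed (use s in auto)
      qed (use r in auto)
      also have "\<dots> = L * (L * (K4 * exp (\<sigma> * h))) * r * S * exp (- \<sigma> * t)"
        by (simp add: algebra_simps exp_diff exp_minus field_simps)
      finally have "norm (input_integral A B r u t) \<le> L * (L * (K4 * exp (\<sigma> * h))) * r * S * exp (- \<sigma> * t)" .
      then have diff: "norm (z t - input_integral A B r u t)
          \<le> K3 * S * exp (- \<sigma> * t) + L * (L * (K4 * exp (\<sigma> * h))) * r * S * exp (- \<sigma> * t)"
        by (intro order_trans[OF norm_triangle_ineq4] add_mono zS[OF t])
      have "x t = mat_exp ((- r) *\<^sub>R A) *v (z t - input_integral A B r u t)"
        by (simp add: z_def matrix_vector_mul_assoc)
      then have "norm (x t) \<le> L * norm (z t - input_integral A B r u t)"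
        using LE[of "- r"] r by simp
      also have "\<dots> \<le> L * (K3 * S * exp (- \<sigma> * t) + L * (L * (K4 * exp (\<sigma> * h))) * r * S * exp (- \<sigma> * t))"
        by (rule mult_left_mono[OF diff L])
      also have "\<dots> = K5 * S * exp (- \<sigma> * t)" by (simp add: K5_def algebra_simps)
      also have "\<dots> \<le> K * S * exp (- \<sigma> * t)" by (intro mult_right_mono K S0) simp
      finally show ?thesis .
    qed
    ultimately show "norm (u t) \<le> K * S * exp (- \<sigma> * t) \<and> (t \<ge> 0 \<longrightarrow> norm (x t) \<le> K * S * exp (- \<sigma> * t))"
      by blast
  qed
qed

theorem corollary2p3:
  fixes A :: "real ^ 'n ^ 'n" and B :: "real ^ 'm ^ 'n" and k :: "real ^ 'n ^ 'm"
    and r \<tau> :: real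
  assumes "\<tau> \<ge> 0" and "r \<ge> 0"
    and "Hurwitz (A + B ** k)"
    and "(\<forall>s::complex.
            det (mat s - cmat (A + B ** k)
                 + cmat (B ** k ** mat_exp (r *\<^sub>R A))
                   ** mat (exp (- of_real r * s) - exp (- of_real \<tau> * s))) = 0
            \<longrightarrow> Re s < 0)
       \<or> (\<forall>s::complex.
            det (mat s - cmat (A + B ** k)
                 + cmat (mat_exp (r *\<^sub>R A) ** B ** k)
                   ** mat (exp (- of_real r * s) - exp (- of_real \<tau> * s))) = 0
            \<longrightarrow> Re s < 0)"
  shows "globally_exponentially_stable A B k r \<tau>"
proof -
  define h where "h = max r \<tau>"
  have h: "h \<ge> 0" using assms by (simp add: h_def)
  have "det (char_mat (A + B ** k) (B ** k ** mat_exp (r *\<^sub>R A)) r \<tau> s)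
      = det (char_mat (A + B ** k) (mat_exp (r *\<^sub>R A) ** B ** k) r \<tau> s)" for s
    using det_char_mat_commute[OF mat_exp_commute[of r A], of "B ** k"] by (simp add: matrix_mul_assoc)
  with assms(4) have roots:
    "\<And>s. det (char_mat (A + B ** k) (mat_exp (r *\<^sub>R A) ** B ** k) r \<tau> s) = 0 \<Longrightarrow> Re s < 0"
    unfolding char_mat_def by metis
  show ?thesis
  proof (rule closed_loop_decay[OF assms(2,1) roots, folded h_def])
    fix K \<sigma> :: real
    assume K: "K > 0" and \<sigma>: "\<sigma> > 0"
      and decay: "\<And>x0 u0 x u S t. \<lbrakk>admissible_initial_data A B k r \<tau> x0 u0; closed_loop_solution A B k r \<tau> x0 u0 x u;
         norm x0 \<le> S; \<And>s. s \<in> {- h..0} \<Longrightarrow> norm (u0 s) \<le> S; t \<ge> - h\<rbrakk>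
         \<Longrightarrow> norm (u t) \<le> K * S * exp (- \<sigma> * t) \<and> (t \<ge> 0 \<longrightarrow> norm (x t) \<le> K * S * exp (- \<sigma> * t))"
    \<comment> \<open>The 1 accounts for the state and exp(\<sigma> h) for the supremum of the input
      over a window of length \<open>h\<close>.\<close>
    define Q where "Q = K * (1 + exp (\<sigma> * h))"
    have Q: "Q > 0" using K by (simp add: Q_def add_pos_pos)
    have "norm (x t) + (SUP s\<in>{t - h..t}. norm (u s))
        \<le> Q * exp (- \<sigma> * t) * (norm x0 + (SUP s\<in>{- h..0}. norm (u0 s)))"
      if adm: "admissible_initial_data A B k r \<tau> x0 u0" and sol: "closed_loop_solution A B k r \<tau> x0 u0 x u"
        and t: "t \<ge> 0" for x0 u0 x u t
    proof -
      have "continuous_on {- h..0} (\<lambda>s. norm (u0 s))"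
        using adm by (intro continuous_intros) (simp add: admissible_initial_data_def h_def)
      then have bdd: "bdd_above ((\<lambda>s. norm (u0 s)) ` {- h..0})"
        by (intro bounded_imp_bdd_above compact_imp_bounded compact_continuous_image) auto
      define S where "S = norm x0 + (SUP s\<in>{- h..0}. norm (u0 s))"
      have sup: "norm (u0 s) \<le> (SUP s\<in>{- h..0}. norm (u0 s))" if "s \<in> {- h..0}" for s
        by (rule cSUP_upper[OF that bdd])
      have sup0: "0 \<le> (SUP s\<in>{- h..0}. norm (u0 s))"
        by (rule order_trans[OF norm_ge_zero sup[of 0]]) (use h in auto)
      have S: "norm x0 \<le> S" "\<And>s. s \<in> {- h..0} \<Longrightarrow> norm (u0 s) \<le> S" "S \<ge> 0"
        using sup sup0 by (auto simp: S_def add_increasing)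
      note bound = decay[OF adm sol S(1,2)]
      have "norm (x t) \<le> K * S * exp (- \<sigma> * t)" using bound[of t] t h by simp
      moreover have "(SUP s\<in>{t - h..t}. norm (u s)) \<le> K * S * exp (\<sigma> * h) * exp (- \<sigma> * t)"
      proof (rule cSUP_least)
        fix s assume s: "s \<in> {t - h..t}"
        then have "norm (u s) \<le> K * S * exp (- \<sigma> * s)" using bound[of s] t by simp
        also have "\<dots> \<le> K * S * exp (\<sigma> * (h - t))"
        proof -
          have "\<sigma> * (t - h) \<le> \<sigma> * s" using \<sigma> s by (intro mult_left_mono) auto
          then have "exp (- \<sigma> * s) \<le> exp (\<sigma> * (h - t))" by (simp add: algebra_simps)
          then show ?thesis using K S(3) by (intro mult_left_mono) auto
        qed
        also have "\<dots> = K * S * exp (\<sigma> * h) * exp (- \<sigma> * t)"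
          by (simp add: mult.assoc mult_exp_exp algebra_simps)
        finally show "norm (u s) \<le> K * S * exp (\<sigma> * h) * exp (- \<sigma> * t)" .
      qed (use h in auto)
      ultimately show ?thesis by (simp add: Q_def algebra_simps flip: S_def)
    qed
    moreover have "\<exists>x u. closed_loop_solution A B k r \<tau> x0 u0 x u"
      if "admissible_initial_data A B k r \<tau> x0 u0" for x0 u0
      using closed_loop_exists[OF assms(2,1) that] by blast
    ultimately show ?thesis
      unfolding globally_exponentially_stable_def Let_def h_def[symmetric] using Q \<sigma> by blast
  qed
qed

end
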